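(* Let $n\ge2$ and let $\gamma:S^1\times[0,\omega)\to\mathbb{R}^n$ be a solution of curve shortening flow with a singularity forming at time $\omega$. Then any nontrivial blow-up limit of $\gamma$ is planar (contained in a two-dimensional affine subspace of $\mathbb{R}^n$) and convex (without inflection points, i.e. its curvature vanishes nowhere).
   Context: A smooth family of immersions $\gamma:S^1\times[0,\omega)\to\mathbb{R}^n$ is a solution of curve shortening flow if $\partial\gamma/\partial t=\kappa N=\partial^2\gamma/\partial s^2$, where $s$ is arclength of $\gamma(\cdot,t)$, $\kappa=|\partial^2\gamma/\partial s^2|$ is the curvature and $N$ the unit normal. A singularity forms at time $\omega$ means that $\omega<\infty$ is the maximal time of smooth existence. A sequence $\{(p_j,t_j)\}\subset S^1\times[0,\omega)$ is a blow-up sequence if $t_j\to\omega$ and $\kappa^2(p_j,t_j)\to\infty$ as $j\to\infty$. The associated rescaled solutions are $$\gamma_j(\cdot,\bar t)=\lambda_j\bigl(A_j\gamma(\cdot,t)+b_j\bigr),\qquad \bar t=\lambda_j^2(t-t_j)\in[-\lambda_j^2t_j,\ \lambda_j^2(\omega-t_j)),$$ with $\lambda_j=\kappa(p_j,t_j)$ and $A_j\in\mathrm{SO}(n)$, $b_j\in\mathbb{R}^n$ chosen so that $\gamma_j(p_j,0)=0$ and the Frenet–Serret frame $(T,N,B_1,\dots,B_{n-2})$ of $\gamma_j(\cdot,0)$ at $p_j$ (as far as it is defined) is the standard basis $(e_1,\dots,e_n)$. They are regarded as families of curves on $\mathbb{R}$, periodic in space, parametrised by arclength with $0\in\mathbb{R}$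 corresponding to $p_j$. A blow-up limit of $\gamma$ is a smooth solution $\gamma_\infty$ of curve shortening flow, existing at least on $(-\infty,0]$, which is the limit of a subsequence of such rescaled solutions in the sense of smooth convergence, uniform on compact subsets of space-time. It is nontrivial if it is not a straight line. *)

theory Defs
  imports "HOL-Analysis.Analysis"
begin

section \<open>Smooth families of curves\<close>

text \<open>
  A family of curves is a function \<open>f\<close> of a space parameter \<open>u\<close>, ranging over the whole real line,
  and a time \<open>t\<close>, ranging over an interval \<open>J\<close>; its values for \<open>t \<notin> J\<close> are irrelevant.
  At an end point belonging to \<open>J\<close> the time derivatives are one-sided.
\<close>

definition space_deriv :: "(real \<Rightarrow> real \<Rightarrow> 'a::real_normed_vector) \<Rightarrow> real \<Rightarrow> real \<Rightarrow> 'a" where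
  "space_deriv f = (\<lambda>u t. vector_derivative (\<lambda>v. f v t) (at u))"

definition time_deriv :: "real set \<Rightarrow> (real \<Rightarrow> real \<Rightarrow> 'a::real_normed_vector) \<Rightarrow> real \<Rightarrow> real \<Rightarrow> 'a" where
  "time_deriv J f = (\<lambda>u t. vector_derivative (\<lambda>s. f u s) (at t within J))"

definition mixed_deriv ::
    "real set \<Rightarrow> nat \<Rightarrow> nat \<Rightarrow> (real \<Rightarrow> real \<Rightarrow> 'a::real_normed_vector) \<Rightarrow> real \<Rightarrow> real \<Rightarrow> 'a" where
  "mixed_deriv J k l f = (space_deriv ^^ k) ((time_deriv J ^^ l) f)"

text \<open>All mixed partial derivatives exist on \<open>UNIV \<times> J\<close>, are jointly continuous, and commute.\<close>

definition smooth_family :: "real set \<Rightarrow> (real \<Rightarrow> real \<Rightarrow> 'a::real_normed_vector) \<Rightarrow> bool" where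
  "smooth_family J f \<longleftrightarrow> (\<forall>k l.
      continuous_on (UNIV \<times> J) (\<lambda>(u, t). mixed_deriv J k l f u t) \<and>
      (\<forall>u. \<forall>t\<in>J.
        ((\<lambda>v. mixed_deriv J k l f v t) has_vector_derivative mixed_deriv J (Suc k) l f u t) (at u) \<and>
        ((\<lambda>s. mixed_deriv J k l f u s) has_vector_derivative mixed_deriv J k (Suc l) f u t)
          (at t within J)))"

text \<open>
  Smooth convergence, uniform on compact subsets of space-time. The \<open>j\<close>-th family is defined for
  times in \<open>J j\<close>, so it need only be defined on a given compact set for large \<open>j\<close>.
\<close>

definition converges_smoothly ::
    "(nat \<Rightarrow> real set) \<Rightarrow> (nat \<Rightarrow> real \<Rightarrow> real \<Rightarrow> 'a::real_normed_vector) \<Rightarrow>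
     real set \<Rightarrow> (real \<Rightarrow> real \<Rightarrow> 'a) \<Rightarrow> bool" where
  "converges_smoothly J f I g \<longleftrightarrow> (\<forall>K. compact K \<and> K \<subseteq> UNIV \<times> I \<longrightarrow>
      (\<forall>\<^sub>F j in sequentially. K \<subseteq> UNIV \<times> J j) \<and>
      (\<forall>k l. uniform_limit K (\<lambda>j (u, t). mixed_deriv (J j) k l (f j) u t)
               (\<lambda>(u, t). mixed_deriv I k l g u t) sequentially))"


section \<open>Arclength and curvature\<close>

text \<open>\<open>arclength_deriv c k\<close> is \<open>\<partial>\<^sup>k c / \<partial>s\<^sup>k\<close>, where \<open>\<partial>/\<partial>s = (1 / norm c') \<partial>/\<partial>u\<close>.\<close>

definition arclength_deriv :: "(real \<Rightarrow> 'a::real_normed_vector) \<Rightarrow> nat \<Rightarrow> real \<Rightarrow> 'a" where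
  "arclength_deriv c k =
     ((\<lambda>f u. vector_derivative f (at u) /\<^sub>R norm (vector_derivative c (at u))) ^^ k) c"

definition curvature :: "(real \<Rightarrow> 'a::real_normed_vector) \<Rightarrow> real \<Rightarrow> real" where
  "curvature c u = norm (arclength_deriv c 2 u)"

text \<open>\<open>c \<circ> \<phi>\<close> is the reparametrisation of \<open>c\<close> by arclength, with the same orientation and with
  arclength measured from the parameter \<open>u0\<close>.\<close>

definition arclength_parametrisation ::
    "(real \<Rightarrow> 'a::real_normed_vector) \<Rightarrow> real \<Rightarrow> (real \<Rightarrow> real) \<Rightarrow> bool" where
  "arclength_parametrisation c u0 \<phi> \<longleftrightarrow>
     \<phi> 0 = u0 \<and> strict_mono \<phi> \<and> (\<forall>v. \<phi> differentiable (at v)) \<and>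
     (\<forall>v. norm (vector_derivative (c \<circ> \<phi>) (at v)) = 1)"


section \<open>Frenet--Serret frames\<close>

text \<open>
  \<open>standard_basis k\<close> for \<open>k = 1, \<dots>, n\<close> is the standard basis \<open>e\<^sub>1, \<dots>, e\<^sub>n\<close>, in the order given by the
  library's fixed enumeration of the finite index type.
\<close>

definition standard_basis :: "nat \<Rightarrow> real ^ 'n" where
  "standard_basis k = axis (from_nat_into UNIV (k - 1)) 1"

text \<open>
  \<open>E 1, \<dots>, E n\<close> (that is, \<open>T, N, B\<^sub>1, \<dots>, B\<^sub>n\<^sub>-\<^sub>2\<close>) is a Frenet--Serret frame of \<open>c\<close> at \<open>u\<close>: it is
  orthonormal and positively oriented, and for \<open>k < n\<close> its first \<open>k\<close> vectors arise by Gram--Schmidt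
  from the first \<open>k\<close> arclength derivatives, provided the latter are linearly independent.
  The vectors for which this fails are those for which the frame is not defined, and they are
  unconstrained. As usual the last vector is fixed by the orientation and not by the \<open>n\<close>-th
  derivative; in particular in the plane \<open>N\<close> is \<open>T\<close> rotated by a quarter turn. Otherwise one could
  not, in general, move the frame to the standard basis by an element of \<open>SO(n)\<close>.
\<close>

definition frenet_frame :: "(real \<Rightarrow> real ^ 'n) \<Rightarrow> real \<Rightarrow> (nat \<Rightarrow> real ^ 'n) \<Rightarrow> bool" where
  "frenet_frame c u E \<longleftrightarrow>
     (\<exists>R. rotation_matrix R \<and> (\<forall>k\<in>{1..CARD('n)}. E k = R *v standard_basis k)) \<and>
     (\<forall>k\<in>{1..<CARD('n)}.
        dim ((\<lambda>i. arclength_deriv c i u) ` {1..k}) = k \<longrightarrow>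
        span (E ` {1..k}) = span ((\<lambda>i. arclength_deriv c i u) ` {1..k}) \<and>
        E k \<bullet> arclength_deriv c k u > 0)"


section \<open>Curve shortening flow\<close>

text \<open>The vector \<open>\<kappa> N\<close> is \<open>\<partial>\<^sup>2\<gamma>/\<partial>s\<^sup>2\<close>, also at points where \<open>\<kappa> = 0\<close> and \<open>N\<close> is undefined.\<close>

definition csf_solution :: "real set \<Rightarrow> (real \<Rightarrow> real \<Rightarrow> real ^ 'n) \<Rightarrow> bool" where
  "csf_solution J \<gamma> \<longleftrightarrow> smooth_family J \<gamma> \<and>
     (\<forall>u. \<forall>t\<in>J. space_deriv \<gamma> u t \<noteq> 0 \<and>
        time_deriv J \<gamma> u t = arclength_deriv (\<lambda>v. \<gamma> v t) 2 u)"

text \<open>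
  The circle \<open>S\<^sup>1\<close> is the unit circle in the complex plane, and families on it are
  differentiated in the angle, i.e. after lifting along \<open>cis\<close>.
\<close>

definition lift_circle :: "(complex \<Rightarrow> real \<Rightarrow> 'a) \<Rightarrow> real \<Rightarrow> real \<Rightarrow> 'a" where
  "lift_circle \<gamma> = (\<lambda>u t. \<gamma> (cis u) t)"

definition csf_circle :: "real \<Rightarrow> (complex \<Rightarrow> real \<Rightarrow> real ^ 'n) \<Rightarrow> bool" where
  "csf_circle \<omega> \<gamma> \<longleftrightarrow> 0 < \<omega> \<and> csf_solution {0..<\<omega>} (lift_circle \<gamma>)"

definition singularity_at :: "real \<Rightarrow> (complex \<Rightarrow> real \<Rightarrow> real ^ 'n) \<Rightarrow> bool" where
  "singularity_at \<omega> \<gamma> \<longleftrightarrow>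
     \<not> (\<exists>\<omega>'>\<omega>. \<exists>\<gamma>'. csf_circle \<omega>' \<gamma>' \<and>
           (\<forall>p\<in>sphere 0 1. \<forall>t\<in>{0..<\<omega>}. \<gamma>' p t = \<gamma> p t))"

definition circle_curvature :: "(complex \<Rightarrow> real \<Rightarrow> real ^ 'n) \<Rightarrow> complex \<Rightarrow> real \<Rightarrow> real" where
  "circle_curvature \<gamma> p t = curvature (\<lambda>u. lift_circle \<gamma> u t) (Arg p)"


section \<open>Blow-up limits\<close>

definition blow_up_sequence ::
    "real \<Rightarrow> (complex \<Rightarrow> real \<Rightarrow> real ^ 'n) \<Rightarrow> (nat \<Rightarrow> complex) \<Rightarrow> (nat \<Rightarrow> real) \<Rightarrow> bool" where
  "blow_up_sequence \<omega> \<gamma> p t \<longleftrightarrow>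
     (\<forall>j. p j \<in> sphere 0 1 \<and> t j \<in> {0..<\<omega>}) \<and> t \<longlonglongrightarrow> \<omega> \<and>
     filterlim (\<lambda>j. (circle_curvature \<gamma> (p j) (t j))\<^sup>2) at_top sequentially"

text \<open>The rescaled time interval \<open>[- \<lambda>\<^sup>2 t0, \<lambda>\<^sup>2 (\<omega> - t0))\<close>, and the rescaled family in terms of the
  original (angular) space parameter.\<close>

definition rescaled_times :: "real \<Rightarrow> real \<Rightarrow> real \<Rightarrow> real set" where
  "rescaled_times \<omega> l t0 = {- (l\<^sup>2 * t0)..<l\<^sup>2 * (\<omega> - t0)}"

definition rescaled_family ::
    "(complex \<Rightarrow> real \<Rightarrow> real ^ 'n) \<Rightarrow> real \<Rightarrow> real \<Rightarrow> real ^ 'n ^ 'n \<Rightarrow> real ^ 'n \<Rightarrow>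
     real \<Rightarrow> real \<Rightarrow> real ^ 'n" where
  "rescaled_family \<gamma> l t0 A b = (\<lambda>u \<tau>. l *\<^sub>R (A *v lift_circle \<gamma> u (t0 + \<tau> / l\<^sup>2) + b))"

text \<open>
  \<open>g\<close> is the rescaled solution at \<open>(p, t0)\<close>, as a family of curves on the real line.
  Its space parameter is arclength at rescaled time \<open>0\<close>, measured from \<open>p\<close>, and is kept fixed in
  time. It cannot be arclength at every time: \<open>\<partial>\<gamma>/\<partial>t = \<partial>\<^sup>2\<gamma>/\<partial>s\<^sup>2\<close> does not preserve arclength where
  \<open>\<kappa> \<noteq> 0\<close>.
\<close>

definition rescaled_solution ::
    "(complex \<Rightarrow> real \<Rightarrow> real ^ 'n) \<Rightarrow> complex \<Rightarrow> real \<Rightarrow> (real \<Rightarrow> real \<Rightarrow> real ^ 'n) \<Rightarrow> bool" where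
  "rescaled_solution \<gamma> p t0 g \<longleftrightarrow>
     (\<exists>A b \<phi>. let h = rescaled_family \<gamma> (circle_curvature \<gamma> p t0) t0 A b in
        rotation_matrix A \<and>
        h (Arg p) 0 = 0 \<and>
        frenet_frame (\<lambda>u. h u 0) (Arg p) standard_basis \<and>
        arclength_parametrisation (\<lambda>u. h u 0) (Arg p) \<phi> \<and>
        g = (\<lambda>v \<tau>. h (\<phi> v) \<tau>))"

text \<open>
  \<open>\<Gamma>\<close>, defined for times in the interval \<open>I\<close>, is a blow-up limit of \<open>\<gamma>\<close>. Only finitely many terms
  of a blow-up sequence can have curvature zero; these have no rescaling and are ignored.
\<close>

definition blow_up_limit ::
    "real \<Rightarrow> (complex \<Rightarrow> real \<Rightarrow> real ^ 'n) \<Rightarrow> real set \<Rightarrow> (real \<Rightarrow> real \<Rightarrow> real ^ 'n) \<Rightarrow> bool" where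
  "blow_up_limit \<omega> \<gamma> I \<Gamma> \<longleftrightarrow>
     is_interval I \<and> {..0} \<subseteq> I \<and> csf_solution I \<Gamma> \<and>
     (\<exists>p t g r. blow_up_sequence \<omega> \<gamma> p t \<and>
        (\<forall>j. circle_curvature \<gamma> (p j) (t j) > 0 \<longrightarrow> rescaled_solution \<gamma> (p j) (t j) (g j)) \<and>
        strict_mono (r :: nat \<Rightarrow> nat) \<and>
        converges_smoothly
          (\<lambda>j. rescaled_times \<omega> (circle_curvature \<gamma> (p (r j)) (t (r j))) (t (r j)))
          (\<lambda>j. g (r j)) I \<Gamma>)"

definition is_straight_line :: "real set \<Rightarrow> (real \<Rightarrow> real \<Rightarrow> real ^ 'n) \<Rightarrow> bool" where
  "is_straight_line I \<gamma> \<longleftrightarrow>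
     (\<exists>a d. d \<noteq> 0 \<and> (\<forall>t\<in>I. range (\<lambda>u. \<gamma> u t) = {a + s *\<^sub>R d | s. True}))"

definition planar :: "real set \<Rightarrow> (real \<Rightarrow> real \<Rightarrow> real ^ 'n) \<Rightarrow> bool" where
  "planar I \<gamma> \<longleftrightarrow> (\<exists>P. affine P \<and> aff_dim P = 2 \<and> (\<forall>u. \<forall>t\<in>I. \<gamma> u t \<in> P))"

definition convex_family :: "real set \<Rightarrow> (real \<Rightarrow> real \<Rightarrow> real ^ 'n) \<Rightarrow> bool" where
  "convex_family I \<gamma> \<longleftrightarrow> (\<forall>u. \<forall>t\<in>I. curvature (\<lambda>v. \<gamma> v t) u \<noteq> 0)"

end

theory Submission
  imports Defs
begin

text \<open>The proof rests on one monotone quantity, the total curvature. Write \<open>T\<close> for the unit tangent,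
  \<open>k = T\<^sub>s\<close> for the curvature vector and \<open>f = \<surd>(\<epsilon>\<^sup>2 + |k|\<^sup>2)\<close> with \<open>\<epsilon> > 0\<close>, a smooth substitute for the
  curvature. Along the flow \<open>f\<^sub>t = f\<^sub>s\<^sub>s + |k|\<^sup>2 f - D\<close> with a dissipation \<open>D \<ge> 0\<close>
  (\<open>reg_curvature_t\<close>, \<open>dissipation_nonneg\<close>), while the length element decays at the rate \<open>|k|\<^sup>2\<close>. Hence
  the integral of \<open>f\<close> over a closed curve decreases exactly at the rate \<open>\<integral> D ds\<close>
  (\<open>total_reg_curvature_t\<close>), and \<open>\<epsilon> \<rightarrow> 0\<close> shows that the total curvature is nonincreasing. Being
  nonnegative, it converges as \<open>t \<rightarrow> \<omega>\<close>. It is also scale invariant, and two fixed rescaled times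
  of a blow-up sequence are original times which both tend to \<open>\<omega>\<close>. So the space-time integral of the
  dissipation of the rescaled flows over any fixed compact set tends to zero
  (\<open>total_reg_curvature_drop\<close>, \<open>rescaled_dissipation_le\<close>). The locale \<open>csf_approximation\<close> records this
  together with the convergence of the frames. The limit then has three properties.

  First, \<open>D\<close> controls the part of \<open>k\<^sub>s\<close> that is orthogonal to \<open>T\<close> and \<open>k\<close>, so this part vanishes in the
  limit (\<open>limit_dissipation_zero\<close>): wherever \<open>k \<noteq> 0\<close> the torsion is zero.

  Second, the functions \<open>f\<close> of the rescaled flows are supersolutions of the heat equation up to the
  error \<open>D\<close>, which tends to zero in \<open>L\<^sup>1\<close>. An integral comparison with explicit barriers survives the
  limit \<open>\<epsilon> \<rightarrow> 0\<close> and gives the strong maximum principle for the curvature \<open>|k|\<close> of the limit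
  (\<open>strong_maximum_principle\<close>): if \<open>|k|\<close> vanishes at one point, it vanishes at all earlier times. The
  comparison is made with the smooth functions \<open>f\<close>, since \<open>|k|\<close> need not be differentiable at its zeros.

  Third, a limit that is straight at an earlier time stays straight up to time \<open>0\<close>
  (\<open>straight_stays_straight\<close>). The limit is parametrised by arclength on all of \<open>\<real>\<close> at time \<open>0\<close>, and
  lengths only decrease, so at earlier times both ends are infinitely long and nothing can enter from
  infinity. Since the normalisation gives \<open>|k| = 1\<close> at the
  origin, the second and third property exclude every zero of \<open>k\<close> (\<open>curvature_never_zero\<close>). With
  \<open>k \<noteq> 0\<close> everywhere, the first property makes the plane spanned by \<open>T\<close> and \<open>k\<close> invariant under
  linear differential equations in space and in time, so it is constant (\<open>planar_if_no_torsion\<close>).\<close>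

section \<open>Real-variable preliminaries\<close>

lemma nonincreasing_within:
  fixes f :: "real \<Rightarrow> real"
  assumes "a \<le> b"
    and d: "\<And>x. x \<in> {a..b} \<Longrightarrow> (f has_real_derivative f' x) (at x within {a..b})"
    and neg: "\<And>x. x \<in> {a..b} \<Longrightarrow> f' x \<le> 0"
  shows "f b \<le> f a"
proof -
  have "\<exists>x\<in>{a..b}. f b - f a = f' x * (b - a)"
    by (rule mvt_very_simple[OF \<open>a \<le> b\<close>, where f' = "\<lambda>x y. f' x * y"])
      (use d in \<open>auto simp: has_field_derivative_def\<close>)
  then obtain x where "x \<in> {a..b}" "f b - f a = f' x * (b - a)" by blast
  with neg[of x] \<open>a \<le> b\<close> show ?thesis
    by (smt (verit) mult_nonpos_nonneg)
qed

lemma continuous_on_slice: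
  assumes "continuous_on (UNIV \<times> J) (\<lambda>(u, t). h u t)" "t \<in> J"
  shows "continuous_on S (\<lambda>u. h u t)"
proof -
  have "continuous_on S (\<lambda>u. (u, t))" by (intro continuous_intros)
  from continuous_on_compose2[OF assms(1) this] assms(2) show ?thesis by auto
qed

lemma continuous_on_swap:
  assumes "continuous_on (UNIV \<times> J) (\<lambda>(u, t). h u t)" "U \<subseteq> J"
  shows "continuous_on (U \<times> S) (\<lambda>(t, u). h u t)"
  using continuous_on_compose2[OF assms(1), of "U \<times> S" "\<lambda>x. (snd x, fst x)"] assms(2)
  by (force intro!: continuous_intros simp: split_beta)

lemma has_integral_real_derivative:
  fixes w :: "real \<Rightarrow> real"
  assumes "\<And>u. (w has_real_derivative w' u) (at u)" "a \<le> b"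
  shows "(w' has_integral (w b - w a)) {a..b}"
  using assms by (intro fundamental_theorem_of_calculus)
    (auto simp: has_real_derivative_iff_has_vector_derivative[symmetric] intro: has_field_derivative_at_within)

lemma has_real_derivative_sqrt:
  assumes "(h has_real_derivative h') (at x within S)" "h x > 0"
  shows "((\<lambda>y. sqrt (h y)) has_real_derivative h' / (2 * sqrt (h x))) (at x within S)"
  using DERIV_chain2[where g = h and x = x, OF DERIV_real_sqrt[OF assms(2)] assms(1)]
  by (rule DERIV_cong) (simp add: field_simps)

lemma integral_nonneg_eq_0_imp:
  fixes f :: "real \<Rightarrow> real"
  assumes "continuous_on {a..b} f" "\<And>x. x \<in> {a..b} \<Longrightarrow> 0 \<le> f x" "integral {a..b} f \<le> 0"
    "x \<in> {a..b}" "a < b"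
  shows "f x = 0"
proof -
  have "integral {a..b} f = 0"
    using assms by (intro antisym integral_nonneg integrable_continuous_interval) auto
  then show ?thesis
    using integral_eq_0_iff[of a b f] assms by (auto simp: cbox_interval)
qed

text \<open>Powers of the positive part are differentiable from exponent two on. This is why comparison
  integrals below use the third power of the positive part: its derivative is again such a power.\<close>

lemma has_real_derivative_pos_part_power:
  assumes "n \<ge> 2"
  shows "((\<lambda>x::real. max 0 x ^ n) has_real_derivative real n * max 0 x ^ (n - 1)) (at x)"
proof -
  consider "x > 0" | "x < 0" | "x = 0" by linarith
  then show ?thesis
  proof cases
    case 1
    have "((\<lambda>x::real. x ^ n) has_real_derivative real n * max 0 x ^ (n - 1)) (at x)"
      using 1 by (auto intro!: derivative_eq_intros)
    then show ?thesis
      by (rule has_field_derivative_transform_within[where d = x]) (use 1 in \<open>auto simp: dist_real_def\<close>)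
  next
    case 2
    have "((\<lambda>x::real. 0) has_real_derivative real n * max 0 x ^ (n - 1)) (at x)"
      using 2 assms by (auto simp: max_def power_0_left)
    then show ?thesis
      by (rule has_field_derivative_transform_within[where d = "- x"])
        (use 2 assms in \<open>auto simp: dist_real_def max_def\<close>)
  next
    case 3
    have "((\<lambda>y::real. \<bar>y\<bar> ^ (n - 1)) \<longlongrightarrow> \<bar>0\<bar> ^ (n - 1)) (at 0)"
      by (intro tendsto_intros)
    then have "((\<lambda>y::real. \<bar>y\<bar> ^ (n - 1)) \<longlongrightarrow> 0) (at 0)"
      using assms by (simp add: power_0_left del: tendsto_rabs_zero_iff)
    moreover have "\<forall>\<^sub>F y::real in at 0. norm (max 0 y ^ n / y) \<le> \<bar>y\<bar> ^ (n - 1)"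
    proof (rule always_eventually, rule allI)
      fix y :: real
      obtain m where "n = Suc m" using assms by (cases n) auto
      then show "norm (max 0 y ^ n / y) \<le> \<bar>y\<bar> ^ (n - 1)"
        by (auto simp: max_def abs_mult power_abs)
    qed
    ultimately have "((\<lambda>y::real. max 0 y ^ n / y) \<longlongrightarrow> 0) (at 0)"
      by (rule Lim_null_comparison[rotated])
    then show ?thesis using assms 3 by (simp add: has_field_derivative_iff power_0_left)
  qed
qed

lemma at_within_interval_neq_bot:
  fixes J :: "real set"
  assumes "is_interval J" "a \<in> J" "b \<in> J" "a \<noteq> b" "t \<in> J"
  shows "at t within J \<noteq> bot"
proof -
  have "connected J" using assms(1) by (simp add: is_interval_connected)
  then have "t islimpt J" using assms by (intro connected_imp_perfect) auto
  then show ?thesis by (simp add: trivial_limit_within)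
qed

lemma interval_subset:
  fixes J :: "real set"
  assumes "is_interval J" "s \<in> J" "t \<in> J"
  shows "{s..t} \<subseteq> J"
proof
  fix x assume "x \<in> {s..t}"
  then have "s \<le> x \<and> x \<le> t" by simp
  with assms show "x \<in> J" unfolding is_interval_1 by blast
qed

text \<open>The extra period accounts for the position of \<open>a\<close> inside a period.\<close>

lemma integral_periodic_le:
  fixes G :: "real \<Rightarrow> real"
  assumes p: "p > 0" and per: "\<And>u. G (u + p) = G u" and cont: "continuous_on UNIV G"
    and nn: "\<And>u. G u \<ge> 0" and ab: "b - a \<le> real N * p"
  shows "integral {a..b} G \<le> (real N + 1) * integral {0..p} G"
proof -
  have int: "G integrable_on {c..d}" for c d
    using cont by (intro integrable_continuous_interval) (auto intro: continuous_on_subset)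
  have pern: "G (u + real n * p) = G u" for u n
  proof (induction n)
    case (Suc n)
    have "G (u + real (Suc n) * p) = G ((u + real n * p) + p)" by (simp add: algebra_simps)
    then show ?case using Suc per by simp
  qed simp
  have peri: "G (u + of_int i * p) = G u" for u and i :: int
  proof (cases "i \<ge> 0")
    case True
    then show ?thesis using pern[of u "nat i"] by simp
  next
    case False
    then show ?thesis using pern[of "u + of_int i * p" "nat (- i)"] by (simp add: algebra_simps)
  qed
  have one: "integral {of_int i * p..of_int i * p + p} G = integral {0..p} G" for i :: int
  proof -
    have "integral {0..p} (G \<circ> (\<lambda>x. x + of_int i * p)) = integral {0 + of_int i * p..p + of_int i * p} G"
      by (rule integral_shift) (use cont in \<open>auto intro: continuous_on_subset\<close>)
    then show ?thesis by (simp add: o_def peri add.commute)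
  qed
  have many: "integral {of_int i * p..of_int i * p + real n * p} G = real n * integral {0..p} G" for i :: int and n
  proof (induction n)
    case (Suc n)
    have "integral {of_int i * p..of_int i * p + real n * p} G
        + integral {of_int i * p + real n * p..of_int i * p + real (Suc n) * p} G
        = integral {of_int i * p..of_int i * p + real (Suc n) * p} G"
      using p by (intro Henstock_Kurzweil_Integration.integral_combine int) (auto simp: algebra_simps)
    moreover have "integral {of_int i * p + real n * p..of_int i * p + real (Suc n) * p} G = integral {0..p} G"
      using one[of "i + int n"] by (simp add: algebra_simps)
    ultimately show ?case using Suc by (simp add: algebra_simps)
  qed simp
  define i where "i = \<lfloor>a / p\<rfloor>"
  have i: "of_int i * p \<le> a" "a \<le> of_int i * p + p"
  proof -
    have "of_int i \<le> a / p" "a / p \<le> of_int i + 1" unfolding i_def by linarith+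
    then show "of_int i * p \<le> a" "a \<le> of_int i * p + p"
      using p by (simp_all only: pos_le_divide_eq pos_divide_le_eq distrib_right mult_1)
  qed
  have "integral {a..b} G \<le> integral {of_int i * p..of_int i * p + real (Suc N) * p} G"
    using i ab nn by (intro integral_subset_le int) (auto simp: algebra_simps)
  also have "\<dots> = real (Suc N) * integral {0..p} G" by (rule many)
  finally show ?thesis by (simp add: add.commute)
qed

lemma continuous_greater_near:
  fixes f :: "real \<Rightarrow> real"
  assumes "continuous_on UNIV f" "c < f x"
  obtains d where "d > 0" "\<And>y. \<bar>y - x\<bar> \<le> d \<Longrightarrow> c < f y"
proof -
  obtain d where d: "d > 0" "\<And>y. dist y x < d \<Longrightarrow> dist (f y) (f x) < f x - c"
    using assms unfolding continuous_on_iff by (metis UNIV_I diff_gt_0_iff_gt)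
  show thesis
  proof
    show "d / 2 > 0" using d by simp
    fix y assume "\<bar>y - x\<bar> \<le> d / 2"
    with d have "dist (f y) (f x) < f x - c" by (simp add: dist_real_def)
    then show "c < f y" by (simp add: dist_real_def abs_less_iff)
  qed
qed

text \<open>The approximating families exist only at the times in \<open>J j\<close> and, as rescalings, only for some
  indices. Identities between their derivatives are therefore available only there.\<close>

lemma uniform_limit_transfer:
  assumes ul: "uniform_limit (S \<times> R) (\<lambda>j (u, t). a j u t) (\<lambda>(u, t). b u t) F"
    and good: "\<forall>\<^sub>F j in F. good j \<and> R \<subseteq> J j"
    and eq: "\<And>j u t. good j \<Longrightarrow> t \<in> J j \<Longrightarrow> a j u t = a' j u t" "\<And>u t. t \<in> R \<Longrightarrow> b u t = b' u t"
  shows "uniform_limit (S \<times> R) (\<lambda>j (u, t). a' j u t) (\<lambda>(u, t). b' u t) F"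
proof -
  have "\<forall>\<^sub>F j in F. \<forall>x\<in>S \<times> R. (case x of (u, t) \<Rightarrow> a j u t) = (case x of (u, t) \<Rightarrow> a' j u t)"
    using good by eventually_elim (auto intro: eq(1))
  from uniform_limit_cong[OF this, of "\<lambda>(u, t). b u t" "\<lambda>(u, t). b' u t"] ul eq(2) show ?thesis by auto
qed

lemma constant_within:
  fixes f :: "real \<Rightarrow> real"
  assumes d: "\<And>x. x \<in> {a..b} \<Longrightarrow> (f has_real_derivative 0) (at x within {a..b})"
    and xy: "x \<in> {a..b}" "y \<in> {a..b}"
  shows "f x = f y"
proof -
  have *: "f y = f x" if "x \<le> y" "x \<in> {a..b}" "y \<in> {a..b}" for x y
  proof (rule antisym)
    have d': "(f has_real_derivative 0) (at z within {x..y})" if "z \<in> {x..y}" for z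
      using that \<open>x \<in> {a..b}\<close> \<open>y \<in> {a..b}\<close> by (intro has_field_derivative_subset[OF d]) auto
    show "f y \<le> f x" by (rule nonincreasing_within[OF that(1) d']) auto
    have "- f y \<le> - f x"
      by (rule nonincreasing_within[OF that(1), of "\<lambda>z. - f z"]) (use DERIV_minus[OF d'] in auto)
    then show "f x \<le> f y" by simp
  qed
  show ?thesis using *[of x y] *[of y x] xy by (cases "x \<le> y") auto
qed

lemma gronwall_zero:
  fixes E :: "real \<Rightarrow> real"
  assumes d: "\<And>x. x \<in> {a..b} \<Longrightarrow> (E has_real_derivative E' x) (at x within {a..b})"
    and le: "\<And>x. x \<in> {a..b} \<Longrightarrow> \<bar>E' x\<bar> \<le> C * E x" and nn: "\<And>x. E x \<ge> 0"
    and x0: "x0 \<in> {a..b}" "E x0 = 0" and x: "x \<in> {a..b}"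
  shows "E x = 0"
proof (cases "x0 \<le> x")
  case True
  have "exp (- C * x) * E x \<le> exp (- C * x0) * E x0"
  proof (rule nonincreasing_within[OF True])
    fix y assume y: "y \<in> {x0..x}"
    then have yab: "y \<in> {a..b}" and sub: "{x0..x} \<subseteq> {a..b}" using x x0 by auto
    show "((\<lambda>x. exp (- C * x) * E x) has_real_derivative exp (- C * y) * (E' y - C * E y)) (at y within {x0..x})"
      by (auto intro!: derivative_eq_intros has_field_derivative_subset[OF d[OF yab] sub] simp: algebra_simps)
    show "exp (- C * y) * (E' y - C * E y) \<le> 0"
      using le[OF yab] by (intro mult_nonneg_nonpos) auto
  qed
  then have "exp (- C * x) * E x \<le> 0" using x0 by simp
  then have "E x \<le> 0" by (simp add: mult_le_0_iff not_le[symmetric])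
  with nn[of x] show ?thesis by simp
next
  case False
  then have le': "x \<le> x0" by simp
  have "- (exp (C * x0) * E x0) \<le> - (exp (C * x) * E x)"
  proof (rule nonincreasing_within[OF le'])
    fix y assume y: "y \<in> {x..x0}"
    then have yab: "y \<in> {a..b}" and sub: "{x..x0} \<subseteq> {a..b}" using x x0 by auto
    show "((\<lambda>x. - (exp (C * x) * E x)) has_real_derivative - (exp (C * y) * (E' y + C * E y))) (at y within {x..x0})"
      by (auto intro!: derivative_eq_intros has_field_derivative_subset[OF d[OF yab] sub] simp: algebra_simps)
    show "- (exp (C * y) * (E' y + C * E y)) \<le> 0"
      using le[OF yab] by (simp add: mult_nonneg_nonneg abs_le_iff)
  qed
  then have "exp (C * x) * E x \<le> 0" using x0 by simp
  then have "E x \<le> 0" by (simp add: mult_le_0_iff not_le[symmetric])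
  with nn[of x] show ?thesis by simp
qed

text \<open>The system satisfied by the components \<open>a = T \<bullet> z\<close> and \<open>b = k \<bullet> z\<close> of a planar frame along a fixed
  vector \<open>z\<close>, in space as well as in time. Gronwall's inequality for \<open>a\<^sup>2 + b\<^sup>2\<close> gives uniqueness.\<close>

lemma linear_system_zero:
  fixes a b :: "real \<Rightarrow> real"
  assumes a: "\<And>x. x \<in> {l..r} \<Longrightarrow> (a has_real_derivative m12 x * b x) (at x within {l..r})"
    and b: "\<And>x. x \<in> {l..r} \<Longrightarrow> (b has_real_derivative m21 x * a x + m22 x * b x) (at x within {l..r})"
    and cont: "continuous_on {l..r} m12" "continuous_on {l..r} m21" "continuous_on {l..r} m22"
    and x0: "x0 \<in> {l..r}" "a x0 = 0" "b x0 = 0" and x: "x \<in> {l..r}"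
  shows "a x = 0" "b x = 0"
proof -
  have "bounded (m ` {l..r})" if "continuous_on {l..r} m" for m :: "real \<Rightarrow> real"
    by (intro compact_imp_bounded compact_continuous_image that compact_Icc)
  then have bd: "\<exists>B. \<forall>x\<in>{l..r}. \<bar>m x\<bar> \<le> B" if "continuous_on {l..r} m" for m :: "real \<Rightarrow> real"
    using that unfolding bounded_iff by simp
  obtain B1 where B1: "\<And>x. x \<in> {l..r} \<Longrightarrow> \<bar>m12 x\<bar> \<le> B1" using bd[OF cont(1)] by blast
  obtain B2 where B2: "\<And>x. x \<in> {l..r} \<Longrightarrow> \<bar>m21 x\<bar> \<le> B2" using bd[OF cont(2)] by blast
  obtain B3 where B3: "\<And>x. x \<in> {l..r} \<Longrightarrow> \<bar>m22 x\<bar> \<le> B3" using bd[OF cont(3)] by blast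
  define E where "E = (\<lambda>x. (a x)\<^sup>2 + (b x)\<^sup>2)"
  have "E x = 0"
  proof (rule gronwall_zero[OF _ _ _ x0(1) _ x])
    fix y assume y: "y \<in> {l..r}"
    show "(E has_real_derivative 2 * a y * (m12 y * b y) + 2 * b y * (m21 y * a y + m22 y * b y)) (at y within {l..r})"
      unfolding E_def by (auto intro!: derivative_eq_intros a[OF y] b[OF y])
    have ab: "2 * \<bar>a y\<bar> * \<bar>b y\<bar> \<le> E y"
      using sum_squares_bound[of "\<bar>a y\<bar>" "\<bar>b y\<bar>"] by (simp add: E_def)
    have bb: "\<bar>b y\<bar> * \<bar>b y\<bar> \<le> E y" by (simp add: E_def power2_eq_square[symmetric])
    have nn: "0 \<le> E y" by (simp add: E_def)
    have "\<bar>2 * a y * (m12 y * b y) + 2 * b y * (m21 y * a y + m22 y * b y)\<bar>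
      \<le> \<bar>m12 y\<bar> * (2 * \<bar>a y\<bar> * \<bar>b y\<bar>) + \<bar>m21 y\<bar> * (2 * \<bar>a y\<bar> * \<bar>b y\<bar>) + 2 * (\<bar>m22 y\<bar> * (\<bar>b y\<bar> * \<bar>b y\<bar>))"
    proof -
      have "2 * a y * (m12 y * b y) + 2 * b y * (m21 y * a y + m22 y * b y)
        = m12 y * (2 * a y * b y) + m21 y * (2 * a y * b y) + 2 * (m22 y * (b y * b y))"
        by (simp add: algebra_simps)
      also have "\<bar>\<dots>\<bar> \<le> \<bar>m12 y * (2 * a y * b y)\<bar> + \<bar>m21 y * (2 * a y * b y)\<bar> + \<bar>2 * (m22 y * (b y * b y))\<bar>"
        by linarith
      finally show ?thesis by (simp add: abs_mult)
    qed
    also have "\<dots> \<le> B1 * E y + B2 * E y + 2 * (B3 * E y)"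
      using B1[OF y] B2[OF y] B3[OF y] ab bb nn by (intro add_mono mult_mono mult_left_mono) auto
    also have "\<dots> = (B1 + B2 + 2 * B3) * E y" by (simp add: algebra_simps)
    finally show "\<bar>2 * a y * (m12 y * b y) + 2 * b y * (m21 y * a y + m22 y * b y)\<bar> \<le> (B1 + B2 + 2 * B3) * E y" .
  qed (simp_all add: E_def x0)
  then show "a x = 0" "b x = 0" by (simp_all add: E_def sum_power2_eq_zero_iff)
qed

lemma bounded_increment:
  fixes \<phi> :: "real \<Rightarrow> real"
  assumes mono: "mono \<phi>" and \<delta>: "\<delta> > 0" and M: "M \<ge> 0" and P: "P \<ge> 0"
    and step: "\<And>v. v \<in> {-M..M} \<Longrightarrow> \<phi> (v + \<delta>) - \<phi> v \<le> P"
  shows "\<phi> M - \<phi> (- M) \<le> real (nat \<lceil>2 * M / \<delta>\<rceil>) * P"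
proof -
  define n where "n = nat \<lceil>2 * M / \<delta>\<rceil>"
  have n: "2 * M / \<delta> \<le> real n" unfolding n_def by linarith
  have i: "\<phi> (- M + real i * \<delta>) - \<phi> (- M) \<le> real i * P" if "i \<le> n" for i
    using that
  proof (induction i)
    case (Suc i)
    have "real i \<le> 2 * M / \<delta>" using Suc.prems unfolding n_def by linarith
    then have "real i * \<delta> \<le> 2 * M" using \<delta> by (simp add: field_simps)
    then have "- M + real i * \<delta> \<in> {-M..M}" using \<delta> by auto
    from step[OF this] Suc show ?case by (simp add: algebra_simps)
  qed simp
  have "M \<le> - M + real n * \<delta>" using n \<delta> by (simp add: field_simps)
  then have "\<phi> M \<le> \<phi> (- M + real n * \<delta>)" by (rule monoD[OF mono])
  with i[of n] show ?thesis by (simp add: n_def)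
qed

section \<open>The arclength frame and the regularised curvature\<close>

text \<open>The curvature \<open>|k|\<close> made smooth at its zeros.\<close>

definition reg_curvature :: "real \<Rightarrow> 'a::real_inner \<Rightarrow> real" where
  "reg_curvature \<epsilon> k = sqrt (\<epsilon>\<^sup>2 + k \<bullet> k)"

text \<open>Here \<open>k1\<close> stands for \<open>k\<^sub>s\<close>. Its normal part \<open>p = k1 + |k|\<^sup>2 T\<close> satisfies \<open>|p|\<^sup>2 = |k1|\<^sup>2 - |k|\<^sup>4\<close> and
  \<open>k \<bullet> p = k \<bullet> k1\<close>. Where \<open>k \<noteq> 0\<close>, the value at \<open>\<epsilon> = 0\<close> is therefore \<open>|k|\<close> times the squared speed at which
  the direction of \<open>k\<close> turns in the normal space, that is \<open>\<tau>\<^sup>2 |k|\<close> for a space curve of torsion \<open>\<tau>\<close>.\<close>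

definition dissipation :: "real \<Rightarrow> 'a::real_inner \<Rightarrow> 'a \<Rightarrow> real" where
  "dissipation \<epsilon> k k1 =
     (k1 \<bullet> k1 - (k \<bullet> k)\<^sup>2 - (k \<bullet> k1)\<^sup>2 / (\<epsilon>\<^sup>2 + k \<bullet> k) + \<epsilon>\<^sup>2 * (k \<bullet> k)) / reg_curvature \<epsilon> k"

lemma reg_curvature_pos: "\<epsilon> > 0 \<Longrightarrow> reg_curvature \<epsilon> k > 0"
  by (simp add: reg_curvature_def add_pos_nonneg)

lemma reg_curvature_nonzero: "\<epsilon> > 0 \<Longrightarrow> reg_curvature \<epsilon> k \<noteq> 0"
  using reg_curvature_pos[of \<epsilon> k] by simp

lemma reg_curvature_sq: "reg_curvature \<epsilon> k ^ 2 = \<epsilon>\<^sup>2 + k \<bullet> k"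
  by (simp add: reg_curvature_def)

lemma reg_curvature_ge: "norm k \<le> reg_curvature \<epsilon> k"
  by (simp add: reg_curvature_def norm_eq_sqrt_inner)

lemma reg_curvature_le: "\<epsilon> > 0 \<Longrightarrow> reg_curvature \<epsilon> k \<le> \<epsilon> + norm k"
  unfolding reg_curvature_def
  by (rule real_le_lsqrt) (auto simp: power2_sum power2_norm_eq_inner)

text \<open>The frame of a family of curves: the speed \<open>g\<close> and its space derivative \<open>g'\<close>, the unit tangent \<open>T\<close>, and
  the arclength derivatives \<open>k = T\<^sub>s\<close>, \<open>k1 = k\<^sub>s\<close>, \<open>k2 = k1\<^sub>s\<close>, where \<open>\<partial>/\<partial>s = (1 / g) \<partial>/\<partial>u\<close>. The derivatives
  are separate parameters, and not defined from the curve, so that rescaling a flow merely substitutes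
  functions for them.\<close>

locale arclength_frame =
  fixes J :: "real set" and g g' :: "real \<Rightarrow> real \<Rightarrow> real"
    and T k k1 k2 :: "real \<Rightarrow> real \<Rightarrow> 'a::euclidean_space"
  assumes J: "is_interval J"
    and cont_g: "continuous_on (UNIV \<times> J) (\<lambda>(u, t). g u t)"
    and cont_g': "continuous_on (UNIV \<times> J) (\<lambda>(u, t). g' u t)"
    and cont_T: "continuous_on (UNIV \<times> J) (\<lambda>(u, t). T u t)"
    and cont_k: "continuous_on (UNIV \<times> J) (\<lambda>(u, t). k u t)"
    and cont_k1: "continuous_on (UNIV \<times> J) (\<lambda>(u, t). k1 u t)"
    and cont_k2: "continuous_on (UNIV \<times> J) (\<lambda>(u, t). k2 u t)"
    and g_pos: "\<And>u t. t \<in> J \<Longrightarrow> g u t > 0"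
    and T_T: "\<And>u t. t \<in> J \<Longrightarrow> T u t \<bullet> T u t = 1"
    and g_u: "\<And>u t. t \<in> J \<Longrightarrow> ((\<lambda>v. g v t) has_real_derivative g' u t) (at u)"
    and T_u: "\<And>u t. t \<in> J \<Longrightarrow> ((\<lambda>v. T v t) has_vector_derivative g u t *\<^sub>R k u t) (at u)"
    and k_u: "\<And>u t. t \<in> J \<Longrightarrow> ((\<lambda>v. k v t) has_vector_derivative g u t *\<^sub>R k1 u t) (at u)"
    and k1_u: "\<And>u t. t \<in> J \<Longrightarrow> ((\<lambda>v. k1 v t) has_vector_derivative g u t *\<^sub>R k2 u t) (at u)"
begin

lemma inner_u:
  fixes a b :: "real \<Rightarrow> 'b::real_inner"
  assumes "(a has_vector_derivative a') (at u)" "(b has_vector_derivative b') (at u)"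
  shows "((\<lambda>v. a v \<bullet> b v) has_vector_derivative a u \<bullet> b' + a' \<bullet> b u) (at u)"
  using assms by (rule bounded_bilinear.has_vector_derivative[OF bounded_bilinear_inner])

lemma T_k:
  assumes "t \<in> J" shows "T u t \<bullet> k u t = 0"
proof -
  have "((\<lambda>v. T v t \<bullet> T v t) has_vector_derivative 0) (at u)" using assms by (simp add: T_T)
  from vector_derivative_unique_at[OF this inner_u[OF T_u[OF assms] T_u[OF assms]]] g_pos[OF assms, of u]
  show ?thesis by (auto simp: inner_commute)
qed

lemma T_k1:
  assumes "t \<in> J" shows "T u t \<bullet> k1 u t = - (k u t \<bullet> k u t)"
proof -
  have "((\<lambda>v. T v t \<bullet> k v t) has_vector_derivative 0) (at u)" using assms by (simp add: T_k)
  from vector_derivative_unique_at[OF this inner_u[OF T_u[OF assms] k_u[OF assms]]]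
  have "g u t * (T u t \<bullet> k1 u t + k u t \<bullet> k u t) = 0" by (simp add: algebra_simps)
  with g_pos[OF assms, of u] show ?thesis by simp
qed

lemma T_k2:
  assumes "t \<in> J" shows "T u t \<bullet> k2 u t = - 3 * (k u t \<bullet> k1 u t)"
proof -
  have "((\<lambda>v. T v t \<bullet> k1 v t + k v t \<bullet> k v t) has_vector_derivative 0) (at u)"
    using assms by (simp add: T_k1)
  from vector_derivative_unique_at[OF this has_vector_derivative_add[OF inner_u[OF T_u[OF assms] k1_u[OF assms]]
        inner_u[OF k_u[OF assms] k_u[OF assms]]]]
  have "g u t * (T u t \<bullet> k2 u t + 3 * (k u t \<bullet> k1 u t)) = 0"
    by (simp add: inner_commute algebra_simps)
  with g_pos[OF assms, of u] show ?thesis by simp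
qed

end

text \<open>The evolution equations of the frame under \<open>X\<^sub>t = k\<close>. They come from the commutation rule
  \<open>\<partial>/\<partial>t \<partial>/\<partial>s = \<partial>/\<partial>s \<partial>/\<partial>t + |k|\<^sup>2 \<partial>/\<partial>s\<close>.\<close>

locale csf_frame = arclength_frame J g g' T k k1 k2
  for J :: "real set" and X :: "real \<Rightarrow> real \<Rightarrow> 'a::euclidean_space" and g g' :: "real \<Rightarrow> real \<Rightarrow> real"
    and T k k1 k2 :: "real \<Rightarrow> real \<Rightarrow> 'a" +
  assumes X_u: "\<And>u t. t \<in> J \<Longrightarrow> ((\<lambda>v. X v t) has_vector_derivative g u t *\<^sub>R T u t) (at u)"
    and X_t: "\<And>u t. t \<in> J \<Longrightarrow> ((\<lambda>s. X u s) has_vector_derivative k u t) (at t within J)"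
    and g_t: "\<And>u t. t \<in> J \<Longrightarrow>
       ((\<lambda>s. g u s) has_real_derivative - (k u t \<bullet> k u t) * g u t) (at t within J)"
    and T_t: "\<And>u t. t \<in> J \<Longrightarrow>
       ((\<lambda>s. T u s) has_vector_derivative k1 u t + (k u t \<bullet> k u t) *\<^sub>R T u t) (at t within J)"
    and k_t: "\<And>u t. t \<in> J \<Longrightarrow>
       ((\<lambda>s. k u s) has_vector_derivative
          k2 u t + (2 * (k u t \<bullet> k1 u t)) *\<^sub>R T u t + (2 * (k u t \<bullet> k u t)) *\<^sub>R k u t) (at t within J)"
begin

text \<open>The normal part of \<open>k1\<close> is \<open>k1 + |k|\<^sup>2 T\<close>. Its inner product with \<open>k\<close> is \<open>k \<bullet> k1\<close>.\<close>

lemma normal_part_Cauchy_Schwarz: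
  assumes "t \<in> J"
  shows "(k u t \<bullet> k1 u t)\<^sup>2 \<le> (k u t \<bullet> k u t) * (k1 u t \<bullet> k1 u t - (k u t \<bullet> k u t)\<^sup>2)"
    and "0 \<le> k1 u t \<bullet> k1 u t - (k u t \<bullet> k u t)\<^sup>2"
proof -
  define p where "p = k1 u t + (k u t \<bullet> k u t) *\<^sub>R T u t"
  have kp: "k u t \<bullet> p = k u t \<bullet> k1 u t"
    using T_k[OF assms, of u] by (simp add: p_def inner_right_distrib inner_commute)
  have pp: "p \<bullet> p = k1 u t \<bullet> k1 u t - (k u t \<bullet> k u t)\<^sup>2"
    using T_k1[OF assms, of u] T_T[OF assms, of u]
    by (simp add: p_def inner_simps inner_commute power2_eq_square)
  show "(k u t \<bullet> k1 u t)\<^sup>2 \<le> (k u t \<bullet> k u t) * (k1 u t \<bullet> k1 u t - (k u t \<bullet> k u t)\<^sup>2)"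
    using Cauchy_Schwarz_ineq[of "k u t" p] by (simp add: kp pp)
  show "0 \<le> k1 u t \<bullet> k1 u t - (k u t \<bullet> k u t)\<^sup>2"
    using inner_ge_zero[of p] by (simp add: pp)
qed

text \<open>The numerator is the squared area of the parallelogram spanned by \<open>k\<close> and the normal part of \<open>k1\<close>.
  Being a polynomial in the frame, it passes to limits even where \<open>k\<close> tends to zero.\<close>

lemma dissipation_ge:
  assumes "t \<in> J" "\<epsilon> > 0"
  shows "dissipation \<epsilon> (k u t) (k1 u t) \<ge>
    ((k u t \<bullet> k u t) * (k1 u t \<bullet> k1 u t - (k u t \<bullet> k u t)\<^sup>2) - (k u t \<bullet> k1 u t)\<^sup>2)
      / reg_curvature \<epsilon> (k u t) ^ 3"
proof -
  let ?K = "k u t \<bullet> k u t" and ?P = "k1 u t \<bullet> k1 u t - (k u t \<bullet> k u t)\<^sup>2" and ?m = "k u t \<bullet> k1 u t"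
  let ?f = "reg_curvature \<epsilon> (k u t)"
  have f: "?f > 0" "?f ^ 2 = \<epsilon>\<^sup>2 + ?K" using assms by (auto simp: reg_curvature_pos reg_curvature_sq)
  have s: "\<epsilon>\<^sup>2 + ?K > 0" using assms by (simp add: add_pos_nonneg)
  have P: "?P \<ge> 0" by (rule normal_part_Cauchy_Schwarz[OF assms(1)])
  have "(?K * ?P - ?m\<^sup>2) / (\<epsilon>\<^sup>2 + ?K) \<le> ?P - ?m\<^sup>2 / (\<epsilon>\<^sup>2 + ?K) + \<epsilon>\<^sup>2 * ?K"
  proof -
    have "?K * ?P / (\<epsilon>\<^sup>2 + ?K) \<le> ?P"
      using s P by (simp add: pos_divide_le_eq mult.commute[of ?P] mult_right_mono)
    moreover have "0 \<le> \<epsilon>\<^sup>2 * ?K" by simp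
    ultimately show ?thesis unfolding diff_divide_distrib by linarith
  qed
  then have "(?K * ?P - ?m\<^sup>2) / (\<epsilon>\<^sup>2 + ?K) / ?f \<le> (?P - ?m\<^sup>2 / (\<epsilon>\<^sup>2 + ?K) + \<epsilon>\<^sup>2 * ?K) / ?f"
    using f(1) by (intro divide_right_mono) auto
  moreover have "?f ^ 3 = (\<epsilon>\<^sup>2 + ?K) * ?f"
    using f(2) by (simp add: power3_eq_cube power2_eq_square)
  ultimately show ?thesis
    by (simp add: dissipation_def)
qed

lemma dissipation_nonneg:
  assumes "t \<in> J" "\<epsilon> > 0"
  shows "dissipation \<epsilon> (k u t) (k1 u t) \<ge> 0"
proof -
  have "0 \<le> ((k u t \<bullet> k u t) * (k1 u t \<bullet> k1 u t - (k u t \<bullet> k u t)\<^sup>2) - (k u t \<bullet> k1 u t)\<^sup>2)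
      / reg_curvature \<epsilon> (k u t) ^ 3"
    using normal_part_Cauchy_Schwarz(1)[OF assms(1), of u] reg_curvature_pos[OF assms(2), of "k u t"]
    by (intro divide_nonneg_pos) auto
  with dissipation_ge[OF assms, of u] show ?thesis by linarith
qed

text \<open>The first and second arclength derivatives of the regularised curvature.\<close>

definition f_s :: "real \<Rightarrow> real \<Rightarrow> real \<Rightarrow> real" where
  "f_s \<epsilon> u t = (k u t \<bullet> k1 u t) / reg_curvature \<epsilon> (k u t)"

definition f_ss :: "real \<Rightarrow> real \<Rightarrow> real \<Rightarrow> real" where
  "f_ss \<epsilon> u t = (k1 u t \<bullet> k1 u t + k u t \<bullet> k2 u t) / reg_curvature \<epsilon> (k u t)
     - (k u t \<bullet> k1 u t)\<^sup>2 / reg_curvature \<epsilon> (k u t) ^ 3"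

lemma inner_k_u:
  assumes "t \<in> J"
  shows "((\<lambda>v. k v t \<bullet> k v t) has_real_derivative g u t * (2 * (k u t \<bullet> k1 u t))) (at u)"
    and "((\<lambda>v. k v t \<bullet> k1 v t) has_real_derivative g u t * (k1 u t \<bullet> k1 u t + k u t \<bullet> k2 u t)) (at u)"
  using bounded_bilinear.has_vector_derivative[OF bounded_bilinear_inner k_u[OF assms, of u] k_u[OF assms, of u]]
    bounded_bilinear.has_vector_derivative[OF bounded_bilinear_inner k_u[OF assms, of u] k1_u[OF assms, of u]]
  by (simp_all add: has_real_derivative_iff_has_vector_derivative inner_commute algebra_simps)

lemma reg_curvature_u:
  assumes "t \<in> J" "\<epsilon> > 0"
  shows "((\<lambda>v. reg_curvature \<epsilon> (k v t)) has_real_derivative g u t * f_s \<epsilon> u t) (at u)"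
proof -
  have p: "\<epsilon>\<^sup>2 + k u t \<bullet> k u t > 0" using assms by (simp add: add_pos_nonneg)
  have "((\<lambda>v. \<epsilon>\<^sup>2 + k v t \<bullet> k v t) has_real_derivative 0 + g u t * (2 * (k u t \<bullet> k1 u t))) (at u)"
    by (intro DERIV_add DERIV_const inner_k_u(1) assms)
  from has_real_derivative_sqrt[OF this] p show ?thesis
    unfolding reg_curvature_def f_s_def by simp
qed

lemma f_s_u:
  assumes "t \<in> J" "\<epsilon> > 0"
  shows "((\<lambda>v. f_s \<epsilon> v t) has_real_derivative g u t * f_ss \<epsilon> u t) (at u)"
proof -
  have p: "reg_curvature \<epsilon> (k u t) > 0" by (rule reg_curvature_pos[OF assms(2)])
  have "((\<lambda>v. f_s \<epsilon> v t) has_real_derivative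
     ((g u t * (k1 u t \<bullet> k1 u t + k u t \<bullet> k2 u t)) * reg_curvature \<epsilon> (k u t)
      - (k u t \<bullet> k1 u t) * (g u t * f_s \<epsilon> u t)) / (reg_curvature \<epsilon> (k u t) * reg_curvature \<epsilon> (k u t))) (at u)"
    unfolding f_s_def[of \<epsilon> "_ :: real" t, abs_def]
    by (rule DERIV_divide inner_k_u reg_curvature_u[unfolded f_s_def] assms)+ (use p in simp)
  moreover have "((g u t * (k1 u t \<bullet> k1 u t + k u t \<bullet> k2 u t)) * reg_curvature \<epsilon> (k u t)
      - (k u t \<bullet> k1 u t) * (g u t * f_s \<epsilon> u t)) / (reg_curvature \<epsilon> (k u t) * reg_curvature \<epsilon> (k u t))
      = g u t * f_ss \<epsilon> u t"
    using p by (simp add: f_s_def f_ss_def divide_simps power2_eq_square power3_eq_cube) (simp add: algebra_simps)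
  ultimately show ?thesis by simp
qed

text \<open>This equation is the origin of the dissipation: it is the defect of \<open>f\<^sub>t = f\<^sub>s\<^sub>s + |k|\<^sup>2 f\<close>. The tangential
  term of \<open>k\<^sub>t\<close> does not contribute, as \<open>T\<close> is orthogonal to \<open>k\<close>.\<close>

lemma reg_curvature_t:
  assumes "t \<in> J" "\<epsilon> > 0"
  shows "((\<lambda>s. reg_curvature \<epsilon> (k u s)) has_real_derivative
     f_ss \<epsilon> u t + (k u t \<bullet> k u t) * reg_curvature \<epsilon> (k u t) - dissipation \<epsilon> (k u t) (k1 u t)) (at t within J)"
proof -
  let ?f = "reg_curvature \<epsilon> (k u t)"
  have half: "(2 * a + 4 * b) / (2 * s) = (a + 2 * b) / s" for a b s :: real
    by (cases "s = 0") (simp_all add: field_simps)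
  have p: "\<epsilon>\<^sup>2 + k u t \<bullet> k u t > 0" using assms by (simp add: add_pos_nonneg)
  have f: "?f > 0" "?f * ?f = \<epsilon>\<^sup>2 + k u t \<bullet> k u t"
    using reg_curvature_pos[OF assms(2)] reg_curvature_sq[of \<epsilon> "k u t"] by (auto simp: power2_eq_square)
  have "((\<lambda>s. k u s \<bullet> k u s) has_real_derivative
      2 * (k u t \<bullet> k2 u t) + 4 * (k u t \<bullet> k u t)\<^sup>2) (at t within J)"
    using bounded_bilinear.has_vector_derivative[OF bounded_bilinear_inner k_t[OF assms(1), of u] k_t[OF assms(1), of u]]
      T_k[OF assms(1), of u]
    by (simp add: has_real_derivative_iff_has_vector_derivative inner_commute inner_simps
        algebra_simps power2_eq_square)
  from DERIV_add[OF DERIV_const this]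
  have "((\<lambda>s. \<epsilon>\<^sup>2 + k u s \<bullet> k u s) has_real_derivative
      0 + (2 * (k u t \<bullet> k2 u t) + 4 * (k u t \<bullet> k u t)\<^sup>2)) (at t within J)" .
  from has_real_derivative_sqrt[OF this p] have "((\<lambda>s. reg_curvature \<epsilon> (k u s)) has_real_derivative
      (k u t \<bullet> k2 u t + 2 * (k u t \<bullet> k u t)\<^sup>2) / ?f) (at t within J)"
    unfolding reg_curvature_def
    by (elim DERIV_cong) (simp add: half)
  moreover have "(k u t \<bullet> k2 u t + 2 * (k u t \<bullet> k u t)\<^sup>2) / ?f =
      f_ss \<epsilon> u t + (k u t \<bullet> k u t) * ?f - dissipation \<epsilon> (k u t) (k1 u t)"
  proof -
    define K m P Q E where "K = k u t \<bullet> k u t" and "m = k u t \<bullet> k1 u t" and "P = k1 u t \<bullet> k1 u t"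
      and "Q = k u t \<bullet> k2 u t" and "E = \<epsilon>\<^sup>2"
    have F: "?f ^ 3 = (E + K) * ?f" using f(2) by (simp add: power3_eq_cube K_def E_def)
    have EK: "E + K > 0" using p by (simp add: K_def E_def)
    have KF: "K * ?f = K * (E + K) / ?f"
      unfolding E_def K_def f(2)[symmetric] using f(1) by simp
    have "f_ss \<epsilon> u t + K * ?f - dissipation \<epsilon> (k u t) (k1 u t) =
      ((P + Q) - m\<^sup>2 / (E + K) + K * (E + K) - (P - K\<^sup>2 - m\<^sup>2 / (E + K) + E * K)) / ?f"
      unfolding f_ss_def dissipation_def F
      unfolding K_def[symmetric] m_def[symmetric] P_def[symmetric] Q_def[symmetric] E_def[symmetric] KF
      by (simp add: add_divide_distrib diff_divide_distrib mult.commute)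
    also have "\<dots> = (Q + 2 * K\<^sup>2) / ?f" by (simp add: algebra_simps power2_eq_square)
    finally show ?thesis by (simp add: K_def Q_def)
  qed
  ultimately show ?thesis by simp
qed

lemma cont_reg_curvature: "continuous_on (UNIV \<times> J) (\<lambda>(u, t). reg_curvature \<epsilon> (k u t))"
  using cont_k unfolding reg_curvature_def split_beta by (intro continuous_intros)

lemma cont_f_ss: "\<epsilon> > 0 \<Longrightarrow> continuous_on (UNIV \<times> J) (\<lambda>(u, t). f_ss \<epsilon> u t)"
  using cont_k cont_k1 cont_k2 cont_reg_curvature unfolding f_ss_def split_beta
  by (intro continuous_intros) (auto simp: reg_curvature_nonzero)

lemma cont_dissipation:
  assumes "\<epsilon> > 0"
  shows "continuous_on (UNIV \<times> J) (\<lambda>(u, t). dissipation \<epsilon> (k u t) (k1 u t))"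
proof -
  have "\<epsilon>\<^sup>2 + x \<bullet> x \<noteq> 0" for x :: 'a
    using add_pos_nonneg[of "\<epsilon>\<^sup>2" "x \<bullet> x"] assms by simp
  then show ?thesis
    using cont_k cont_k1 cont_reg_curvature unfolding dissipation_def split_beta
    by (intro continuous_intros) (auto simp: reg_curvature_nonzero assms)
qed

text \<open>The term \<open>- |k|\<^sup>2 h\<close> is the contribution of the length element \<open>ds = g du\<close>.\<close>

lemma arclength_integral_t:
  assumes h_t: "\<And>u t. u \<in> {a..b} \<Longrightarrow> t \<in> U \<Longrightarrow> ((\<lambda>s. h u s) has_real_derivative h' u t) (at t within U)"
    and h: "\<And>t. t \<in> U \<Longrightarrow> continuous_on {a..b} (\<lambda>u. h u t)"
    and U: "U \<subseteq> J" "is_interval U"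
    and cont: "continuous_on (U \<times> {a..b}) (\<lambda>(t, u). (h' u t - (k u t \<bullet> k u t) * h u t) * g u t)"
    and t: "t \<in> U"
  shows "((\<lambda>s. integral {a..b} (\<lambda>u. h u s * g u s)) has_real_derivative
     integral {a..b} (\<lambda>u. (h' u t - (k u t \<bullet> k u t) * h u t) * g u t)) (at t within U)"
proof -
  have cg: "continuous_on {a..b} (\<lambda>u. g u t)" if "t \<in> U" for t
    using continuous_on_slice[OF cont_g] U that by blast
  have "((\<lambda>s. integral (cbox a b) (\<lambda>u. h u s * g u s)) has_real_derivative
     integral (cbox a b) (\<lambda>u. (h' u t - (k u t \<bullet> k u t) * h u t) * g u t)) (at t within U)"
  proof (rule leibniz_rule_field_derivative[of U a b "\<lambda>s u. h u s * g u s"])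
    fix x u assume x: "x \<in> U" "u \<in> cbox a b"
    show "((\<lambda>x. h u x * g u x) has_real_derivative (h' u x - k u x \<bullet> k u x * h u x) * g u x) (at x within U)"
      using DERIV_mult[OF h_t[of u x] has_field_derivative_subset[OF g_t[of x u] U(1)]] x U
      by (auto simp: algebra_simps cbox_interval)
  next
    fix x assume "x \<in> U"
    then show "(\<lambda>u. h u x * g u x) integrable_on cbox a b"
      unfolding cbox_interval by (intro integrable_continuous_interval continuous_intros h cg)
  qed (use cont t U in \<open>auto simp: cbox_interval is_interval_convex_1\<close>)
  then show ?thesis by (simp add: cbox_interval)
qed

text \<open>The growth term \<open>|k|\<^sup>2 f\<close> cancels against the decay of the length element, and \<open>f\<^sub>s\<^sub>s\<close> integrates to zero
  over a period. Only the dissipation is left.\<close>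

lemma total_reg_curvature_t:
  assumes per: "\<And>u t. t \<in> J \<Longrightarrow> k (u + p) t = k u t" "\<And>u t. t \<in> J \<Longrightarrow> k1 (u + p) t = k1 u t"
    and p: "p > 0" and e: "\<epsilon> > 0" and t: "t \<in> J"
  shows "((\<lambda>s. integral {0..p} (\<lambda>u. reg_curvature \<epsilon> (k u s) * g u s)) has_real_derivative
     - integral {0..p} (\<lambda>u. dissipation \<epsilon> (k u t) (k1 u t) * g u t)) (at t within J)"
proof -
  let ?h' = "\<lambda>u t. f_ss \<epsilon> u t + (k u t \<bullet> k u t) * reg_curvature \<epsilon> (k u t) - dissipation \<epsilon> (k u t) (k1 u t)"
  have eq: "(?h' u t - (k u t \<bullet> k u t) * reg_curvature \<epsilon> (k u t)) * g u t =
       g u t * f_ss \<epsilon> u t - dissipation \<epsilon> (k u t) (k1 u t) * g u t" for u t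
    by (simp add: algebra_simps)
  have "((\<lambda>s. integral {0..p} (\<lambda>u. reg_curvature \<epsilon> (k u s) * g u s)) has_real_derivative
     integral {0..p} (\<lambda>u. (?h' u t - (k u t \<bullet> k u t) * reg_curvature \<epsilon> (k u t)) * g u t)) (at t within J)"
  proof (rule arclength_integral_t[OF _ _ order_refl J _ t])
    show "continuous_on (J \<times> {0..p}) (\<lambda>(t, u). (?h' u t - k u t \<bullet> k u t * reg_curvature \<epsilon> (k u t)) * g u t)"
      unfolding eq
      using continuous_on_swap[OF cont_f_ss[OF e] order_refl, of "{0..p}"]
        continuous_on_swap[OF cont_g order_refl, of "{0..p}"]
        continuous_on_swap[OF cont_dissipation[OF e] order_refl, of "{0..p}"]
      unfolding split_beta by (intro continuous_intros)
  qed (use reg_curvature_t e continuous_on_slice[OF cont_reg_curvature] in auto)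
  also have "integral {0..p} (\<lambda>u. (?h' u t - (k u t \<bullet> k u t) * reg_curvature \<epsilon> (k u t)) * g u t) =
     integral {0..p} (\<lambda>u. g u t * f_ss \<epsilon> u t) - integral {0..p} (\<lambda>u. dissipation \<epsilon> (k u t) (k1 u t) * g u t)"
    unfolding eq
    using continuous_on_slice[OF cont_f_ss[OF e] t, of "{0..p}"]
        continuous_on_slice[OF cont_g t, of "{0..p}"]
        continuous_on_slice[OF cont_dissipation[OF e] t, of "{0..p}"]
    by (intro integral_diff integrable_continuous_interval continuous_intros)
  also have "integral {0..p} (\<lambda>u. g u t * f_ss \<epsilon> u t) = 0"
  proof -
    have "((\<lambda>u. g u t * f_ss \<epsilon> u t) has_integral f_s \<epsilon> p t - f_s \<epsilon> 0 t) {0..p}"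
      by (rule has_integral_real_derivative[OF f_s_u[OF t e]]) (use p in simp)
    moreover have "f_s \<epsilon> p t = f_s \<epsilon> 0 t"
      using per[OF t, of 0] by (simp add: f_s_def)
    ultimately show ?thesis by (auto dest: integral_unique)
  qed
  finally show ?thesis by simp
qed

end

section \<open>Comparison with subsolutions\<close>

context csf_frame
begin

text \<open>An integral form of the comparison principle. Let \<open>\<Phi>\<close> be a subsolution \<open>\<Phi>\<^sub>t \<le> \<Phi>\<^sub>s\<^sub>s\<close> which is not positive at
  the end points, and let \<open>y\<close> be the positive part of \<open>\<Phi> - f\<close>. Since \<open>f\<^sub>t \<ge> f\<^sub>s\<^sub>s - D\<close>, the integral of
  \<open>y\<^sup>3\<close> can grow only through \<open>3 y\<^sup>2 D\<close>; the remaining term \<open>3 y\<^sup>2 (\<Phi> - f)\<^sub>s\<^sub>s\<close> is nonpositive after integration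
  by parts. An integral bound on \<open>D\<close> suffices, which is all that is known for the rescaled flows.\<close>

lemma comparison_t:
  fixes \<Phi> \<Phi>1 \<Phi>2 \<Phi>t :: "real \<Rightarrow> real \<Rightarrow> real"
  assumes U: "U \<subseteq> J" "is_interval U" "t \<in> U" and e: "\<epsilon> > 0" and ab: "a \<le> b" and B: "B \<ge> 0"
    and \<Phi>_u: "\<And>u t. t \<in> U \<Longrightarrow> ((\<lambda>v. \<Phi> v t) has_real_derivative \<Phi>1 u t) (at u)"
    and \<Phi>1_u: "\<And>u t. t \<in> U \<Longrightarrow> ((\<lambda>v. \<Phi>1 v t) has_real_derivative \<Phi>2 u t) (at u)"
    and \<Phi>_t: "\<And>u t. t \<in> U \<Longrightarrow> ((\<lambda>s. \<Phi> u s) has_real_derivative \<Phi>t u t) (at t within U)"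
    and cont: "continuous_on (UNIV \<times> U) (\<lambda>(u, t). \<Phi> u t)" "continuous_on (UNIV \<times> U) (\<lambda>(u, t). \<Phi>t u t)"
    and ends: "\<Phi> a t \<le> 0" "\<Phi> b t \<le> 0"
    and bound: "\<And>u. \<Phi> u t \<le> B"
    and sub: "\<And>u. u \<in> {a..b} \<Longrightarrow> \<Phi>t u t * g u t \<le> \<Phi>2 u t / g u t - \<Phi>1 u t * g' u t / (g u t)\<^sup>2"
  shows "\<exists>D. ((\<lambda>s. integral {a..b} (\<lambda>u. max 0 (\<Phi> u s - reg_curvature \<epsilon> (k u s)) ^ 3 * g u s))
             has_real_derivative D) (at t within U) \<and>
           D \<le> 3 * B\<^sup>2 * integral {a..b} (\<lambda>u. dissipation \<epsilon> (k u t) (k1 u t) * g u t)"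
proof -
  have t: "t \<in> J" using U by blast
  let ?f = "\<lambda>u t. reg_curvature \<epsilon> (k u t)"
  let ?D = "\<lambda>u t. dissipation \<epsilon> (k u t) (k1 u t)"
  define m where "m = (\<lambda>u t. max 0 (\<Phi> u t - ?f u t))"
  define ft where "ft = (\<lambda>u t. f_ss \<epsilon> u t + (k u t \<bullet> k u t) * ?f u t - ?D u t)"
  have cont_m: "continuous_on (UNIV \<times> U) (\<lambda>(u, t). m u t)"
    using cont(1) continuous_on_subset[OF cont_reg_curvature, of "UNIV \<times> U"] U(1)
    unfolding m_def split_beta by (intro continuous_intros) auto
  have "((\<lambda>s. integral {a..b} (\<lambda>u. m u s ^ 3 * g u s)) has_real_derivative
      integral {a..b} (\<lambda>u. (3 * (m u t)\<^sup>2 * (\<Phi>t u t - ft u t) - (k u t \<bullet> k u t) * m u t ^ 3) * g u t)) (at t within U)"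
  proof (rule arclength_integral_t)
    fix u t assume "t \<in> U"
    then show "((\<lambda>s. m u s ^ 3) has_real_derivative 3 * (m u t)\<^sup>2 * (\<Phi>t u t - ft u t)) (at t within U)"
      using DERIV_chain2[where g = "\<lambda>s. \<Phi> u s - ?f u s" and x = t,
          OF has_real_derivative_pos_part_power[of 3]
            DERIV_diff[OF \<Phi>_t has_field_derivative_subset[OF reg_curvature_t[OF _ e, of t u] U(1)]]] U(1)
      unfolding m_def ft_def by auto
  next
    fix t assume "t \<in> U"
    then show "continuous_on {a..b} (\<lambda>u. m u t ^ 3)"
      using continuous_on_slice[OF cont_m] by (intro continuous_intros)
  next
    show "continuous_on (U \<times> {a..b})
       (\<lambda>(t, u). (3 * (m u t)\<^sup>2 * (\<Phi>t u t - ft u t) - k u t \<bullet> k u t * m u t ^ 3) * g u t)"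
      using continuous_on_swap[OF cont_m order_refl, of "{a..b}"]
        continuous_on_swap[OF cont(2) order_refl, of "{a..b}"]
        continuous_on_swap[OF cont_f_ss[OF e] U(1), of "{a..b}"]
        continuous_on_swap[OF cont_g U(1), of "{a..b}"]
        continuous_on_swap[OF cont_k U(1), of "{a..b}"]
        continuous_on_swap[OF cont_reg_curvature U(1), of "{a..b}"]
        continuous_on_swap[OF cont_dissipation[OF e] U(1), of "{a..b}"]
      unfolding split_beta ft_def by (intro continuous_intros)
  qed (use U in auto)
  moreover have "integral {a..b} (\<lambda>u. (3 * (m u t)\<^sup>2 * (\<Phi>t u t - ft u t) - (k u t \<bullet> k u t) * m u t ^ 3) * g u t)
    \<le> 3 * B\<^sup>2 * integral {a..b} (\<lambda>u. ?D u t * g u t)"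
  proof -
    \<comment> \<open>\<open>z = (\<Phi> - f)\<^sub>s\<close> and \<open>w = 3 m\<^sup>2 z\<close>; the integrand is at most \<open>w' + 3 B\<^sup>2 D g\<close>, and \<open>w\<close> vanishes at both ends.\<close>
    define z where "z = (\<lambda>u. \<Phi>1 u t / g u t - f_s \<epsilon> u t)"
    define zu where "zu = (\<lambda>u. \<Phi>2 u t / g u t - \<Phi>1 u t * g' u t / (g u t)\<^sup>2 - g u t * f_ss \<epsilon> u t)"
    define w where "w = (\<lambda>u. 3 * (m u t)\<^sup>2 * z u)"
    define w' where "w' = (\<lambda>u. 3 * (m u t)\<^sup>2 * zu u + 6 * m u t * (g u t * (z u)\<^sup>2))"
    have gp: "g u t > 0" for u using g_pos[OF t] .
    have z_u: "(z has_real_derivative zu u) (at u)" for u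
    proof -
      have "(z has_real_derivative (\<Phi>2 u t * g u t - \<Phi>1 u t * g' u t) / (g u t * g u t) - g u t * f_ss \<epsilon> u t) (at u)"
        unfolding z_def
        by (intro DERIV_diff DERIV_divide \<Phi>1_u g_u f_s_u U t e) (use gp[of u] in simp)
      moreover have "(\<Phi>2 u t * g u t - \<Phi>1 u t * g' u t) / (g u t * g u t) - g u t * f_ss \<epsilon> u t = zu u"
        using gp[of u] by (simp add: zu_def field_simps power2_eq_square)
      ultimately show ?thesis by simp
    qed
    have m_u: "((\<lambda>u. (m u t)\<^sup>2) has_real_derivative 2 * m u t * (g u t * z u)) (at u)" for u
    proof -
      have "((\<lambda>v. \<Phi> v t - ?f v t) has_real_derivative \<Phi>1 u t - g u t * f_s \<epsilon> u t) (at u)"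
        by (intro DERIV_diff \<Phi>_u reg_curvature_u U t e)
      from DERIV_chain2[where g = "\<lambda>v. \<Phi> v t - ?f v t" and x = u,
          OF has_real_derivative_pos_part_power[of 2] this]
      have "((\<lambda>u. (m u t)\<^sup>2) has_real_derivative 2 * m u t * (\<Phi>1 u t - g u t * f_s \<epsilon> u t)) (at u)"
        by (simp add: m_def)
      moreover have "\<Phi>1 u t - g u t * f_s \<epsilon> u t = g u t * z u"
        using gp[of u] by (simp add: z_def field_simps)
      ultimately show ?thesis by simp
    qed
    have w_u: "(w has_real_derivative w' u) (at u)" for u
    proof -
      have "((\<lambda>u. 3 * ((m u t)\<^sup>2 * z u)) has_real_derivative
         3 * (2 * m u t * (g u t * z u) * z u + zu u * (m u t)\<^sup>2)) (at u)"
        by (intro DERIV_cmult DERIV_mult m_u z_u)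
      moreover have "3 * (2 * m u t * (g u t * z u) * z u + zu u * (m u t)\<^sup>2) = w' u"
        by (simp add: w'_def power2_eq_square algebra_simps)
      moreover have "w = (\<lambda>u. 3 * ((m u t)\<^sup>2 * z u))" by (simp add: w_def mult.assoc)
      ultimately show ?thesis by simp
    qed
    have m0: "m a t = 0" "m b t = 0"
      using ends reg_curvature_pos[OF e, of "k a t"] reg_curvature_pos[OF e, of "k b t"]
      by (auto simp: m_def)
    have w'_int: "(w' has_integral 0) {a..b}"
    proof -
      have "(w' has_integral (w b - w a)) {a..b}"
        by (rule has_integral_real_derivative[OF w_u ab])
      then show ?thesis using m0 by (simp add: w_def)
    qed
    have D_int: "(\<lambda>u. ?D u t * g u t) integrable_on {a..b}"
      using continuous_on_slice[OF cont_g t, of "{a..b}"]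
        continuous_on_slice[OF cont_dissipation[OF e] t, of "{a..b}"]
      by (intro integrable_continuous_interval continuous_intros)
    have R_int: "((\<lambda>u. w' u + 3 * B\<^sup>2 * (?D u t * g u t)) has_integral
        0 + 3 * B\<^sup>2 * integral {a..b} (\<lambda>u. ?D u t * g u t)) {a..b}"
      by (intro has_integral_add w'_int has_integral_mult_right integrable_integral D_int)
    have L_int: "(\<lambda>u. (3 * (m u t)\<^sup>2 * (\<Phi>t u t - ft u t) - (k u t \<bullet> k u t) * m u t ^ 3) * g u t)
        integrable_on {a..b}"
      using continuous_on_slice[OF cont_m U(3), of "{a..b}"]
        continuous_on_slice[OF cont(2) U(3), of "{a..b}"]
        continuous_on_slice[OF cont_f_ss[OF e] t, of "{a..b}"]
        continuous_on_slice[OF cont_g t, of "{a..b}"]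
        continuous_on_slice[OF cont_k t, of "{a..b}"]
        continuous_on_slice[OF cont_reg_curvature t, of "{a..b}"]
        continuous_on_slice[OF cont_dissipation[OF e] t, of "{a..b}"]
      unfolding ft_def by (intro integrable_continuous_interval continuous_intros)
    have "(3 * (m u t)\<^sup>2 * (\<Phi>t u t - ft u t) - (k u t \<bullet> k u t) * m u t ^ 3) * g u t
        \<le> w' u + 3 * B\<^sup>2 * (?D u t * g u t)" if "u \<in> {a..b}" for u
    proof -
      have m: "0 \<le> m u t" "m u t \<le> B"
        using bound[of u] reg_curvature_pos[OF e, of "k u t"] B by (auto simp: m_def)
      have f: "?f u t > 0" by (rule reg_curvature_pos[OF e])
      have D: "0 \<le> ?D u t * g u t" using dissipation_nonneg[OF t e, of u] gp[of u] by simp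
      have 1: "(m u t)\<^sup>2 * (\<Phi>t u t * g u t - g u t * f_ss \<epsilon> u t) \<le> (m u t)\<^sup>2 * zu u"
        using sub[OF that] by (intro mult_left_mono) (auto simp: zu_def)
      have 2: "(m u t)\<^sup>2 * (?D u t * g u t) \<le> B\<^sup>2 * (?D u t * g u t)"
        using m by (intro mult_right_mono D power_mono) auto
      have 3: "0 \<le> (m u t)\<^sup>2 * ((k u t \<bullet> k u t) * ?f u t) * g u t" "0 \<le> (k u t \<bullet> k u t) * m u t ^ 3 * g u t"
        "0 \<le> 6 * m u t * (g u t * (z u)\<^sup>2)"
        using f m gp[of u] by auto
      have "(3 * (m u t)\<^sup>2 * (\<Phi>t u t - ft u t) - (k u t \<bullet> k u t) * m u t ^ 3) * g u t =
        3 * ((m u t)\<^sup>2 * (\<Phi>t u t * g u t - g u t * f_ss \<epsilon> u t)) - 3 * ((m u t)\<^sup>2 * ((k u t \<bullet> k u t) * ?f u t) * g u t)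
         + 3 * ((m u t)\<^sup>2 * (?D u t * g u t)) - (k u t \<bullet> k u t) * m u t ^ 3 * g u t"
        by (simp add: ft_def algebra_simps)
      with 1 2 3 show ?thesis unfolding w'_def by linarith
    qed
    from has_integral_le[OF integrable_integral[OF L_int] R_int this]
    show ?thesis by simp
  qed
  ultimately show ?thesis unfolding m_def by blast
qed

section \<open>Straight lines remain straight\<close>

text \<open>Let \<open>e\<close> be the direction of the line at time \<open>t1\<close>. The function \<open>w = 1 - T \<bullet> e\<close> takes values in \<open>[0, 2]\<close> and
  satisfies \<open>w\<^sub>t = w\<^sub>s\<^sub>s - |k|\<^sup>2 + |k|\<^sup>2 w\<close>; the last term cancels against the decay of the length element.
  Integrated against a cut-off \<open>\<psi>\<^sup>2\<close>, the good term \<open>- \<psi>\<^sup>2 |k|\<^sup>2\<close> absorbs the boundary term up to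
  \<open>4 \<integral> (\<psi>')\<^sup>2 / g du\<close>, which is \<open>O(1 / R)\<close> for a cut-off at distance \<open>R\<close> because \<open>g \<ge> 1\<close>. Hence \<open>w\<close> stays zero.\<close>

lemma straight_stays_straight:
  assumes "t1 \<le> t2" and sub: "{t1..t2} \<subseteq> J"
    and k0: "\<And>u. k u t1 = 0"
    and g1: "\<And>u t. t \<in> {t1..t2} \<Longrightarrow> g u t \<ge> 1"
  shows "k u t2 = 0"
proof -
  have J12: "t1 \<in> J" "t2 \<in> J" using assms(1,2) by auto
  define e where "e = T 0 t1"
  have e1: "e \<bullet> e = 1" using T_T[OF J12(1)] by (simp add: e_def)
  have "((\<lambda>v. T v t1) has_vector_derivative 0) (at u)" for u
    using T_u[OF J12(1), of u] by (simp add: k0)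
  then obtain c where "T v t1 = c" for v
    using has_vector_derivative_zero_constant[OF convex_UNIV, of "\<lambda>v. T v t1"] by auto
  then have Te: "T v t1 = e" for v unfolding e_def by simp
  have Te_le: "T v t \<bullet> e \<le> 1" if "t \<in> J" for v t
  proof -
    have "norm (T v t) = 1" "norm e = 1" using T_T[OF that, of v] e1 by (auto simp: norm_eq_1)
    then show ?thesis using norm_cauchy_schwarz[of "T v t" e] by simp
  qed
  have est: "integral {-M..M} (\<lambda>u. 1 - T u t2 \<bullet> e) \<le> 64 * (t2 - t1) / R" if M: "M > 0" "R \<ge> 2 * M" for M R
  proof -
    have R: "R > 0" using M by linarith
    define \<psi> where "\<psi> = (\<lambda>u::real. 1 - u\<^sup>2 / R\<^sup>2)"
    define \<psi>' where "\<psi>' = (\<lambda>u::real. - (2 * u / R\<^sup>2))"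
    have \<psi>_u: "(\<psi> has_real_derivative \<psi>' u) (at u)" for u
      unfolding \<psi>_def \<psi>'_def
      by (rule DERIV_cong[OF DERIV_diff[OF DERIV_const DERIV_cdivide[OF DERIV_pow]]]) simp
    have cont_\<psi>: "continuous_on S \<psi>" for S unfolding \<psi>_def using R by (intro continuous_intros) auto
    define E where "E = (\<lambda>t. integral {-R..R} (\<lambda>u. (\<psi> u)\<^sup>2 * (1 - T u t \<bullet> e) * g u t))"
    let ?h' = "\<lambda>u t. - (\<psi> u)\<^sup>2 * (k1 u t \<bullet> e + (k u t \<bullet> k u t) * (T u t \<bullet> e))"
    let ?I = "\<lambda>u t. (?h' u t - (k u t \<bullet> k u t) * ((\<psi> u)\<^sup>2 * (1 - T u t \<bullet> e))) * g u t"
    have E_t: "(E has_real_derivative integral {-R..R} (\<lambda>u. ?I u t)) (at t within {t1..t2})"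
      if t: "t \<in> {t1..t2}" for t
      unfolding E_def
    proof (rule arclength_integral_t[OF _ _ sub _ _ t])
      fix u t assume t: "t \<in> {t1..t2}"
      then have tJ: "t \<in> J" using sub by auto
      have "((\<lambda>s. T u s \<bullet> e) has_vector_derivative (k1 u t + (k u t \<bullet> k u t) *\<^sub>R T u t) \<bullet> e) (at t within {t1..t2})"
        by (rule bounded_linear.has_vector_derivative[OF bounded_linear_inner_left
              has_vector_derivative_within_subset[OF T_t[OF tJ] sub]])
      then have "((\<lambda>s. T u s \<bullet> e) has_real_derivative (k1 u t \<bullet> e + (k u t \<bullet> k u t) * (T u t \<bullet> e))) (at t within {t1..t2})"
        by (simp add: has_real_derivative_iff_has_vector_derivative inner_simps)
      then show "((\<lambda>s. (\<psi> u)\<^sup>2 * (1 - T u s \<bullet> e)) has_real_derivative ?h' u t) (at t within {t1..t2})"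
        by (auto intro!: derivative_eq_intros simp: algebra_simps)
    next
      fix t assume t: "t \<in> {t1..t2}"
      then have tJ: "t \<in> J" using sub by auto
      show "continuous_on {- R..R} (\<lambda>u. (\<psi> u)\<^sup>2 * (1 - T u t \<bullet> e))"
        using continuous_on_slice[OF cont_T tJ] cont_\<psi> by (intro continuous_intros)
    next
      have "continuous_on ({t1..t2} \<times> {-R..R}) (\<lambda>x. \<psi> (snd x))"
        by (rule continuous_on_compose2[OF cont_\<psi>[of UNIV]]) (auto intro!: continuous_intros)
      then show "continuous_on ({t1..t2} \<times> {-R..R}) (\<lambda>(t, u). ?I u t)"
      using continuous_on_swap[OF cont_T sub, of "{-R..R}"]
        continuous_on_swap[OF cont_g sub, of "{-R..R}"]
        continuous_on_swap[OF cont_k sub, of "{-R..R}"]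
        continuous_on_swap[OF cont_k1 sub, of "{-R..R}"]
      unfolding split_beta by (intro continuous_intros)
    qed auto
    have I_le: "integral {-R..R} (\<lambda>u. ?I u t) \<le> 32 / R" if t: "t \<in> {t1..t2}" for t
    proof -
      have tJ: "t \<in> J" using sub t by auto
      define w where "w = (\<lambda>u. - ((\<psi> u)\<^sup>2 * (k u t \<bullet> e)))"
      define w' where "w' = (\<lambda>u. - (2 * \<psi> u * \<psi>' u * (k u t \<bullet> e) + (\<psi> u)\<^sup>2 * (g u t * (k1 u t \<bullet> e))))"
      have w_u: "(w has_real_derivative w' u) (at u)" for u
      proof -
        have "((\<lambda>u. k u t \<bullet> e) has_vector_derivative (g u t *\<^sub>R k1 u t) \<bullet> e) (at u)"
          by (rule bounded_linear.has_vector_derivative[OF bounded_linear_inner_left k_u[OF tJ]])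
        then have "((\<lambda>u. k u t \<bullet> e) has_real_derivative g u t * (k1 u t \<bullet> e)) (at u)"
          by (simp add: has_real_derivative_iff_has_vector_derivative)
        then show ?thesis unfolding w_def w'_def
          by (auto intro!: derivative_eq_intros \<psi>_u simp: algebra_simps)
      qed
      have "(w' has_integral (w R - w (-R))) {-R..R}"
        by (rule has_integral_real_derivative[OF w_u]) (use R in simp)
      then have w'_int: "(w' has_integral 0) {-R..R}" using R by (simp add: w_def \<psi>_def)
      have const_int: "((\<lambda>u. 16 / R\<^sup>2) has_integral (32 / R)) {-R..R}"
        using has_integral_const_real[of "16 / R\<^sup>2" "-R" R] R by (simp add: field_simps power2_eq_square)
      have L_int: "(\<lambda>u. ?I u t) integrable_on {-R..R}"
        using continuous_on_slice[OF cont_T tJ, of "{-R..R}"] continuous_on_slice[OF cont_g tJ, of "{-R..R}"]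
          continuous_on_slice[OF cont_k tJ, of "{-R..R}"] continuous_on_slice[OF cont_k1 tJ, of "{-R..R}"]
          cont_\<psi>[of "{-R..R}"]
        by (intro integrable_continuous_interval continuous_intros)
      have "?I u t \<le> w' u + 16 / R\<^sup>2" if u: "u \<in> {-R..R}" for u
      proof -
        have nT: "norm (T u t) = 1" "norm e = 1" using T_T[OF tJ, of u] e1 by (auto simp: norm_eq_1)
        \<comment> \<open>\<open>w\<^sub>s = - (k \<bullet> e)\<close> is controlled by \<open>|k|\<close> alone.\<close>
        have "\<bar>k u t \<bullet> e\<bar> = \<bar>k u t \<bullet> (e - T u t)\<bar>"
          using T_k[OF tJ, of u] by (simp add: inner_diff_right inner_commute)
        also have "\<dots> \<le> norm (k u t) * norm (e - T u t)" by (rule Cauchy_Schwarz_ineq2)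
        also have "\<dots> \<le> norm (k u t) * 2"
          using norm_triangle_ineq4[of e "T u t"] nT by (intro mult_left_mono) auto
        finally have ke: "\<bar>k u t \<bullet> e\<bar> \<le> norm (k u t) * 2" .
        have "2 * \<psi> u * \<psi>' u * (k u t \<bullet> e) \<le> \<bar>2 * \<psi> u * \<psi>' u * (k u t \<bullet> e)\<bar>" by simp
        also have "\<dots> = 2 * (\<bar>\<psi> u\<bar> * \<bar>\<psi>' u\<bar>) * \<bar>k u t \<bullet> e\<bar>" by (simp add: abs_mult)
        also have "\<dots> \<le> 2 * (\<bar>\<psi> u\<bar> * \<bar>\<psi>' u\<bar>) * (norm (k u t) * 2)"
          by (intro mult_left_mono ke) auto
        also have "\<dots> \<le> (\<bar>\<psi> u\<bar> * norm (k u t))\<^sup>2 + (2 * \<bar>\<psi>' u\<bar>)\<^sup>2"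
          using sum_squares_bound[of "\<bar>\<psi> u\<bar> * norm (k u t)" "2 * \<bar>\<psi>' u\<bar>"] by (simp add: algebra_simps)
        also have "\<dots> = (\<psi> u)\<^sup>2 * (k u t \<bullet> k u t) * 1 + 4 * (\<psi>' u)\<^sup>2"
          by (simp add: power_mult_distrib power2_norm_eq_inner)
        also have "\<dots> \<le> (\<psi> u)\<^sup>2 * (k u t \<bullet> k u t) * g u t + 16 / R\<^sup>2"
        proof (intro add_mono mult_left_mono g1[OF t])
          have "\<bar>u\<bar> \<le> R" using u by auto
          then have "u\<^sup>2 \<le> R\<^sup>2" by (metis abs_ge_zero power2_abs power_mono)
          then have "16 * u\<^sup>2 / (R\<^sup>2 * R\<^sup>2) \<le> 16 * R\<^sup>2 / (R\<^sup>2 * R\<^sup>2)"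
            by (intro divide_right_mono) auto
          then show "4 * (\<psi>' u)\<^sup>2 \<le> 16 / R\<^sup>2"
            using R by (simp add: \<psi>'_def power_divide power_mult_distrib power2_eq_square)
        qed auto
        finally have *: "2 * \<psi> u * \<psi>' u * (k u t \<bullet> e) \<le> (\<psi> u)\<^sup>2 * (k u t \<bullet> k u t) * g u t + 16 / R\<^sup>2" .
        have "?I u t = w' u + 2 * \<psi> u * \<psi>' u * (k u t \<bullet> e) - (\<psi> u)\<^sup>2 * (k u t \<bullet> k u t) * g u t"
          by (simp add: w'_def algebra_simps)
        with * show ?thesis by linarith
      qed
      from has_integral_le[OF integrable_integral[OF L_int] has_integral_add[OF w'_int const_int] this]
      show ?thesis by simp
    qed
    \<comment> \<open>The growth rate \<open>32 / R\<close> is the integral of \<open>16 / R\<^sup>2\<close> over \<open>[-R, R]\<close>.\<close>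
    have "E t2 - 32 / R * t2 \<le> E t1 - 32 / R * t1"
    proof (rule nonincreasing_within[OF \<open>t1 \<le> t2\<close>])
      fix t assume t: "t \<in> {t1..t2}"
      show "((\<lambda>t. E t - 32 / R * t) has_real_derivative integral {-R..R} (\<lambda>u. ?I u t) - 32 / R) (at t within {t1..t2})"
        using R by (auto intro!: derivative_eq_intros E_t[OF t])
      show "integral {-R..R} (\<lambda>u. ?I u t) - 32 / R \<le> 0" using I_le[OF t] by simp
    qed
    moreover have "E t1 = 0" by (simp add: E_def Te e1)
    ultimately have E: "E t2 \<le> 32 * (t2 - t1) / R" by (simp add: algebra_simps diff_divide_distrib)
    have c2: "continuous_on S (\<lambda>u. 1 - T u t2 \<bullet> e)" for S
      using continuous_on_slice[OF cont_T J12(2)] by (intro continuous_intros)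
    have "integral {-M..M} (\<lambda>u. 1 / 2 * (1 - T u t2 \<bullet> e)) \<le>
        integral {-M..M} (\<lambda>u. (\<psi> u)\<^sup>2 * (1 - T u t2 \<bullet> e) * g u t2)"
    proof (rule integral_le)
      fix u assume u: "u \<in> {-M..M}"
      have nn: "0 \<le> 1 - T u t2 \<bullet> e" using Te_le[OF J12(2), of u] by simp
      have "\<bar>u / R\<bar> \<le> 1 / 2" using u M R by (auto simp: abs_le_iff field_simps)
      then have "(u / R)\<^sup>2 \<le> (1 / 2)\<^sup>2" by (metis abs_ge_zero power2_abs power_mono)
      then have "3 / 4 \<le> \<psi> u" by (simp add: \<psi>_def power_divide)
      then have "(3 / 4)\<^sup>2 \<le> (\<psi> u)\<^sup>2" by (intro power_mono) auto
      then have half: "1 / 2 \<le> (\<psi> u)\<^sup>2" by (simp add: power2_eq_square)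
      have "1 / 2 * (1 - T u t2 \<bullet> e) \<le> (\<psi> u)\<^sup>2 * (1 - T u t2 \<bullet> e) * 1"
        using mult_right_mono[OF half nn] by simp
      also have "\<dots> \<le> (\<psi> u)\<^sup>2 * (1 - T u t2 \<bullet> e) * g u t2"
        using nn g1[of t2 u] \<open>t1 \<le> t2\<close> by (intro mult_left_mono) auto
      finally show "1 / 2 * (1 - T u t2 \<bullet> e) \<le> (\<psi> u)\<^sup>2 * (1 - T u t2 \<bullet> e) * g u t2" .
    qed (intro integrable_continuous_interval continuous_intros c2 cont_\<psi>
        continuous_on_slice[OF cont_T J12(2)] continuous_on_slice[OF cont_g J12(2)])+
    also have "\<dots> \<le> E t2"
      unfolding E_def
    proof (rule integral_subset_le)
      show "{- M..M} \<subseteq> {- R..R}" using M by auto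
      show "\<forall>u\<in>{-R..R}. 0 \<le> (\<psi> u)\<^sup>2 * (1 - T u t2 \<bullet> e) * g u t2"
        using Te_le[OF J12(2)] g_pos[OF J12(2)] by (simp add: less_imp_le)
    qed (intro integrable_continuous_interval continuous_intros c2 cont_\<psi>
        continuous_on_slice[OF cont_T J12(2)] continuous_on_slice[OF cont_g J12(2)])+
    also note E
    finally show ?thesis using R by (simp add: field_simps)
  qed
  have Te2: "T v t2 \<bullet> e = 1" for v
  proof -
    define M where "M = \<bar>v\<bar> + 1"
    have M: "M > 0" by (simp add: M_def)
    have "integral {-M..M} (\<lambda>u. 1 - T u t2 \<bullet> e) \<le> 0"
    proof (rule tendsto_lowerbound[of "\<lambda>R. 64 * (t2 - t1) / R" 0 at_top])
      show "((\<lambda>R. 64 * (t2 - t1) / R) \<longlongrightarrow> 0) at_top"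
        by (intro tendsto_divide_0[OF tendsto_const] filterlim_at_top_imp_at_infinity filterlim_ident)
      show "\<forall>\<^sub>F R in at_top. integral {-M..M} (\<lambda>u. 1 - T u t2 \<bullet> e) \<le> 64 * (t2 - t1) / R"
        using eventually_ge_at_top[of "2 * M"] by eventually_elim (rule est[OF M])
    qed auto
    then have "1 - T v t2 \<bullet> e = 0"
      by (rule integral_nonneg_eq_0_imp[rotated 2])
        (use continuous_on_slice[OF cont_T J12(2)] Te_le[OF J12(2)] M
          in \<open>auto simp: M_def intro!: continuous_intros\<close>)
    then show ?thesis by simp
  qed
  have "T v t2 = e" for v
  proof -
    have "(T v t2 - e) \<bullet> (T v t2 - e) = 0"
      using Te2[of v] T_T[OF J12(2), of v] e1 by (simp add: inner_diff inner_commute)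
    then show ?thesis by simp
  qed
  then have "((\<lambda>v. T v t2) has_vector_derivative 0) (at u)" by simp
  with T_u[OF J12(2), of u] have "g u t2 *\<^sub>R k u t2 = 0"
    by (rule vector_derivative_unique_at)
  with g_pos[OF J12(2), of u] show ?thesis by simp
qed

end

section \<open>Rescaling\<close>

text \<open>The reparametrisation \<open>\<phi>\<close> makes the speed at rescaled time \<open>0\<close> equal to one. Each arclength derivative
  contributes a factor \<open>1 / l\<close>, and rescaled time runs \<open>l\<^sup>2\<close> times as fast.\<close>

lemma csf_frame_rescale:
  fixes L :: "'a::euclidean_space \<Rightarrow> 'a"
  assumes "csf_frame J X g g' T k k1 k2" and l: "l > 0" and t0: "t0 \<in> J"
    and L: "orthogonal_transformation L"
    and \<phi>: "\<And>v. (\<phi> has_real_derivative 1 / (l * g (\<phi> v) t0)) (at v)"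
  defines "\<sigma> \<equiv> \<lambda>\<tau>. t0 + \<tau> / l\<^sup>2"
  shows "csf_frame {\<tau>. \<sigma> \<tau> \<in> J}
    (\<lambda>v \<tau>. l *\<^sub>R (L (X (\<phi> v) (\<sigma> \<tau>)) + b))
    (\<lambda>v \<tau>. g (\<phi> v) (\<sigma> \<tau>) / g (\<phi> v) t0)
    (\<lambda>v \<tau>. (g' (\<phi> v) (\<sigma> \<tau>) * g (\<phi> v) t0 - g (\<phi> v) (\<sigma> \<tau>) * g' (\<phi> v) t0)
        / (g (\<phi> v) t0)\<^sup>2 * (1 / (l * g (\<phi> v) t0)))
    (\<lambda>v \<tau>. L (T (\<phi> v) (\<sigma> \<tau>)))
    (\<lambda>v \<tau>. (1 / l) *\<^sub>R L (k (\<phi> v) (\<sigma> \<tau>)))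
    (\<lambda>v \<tau>. (1 / l\<^sup>2) *\<^sub>R L (k1 (\<phi> v) (\<sigma> \<tau>)))
    (\<lambda>v \<tau>. (1 / l ^ 3) *\<^sub>R L (k2 (\<phi> v) (\<sigma> \<tau>)))"
proof -
  interpret csf_frame J X g g' T k k1 k2 by fact
  define J' where "J' = {\<tau>. \<sigma> \<tau> \<in> J}"
  have bl: "bounded_linear L"
    using L by (simp add: orthogonal_transformation_linear linear_conv_bounded_linear[symmetric])
  have LL: "L x \<bullet> L y = x \<bullet> y" for x y
    using L by (simp add: orthogonal_transformation_def)
  have g0: "g (\<phi> v) t0 > 0" for v by (rule g_pos[OF t0])
  have nz0: "g (\<phi> v) t0 \<noteq> 0" for v using g0[of v] by simp
  have \<sigma>_t: "(\<sigma> has_vector_derivative (1 / l\<^sup>2)) (at \<tau> within S)" for \<tau> S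
    unfolding \<sigma>_def has_real_derivative_iff_has_vector_derivative[symmetric]
    by (rule DERIV_cong[OF DERIV_add[OF DERIV_const DERIV_cdivide[OF DERIV_ident]]]) simp
  have cont_\<phi>: "continuous_on UNIV \<phi>"
    using \<phi> by (meson DERIV_isCont continuous_at_imp_continuous_on)
  have cont_\<sigma>: "continuous_on UNIV \<sigma>"
    unfolding \<sigma>_def using l by (intro continuous_intros) auto
  have cont: "continuous_on (UNIV \<times> J') (\<lambda>x. h (\<phi> (fst x)) (\<sigma> (snd x)))"
    if "continuous_on (UNIV \<times> J) (\<lambda>(u, t). h u t)" for h :: "real \<Rightarrow> real \<Rightarrow> 'b::topological_space"
  proof -
    have "continuous_on (UNIV \<times> J') (\<lambda>x. (\<phi> (fst x), \<sigma> (snd x)))"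
      by (intro continuous_on_Pair continuous_on_compose2[OF cont_\<phi>] continuous_on_compose2[OF cont_\<sigma>]
          continuous_intros) auto
    moreover have "(\<lambda>x. (\<phi> (fst x), \<sigma> (snd x))) ` (UNIV \<times> J') \<subseteq> UNIV \<times> J"
      by (auto simp: J'_def)
    ultimately have "continuous_on (UNIV \<times> J') (\<lambda>x. case (\<phi> (fst x), \<sigma> (snd x)) of (u, t) \<Rightarrow> h u t)"
      by (rule continuous_on_compose2[OF that])
    then show ?thesis by simp
  qed
  have cont0: "continuous_on (UNIV \<times> J') (\<lambda>x. h (\<phi> (fst x)) t0)"
    if "continuous_on (UNIV \<times> J) (\<lambda>(u, t). h u t)" for h :: "real \<Rightarrow> real \<Rightarrow> 'b::topological_space"
  proof -
    have "continuous_on (UNIV \<times> J') (\<lambda>x. (\<phi> (fst x), t0))"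
      by (intro continuous_on_Pair continuous_on_compose2[OF cont_\<phi>] continuous_intros) auto
    moreover have "(\<lambda>x. (\<phi> (fst x), t0)) ` (UNIV \<times> J') \<subseteq> UNIV \<times> J"
      using t0 by auto
    ultimately have "continuous_on (UNIV \<times> J') (\<lambda>x. case (\<phi> (fst x), t0) of (u, t) \<Rightarrow> h u t)"
      by (rule continuous_on_compose2[OF that])
    then show ?thesis by simp
  qed
  have sp: "((\<lambda>v. h (\<phi> v)) has_vector_derivative (1 / (l * g (\<phi> v) t0)) *\<^sub>R d) (at v)"
    if "(h has_vector_derivative d) (at (\<phi> v))" for h :: "real \<Rightarrow> 'b::real_normed_vector" and d v
    using vector_diff_chain_at[of \<phi> _ v h, OF \<phi>[unfolded has_real_derivative_iff_has_vector_derivative] that]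
    by (simp add: o_def)
  have tm: "((\<lambda>\<tau>. h (\<sigma> \<tau>)) has_vector_derivative (1 / l\<^sup>2) *\<^sub>R d) (at \<tau> within J')"
    if "(h has_vector_derivative d) (at (\<sigma> \<tau>) within J)" for h :: "real \<Rightarrow> 'b::real_normed_vector" and d \<tau>
  proof -
    have "(h has_vector_derivative d) (at (\<sigma> \<tau>) within \<sigma> ` J')"
      by (rule has_vector_derivative_within_subset[OF that]) (auto simp: J'_def)
    from vector_diff_chain_within[OF \<sigma>_t this] show ?thesis by (simp add: o_def)
  qed
  have L_vd: "((\<lambda>x. L (h x)) has_vector_derivative L d) F" if "(h has_vector_derivative d) F" for h d F
    using that by (rule bounded_linear.has_vector_derivative[OF bl])
  have Ls: "L (c *\<^sub>R x) = c *\<^sub>R L x" "L (x + y) = L x + L y" for c x y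
    using bl by (simp_all add: linear_simps)
  show ?thesis
    unfolding J'_def[symmetric]
  proof
    show "is_interval J'"
      unfolding is_interval_1
    proof (intro ballI allI impI)
      fix a b x assume "a \<in> J'" "b \<in> J'" "a \<le> x \<and> x \<le> b"
      moreover from this have "\<sigma> a \<le> \<sigma> x" "\<sigma> x \<le> \<sigma> b"
        using l by (auto simp: \<sigma>_def divide_right_mono)
      ultimately show "x \<in> J'" using J unfolding is_interval_1 J'_def by blast
    qed
  next
    show "continuous_on (UNIV \<times> J') (\<lambda>(u, t). g (\<phi> u) (\<sigma> t) / g (\<phi> u) t0)"
      using cont[OF cont_g] cont0[OF cont_g] nz0 unfolding split_beta
      by (intro continuous_intros) auto
  next
    have "l * g (\<phi> v) t0 \<noteq> 0" "(g (\<phi> v) t0)\<^sup>2 \<noteq> 0" for v using g0[of v] l by auto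
    then show "continuous_on (UNIV \<times> J') (\<lambda>(v, \<tau>). (g' (\<phi> v) (\<sigma> \<tau>) * g (\<phi> v) t0 - g (\<phi> v) (\<sigma> \<tau>) * g' (\<phi> v) t0)
        / (g (\<phi> v) t0)\<^sup>2 * (1 / (l * g (\<phi> v) t0)))"
      using cont[OF cont_g] cont0[OF cont_g] cont[OF cont_g'] cont0[OF cont_g'] g0 unfolding split_beta
      by (intro continuous_intros) auto
  next
    show "continuous_on (UNIV \<times> J') (\<lambda>(v, \<tau>). L (T (\<phi> v) (\<sigma> \<tau>)))"
      "continuous_on (UNIV \<times> J') (\<lambda>(v, \<tau>). (1 / l) *\<^sub>R L (k (\<phi> v) (\<sigma> \<tau>)))"
      "continuous_on (UNIV \<times> J') (\<lambda>(v, \<tau>). (1 / l\<^sup>2) *\<^sub>R L (k1 (\<phi> v) (\<sigma> \<tau>)))"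
      "continuous_on (UNIV \<times> J') (\<lambda>(v, \<tau>). (1 / l ^ 3) *\<^sub>R L (k2 (\<phi> v) (\<sigma> \<tau>)))"
      unfolding split_beta
      by (intro continuous_intros bounded_linear.continuous_on[OF bl] cont cont_T cont_k cont_k1 cont_k2)+
  next
    fix v \<tau> assume "\<tau> \<in> J'"
    then have t: "\<sigma> \<tau> \<in> J" by (simp add: J'_def)
    note p = g_pos[OF t, of "\<phi> v"] g0[of v] l
    show "g (\<phi> v) (\<sigma> \<tau>) / g (\<phi> v) t0 > 0" using p by simp
    show "L (T (\<phi> v) (\<sigma> \<tau>)) \<bullet> L (T (\<phi> v) (\<sigma> \<tau>)) = 1" by (simp add: LL T_T[OF t])
    show "((\<lambda>v. l *\<^sub>R (L (X (\<phi> v) (\<sigma> \<tau>)) + b)) has_vector_derivative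
        (g (\<phi> v) (\<sigma> \<tau>) / g (\<phi> v) t0) *\<^sub>R L (T (\<phi> v) (\<sigma> \<tau>))) (at v)"
      using bounded_linear.has_vector_derivative[OF bounded_linear_scaleR_right[of l]
          has_vector_derivative_add[OF L_vd[OF sp[OF X_u[OF t, of "\<phi> v"]]] has_vector_derivative_const[of b]]] p
      by (simp add: Ls)
    show "((\<lambda>v. g (\<phi> v) (\<sigma> \<tau>) / g (\<phi> v) t0) has_real_derivative
       (g' (\<phi> v) (\<sigma> \<tau>) * g (\<phi> v) t0 - g (\<phi> v) (\<sigma> \<tau>) * g' (\<phi> v) t0)
        / (g (\<phi> v) t0)\<^sup>2 * (1 / (l * g (\<phi> v) t0))) (at v)"
    proof -
      have *: "((\<lambda>v. g (\<phi> v) t) has_real_derivative 1 / (l * g (\<phi> v) t0) * g' (\<phi> v) t) (at v)" if "t \<in> J" for t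
        using sp[of "\<lambda>u. g u t" _ v] g_u[OF that] by (simp add: has_real_derivative_iff_has_vector_derivative)
      show ?thesis
        by (rule DERIV_cong[OF DERIV_divide[OF *[OF t] *[OF t0]]])
          (use p in \<open>simp_all add: field_simps power2_eq_square\<close>)
    qed
    show "((\<lambda>v. L (T (\<phi> v) (\<sigma> \<tau>))) has_vector_derivative
        (g (\<phi> v) (\<sigma> \<tau>) / g (\<phi> v) t0) *\<^sub>R (1 / l) *\<^sub>R L (k (\<phi> v) (\<sigma> \<tau>))) (at v)"
      using L_vd[OF sp[OF T_u[OF t, of "\<phi> v"]]] p by (simp add: Ls mult.commute)
    show "((\<lambda>v. (1 / l) *\<^sub>R L (k (\<phi> v) (\<sigma> \<tau>))) has_vector_derivative
        (g (\<phi> v) (\<sigma> \<tau>) / g (\<phi> v) t0) *\<^sub>R (1 / l\<^sup>2) *\<^sub>R L (k1 (\<phi> v) (\<sigma> \<tau>))) (at v)"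
      using bounded_linear.has_vector_derivative[OF bounded_linear_scaleR_right[of "1 / l"] L_vd[OF sp[OF k_u[OF t, of "\<phi> v"]]]] p
      by (simp add: Ls mult.commute mult.assoc power2_eq_square)
    show "((\<lambda>v. (1 / l\<^sup>2) *\<^sub>R L (k1 (\<phi> v) (\<sigma> \<tau>))) has_vector_derivative
        (g (\<phi> v) (\<sigma> \<tau>) / g (\<phi> v) t0) *\<^sub>R (1 / l ^ 3) *\<^sub>R L (k2 (\<phi> v) (\<sigma> \<tau>))) (at v)"
      using bounded_linear.has_vector_derivative[OF bounded_linear_scaleR_right[of "1 / l\<^sup>2"] L_vd[OF sp[OF k1_u[OF t, of "\<phi> v"]]]] p
      by (simp add: Ls mult.commute mult.left_commute power2_eq_square power3_eq_cube)
    show "((\<lambda>\<tau>. l *\<^sub>R (L (X (\<phi> v) (\<sigma> \<tau>)) + b)) has_vector_derivative (1 / l) *\<^sub>R L (k (\<phi> v) (\<sigma> \<tau>))) (at \<tau> within J')"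
      using bounded_linear.has_vector_derivative[OF bounded_linear_scaleR_right[of l]
          has_vector_derivative_add[OF L_vd[OF tm[OF X_t[OF t, of "\<phi> v"]]] has_vector_derivative_const[of b]]] p
      by (simp add: Ls power2_eq_square)
    show "((\<lambda>\<tau>. g (\<phi> v) (\<sigma> \<tau>) / g (\<phi> v) t0) has_real_derivative
       - ((1 / l) *\<^sub>R L (k (\<phi> v) (\<sigma> \<tau>)) \<bullet> (1 / l) *\<^sub>R L (k (\<phi> v) (\<sigma> \<tau>))) * (g (\<phi> v) (\<sigma> \<tau>) / g (\<phi> v) t0)) (at \<tau> within J')"
    proof -
      have "((\<lambda>\<tau>. g (\<phi> v) (\<sigma> \<tau>)) has_real_derivative
          (1 / l\<^sup>2) * (- (k (\<phi> v) (\<sigma> \<tau>) \<bullet> k (\<phi> v) (\<sigma> \<tau>)) * g (\<phi> v) (\<sigma> \<tau>))) (at \<tau> within J')"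
        using tm[OF g_t[OF t, of "\<phi> v", unfolded has_real_derivative_iff_has_vector_derivative]]
        by (simp add: has_real_derivative_iff_has_vector_derivative)
      from DERIV_cdivide[OF this, of "g (\<phi> v) t0"] show ?thesis
        by (rule DERIV_cong) (simp add: LL power2_eq_square)
    qed
    show "((\<lambda>\<tau>. L (T (\<phi> v) (\<sigma> \<tau>))) has_vector_derivative
        (1 / l\<^sup>2) *\<^sub>R L (k1 (\<phi> v) (\<sigma> \<tau>)) + ((1 / l) *\<^sub>R L (k (\<phi> v) (\<sigma> \<tau>)) \<bullet> (1 / l) *\<^sub>R L (k (\<phi> v) (\<sigma> \<tau>))) *\<^sub>R L (T (\<phi> v) (\<sigma> \<tau>))) (at \<tau> within J')"
      using L_vd[OF tm[OF T_t[OF t, of "\<phi> v"]]]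
      by (simp add: LL Ls power2_eq_square scaleR_add_right)
    show "((\<lambda>\<tau>. (1 / l) *\<^sub>R L (k (\<phi> v) (\<sigma> \<tau>))) has_vector_derivative
        (1 / l ^ 3) *\<^sub>R L (k2 (\<phi> v) (\<sigma> \<tau>))
        + (2 * ((1 / l) *\<^sub>R L (k (\<phi> v) (\<sigma> \<tau>)) \<bullet> (1 / l\<^sup>2) *\<^sub>R L (k1 (\<phi> v) (\<sigma> \<tau>)))) *\<^sub>R L (T (\<phi> v) (\<sigma> \<tau>))
        + (2 * ((1 / l) *\<^sub>R L (k (\<phi> v) (\<sigma> \<tau>)) \<bullet> (1 / l) *\<^sub>R L (k (\<phi> v) (\<sigma> \<tau>)))) *\<^sub>R (1 / l) *\<^sub>R L (k (\<phi> v) (\<sigma> \<tau>)))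
        (at \<tau> within J')"
      using bounded_linear.has_vector_derivative[OF bounded_linear_scaleR_right[of "1 / l"] L_vd[OF tm[OF k_t[OF t, of "\<phi> v"]]]]
      by (simp add: LL Ls power2_eq_square power3_eq_cube scaleR_add_right mult.commute mult.left_commute)
  qed
qed

text \<open>The factor \<open>1 / l\<^sup>3\<close> is compensated by the space-time element \<open>ds dt\<close>, which scales like \<open>l\<^sup>3\<close>: the
  total dissipation is scale invariant.\<close>

lemma dissipation_rescale:
  assumes "l > 0" and L: "orthogonal_transformation L"
  shows "dissipation (\<epsilon> / l) ((1 / l) *\<^sub>R L k) ((1 / l\<^sup>2) *\<^sub>R L k1) = dissipation \<epsilon> k k1 / l ^ 3"
proof -
  have LL: "L x \<bullet> L y = x \<bullet> y" for x y
    using L by (simp add: orthogonal_transformation_def)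
  have f: "reg_curvature (\<epsilon> / l) ((1 / l) *\<^sub>R L k) = reg_curvature \<epsilon> k / l"
  proof -
    have "(\<epsilon> / l)\<^sup>2 + (1 / l) *\<^sub>R L k \<bullet> (1 / l) *\<^sub>R L k = (\<epsilon>\<^sup>2 + k \<bullet> k) / l\<^sup>2"
      using assms by (simp add: LL field_simps power2_eq_square)
    then show ?thesis using assms by (simp add: reg_curvature_def real_sqrt_divide)
  qed
  define F where "F = \<epsilon>\<^sup>2 + k \<bullet> k"
  have s: "(\<epsilon> / l)\<^sup>2 + (1 / l) *\<^sub>R L k \<bullet> (1 / l) *\<^sub>R L k = F / l\<^sup>2"
    using assms by (simp add: F_def LL field_simps power2_eq_square)
  have num: "(1 / l\<^sup>2) *\<^sub>R L k1 \<bullet> (1 / l\<^sup>2) *\<^sub>R L k1 - ((1 / l) *\<^sub>R L k \<bullet> (1 / l) *\<^sub>R L k)\<^sup>2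
      - ((1 / l) *\<^sub>R L k \<bullet> (1 / l\<^sup>2) *\<^sub>R L k1)\<^sup>2 / (F / l\<^sup>2) + (\<epsilon> / l)\<^sup>2 * ((1 / l) *\<^sub>R L k \<bullet> (1 / l) *\<^sub>R L k)
      = (k1 \<bullet> k1 - (k \<bullet> k)\<^sup>2 - (k \<bullet> k1)\<^sup>2 / F + \<epsilon>\<^sup>2 * (k \<bullet> k)) / l ^ 4"
    using assms(1) by (cases "F = 0") (simp_all add: LL field_simps power2_eq_square power4_eq_xxxx)
  have "x / l ^ 4 / (y / l) = x / y / l ^ 3" for x y
    using assms(1) by (simp add: power3_eq_cube power4_eq_xxxx)
  then show ?thesis
    unfolding dissipation_def f s F_def[symmetric] num .
qed

section \<open>The frame of a solution\<close>

text \<open>For a solution the curvature vector is the time derivative. Defining \<open>k\<close> in this way expresses \<open>k\<close>,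
  \<open>k1\<close>, \<open>k2\<close> through the mixed derivatives \<open>X\<^sub>t\<close>, \<open>X\<^sub>t\<^sub>u\<close>, \<open>X\<^sub>t\<^sub>u\<^sub>u\<close>, whose continuity is part of smoothness,
  and not through third and fourth space derivatives.\<close>

definition frame_speed :: "(real \<Rightarrow> real \<Rightarrow> 'a::euclidean_space) \<Rightarrow> real \<Rightarrow> real \<Rightarrow> real" where
  "frame_speed X u t = norm (space_deriv X u t)"

definition frame_T :: "(real \<Rightarrow> real \<Rightarrow> 'a::euclidean_space) \<Rightarrow> real \<Rightarrow> real \<Rightarrow> 'a" where
  "frame_T X u t = space_deriv X u t /\<^sub>R frame_speed X u t"

definition frame_k :: "real set \<Rightarrow> (real \<Rightarrow> real \<Rightarrow> 'a::euclidean_space) \<Rightarrow> real \<Rightarrow> real \<Rightarrow> 'a" where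
  "frame_k J X = time_deriv J X"

definition frame_speed' :: "(real \<Rightarrow> real \<Rightarrow> 'a::euclidean_space) \<Rightarrow> real \<Rightarrow> real \<Rightarrow> real" where
  "frame_speed' X u t = frame_T X u t \<bullet> space_deriv (space_deriv X) u t"

definition frame_k1 :: "real set \<Rightarrow> (real \<Rightarrow> real \<Rightarrow> 'a::euclidean_space) \<Rightarrow> real \<Rightarrow> real \<Rightarrow> 'a" where
  "frame_k1 J X u t = space_deriv (frame_k J X) u t /\<^sub>R frame_speed X u t"

definition frame_k2 :: "real set \<Rightarrow> (real \<Rightarrow> real \<Rightarrow> 'a::euclidean_space) \<Rightarrow> real \<Rightarrow> real \<Rightarrow> 'a" where
  "frame_k2 J X u t = (space_deriv (space_deriv (frame_k J X)) u t - frame_speed' X u t *\<^sub>R frame_k1 J X u t)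
     /\<^sub>R (frame_speed X u t)\<^sup>2"

text \<open>The evolution equations follow from the commutation of the mixed derivatives. The equation for \<open>k\<^sub>t\<close> is
  obtained by differentiating \<open>k = (X\<^sub>u\<^sub>u - (T \<bullet> X\<^sub>u\<^sub>u) T) / g\<^sup>2\<close> in time.\<close>

lemma csf_frame_of_solution:
  fixes X :: "real \<Rightarrow> real \<Rightarrow> real ^ 'n"
  assumes J: "is_interval J" and X: "csf_solution J X"
  shows "csf_frame J X (frame_speed X) (frame_speed' X) (frame_T X) (frame_k J X) (frame_k1 J X) (frame_k2 J X)"
proof -
  define g g' T k k1 k2 where gs: "g = frame_speed X" "g' = frame_speed' X" "T = frame_T X" "k = frame_k J X"
    "k1 = frame_k1 J X" "k2 = frame_k2 J X"
  define p q r s where pqrs: "p = mixed_deriv J 1 0 X" "q = mixed_deriv J 2 0 X" "r = mixed_deriv J 1 1 X"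
    "s = mixed_deriv J 2 1 X"
  have sm: "smooth_family J X" and p0: "\<And>u t. t \<in> J \<Longrightarrow> p u t \<noteq> 0"
    and flow: "\<And>u t. t \<in> J \<Longrightarrow> time_deriv J X u t = arclength_deriv (\<lambda>v. X v t) 2 u"
    using X by (auto simp: csf_solution_def pqrs mixed_deriv_def)
  have cont: "continuous_on (UNIV \<times> J) (\<lambda>(u, t). mixed_deriv J i j X u t)" for i j
    using sm unfolding smooth_family_def by blast
  have du: "((\<lambda>v. mixed_deriv J i j X v t) has_vector_derivative mixed_deriv J (Suc i) j X u t) (at u)"
    and dt: "((\<lambda>s. mixed_deriv J i j X u s) has_vector_derivative mixed_deriv J i (Suc j) X u t) (at t within J)"
    if "t \<in> J" for i j u t
    using sm that unfolding smooth_family_def by blast+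
  have k_mixed: "k = mixed_deriv J 0 1 X" by (simp add: gs frame_k_def mixed_deriv_def)
  have X_mixed: "X = mixed_deriv J 0 0 X" by (simp add: mixed_deriv_def)
  have p_sp: "p = space_deriv X" "q = space_deriv p" "r = space_deriv k" "s = space_deriv r"
    by (simp_all add: pqrs mixed_deriv_def k_mixed numeral_2_eq_2)
  have g: "g u t = norm (p u t)" and T: "T u t = p u t /\<^sub>R g u t" and g': "g' u t = T u t \<bullet> q u t"
    and k1: "k1 u t = r u t /\<^sub>R g u t" and k2: "k2 u t = (s u t - g' u t *\<^sub>R k1 u t) /\<^sub>R (g u t)\<^sup>2" for u t
    by (simp_all add: gs p_sp frame_speed_def frame_T_def frame_speed'_def frame_k1_def frame_k2_def)
  have X_p: "((\<lambda>v. X v t) has_vector_derivative p u t) (at u)" if "t \<in> J" for u t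
    using du[OF that, of 0 0 u] X_mixed by (simp add: pqrs)
  have p_u: "((\<lambda>v. p v t) has_vector_derivative q u t) (at u)" if "t \<in> J" for u t
    using du[OF that, of 1 0 u] by (simp add: pqrs numeral_2_eq_2)
  have k_r: "((\<lambda>v. k v t) has_vector_derivative r u t) (at u)" if "t \<in> J" for u t
    using du[OF that, of 0 1 u] by (simp add: pqrs k_mixed)
  have r_u: "((\<lambda>v. r v t) has_vector_derivative s u t) (at u)" if "t \<in> J" for u t
    using du[OF that, of 1 1 u] by (simp add: pqrs numeral_2_eq_2)
  have X_k: "((\<lambda>s. X u s) has_vector_derivative k u t) (at t within J)" if "t \<in> J" for u t
    using dt[OF that, of 0 0 u] X_mixed by (simp add: k_mixed)
  have p_t: "((\<lambda>s. p u s) has_vector_derivative r u t) (at t within J)" if "t \<in> J" for u t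
    using dt[OF that, of 1 0 u] by (simp add: pqrs)
  have q_t: "((\<lambda>s'. q u s') has_vector_derivative s u t) (at t within J)" if "t \<in> J" for u t
    using dt[OF that, of 2 0 u] by (simp add: pqrs)
  have gp: "g u t > 0" if "t \<in> J" for u t using p0[OF that] by (simp add: g)
  have gT: "p u t = g u t *\<^sub>R T u t" if "t \<in> J" for u t using gp[OF that, of u] by (simp add: T)
  have TT: "T u t \<bullet> T u t = 1" if "t \<in> J" for u t
    using gp[OF that, of u] by (simp add: T g power2_norm_eq_inner[symmetric] power2_eq_square)
  have norm_deriv: "((\<lambda>x. norm (h x)) has_real_derivative (h x \<bullet> d) / norm (h x)) (at x within S)"
    if "(h has_vector_derivative d) (at x within S)" "h x \<noteq> 0" for h :: "real \<Rightarrow> real ^ 'n" and d x S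
  proof -
    have "((\<lambda>x. h x \<bullet> h x) has_real_derivative 2 * (h x \<bullet> d)) (at x within S)"
      using bounded_bilinear.has_vector_derivative[OF bounded_bilinear_inner that(1) that(1)]
      by (simp add: has_real_derivative_iff_has_vector_derivative inner_commute)
    from has_real_derivative_sqrt[OF this] that(2) show ?thesis
      by (simp add: norm_eq_sqrt_inner)
  qed
  have gu: "((\<lambda>v. g v t) has_real_derivative g' u t) (at u)" if "t \<in> J" for u t
    unfolding g g' T using norm_deriv[OF p_u[OF that] p0[OF that]] by (simp add: divide_inverse mult.commute)
  have gt: "((\<lambda>s. g u s) has_real_derivative T u t \<bullet> r u t) (at t within J)" if "t \<in> J" for u t
    unfolding g T using norm_deriv[OF p_t[OF that] p0[OF that]] by (simp add: divide_inverse mult.commute)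
  have T_diff: "((\<lambda>v. T v t) has_vector_derivative (q u t - g' u t *\<^sub>R T u t) /\<^sub>R g u t) (at u)" if "t \<in> J" for u t
  proof -
    have "((\<lambda>v. inverse (g v t)) has_real_derivative - (inverse (g u t) * g' u t * inverse (g u t))) (at u)"
      using gp[OF that, of u] by (intro DERIV_inverse'[OF gu[OF that]]) auto
    from has_vector_derivative_scaleR[OF this p_u[OF that]]
    have "((\<lambda>v. T v t) has_vector_derivative
        inverse (g u t) *\<^sub>R q u t + (- (inverse (g u t) * g' u t * inverse (g u t))) *\<^sub>R p u t) (at u)"
      unfolding T .
    moreover have "inverse (g u t) *\<^sub>R q u t + (- (inverse (g u t) * g' u t * inverse (g u t))) *\<^sub>R p u t
      = (q u t - g' u t *\<^sub>R T u t) /\<^sub>R g u t"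
      unfolding gT[OF that] using gp[OF that, of u] by (simp add: scaleR_diff_right)
    ultimately show ?thesis by simp
  qed
  have k_eq: "k u t = (q u t - g' u t *\<^sub>R T u t) /\<^sub>R (g u t)\<^sup>2" if "t \<in> J" for u t
  proof -
    have vd: "vector_derivative (\<lambda>v. X v t) (at u) = p u t" for u
      by (rule vector_derivative_at[OF X_p[OF that]])
    have "arclength_deriv (\<lambda>v. X v t) 2 u = vector_derivative (\<lambda>v. T v t) (at u) /\<^sub>R g u t"
      by (simp add: arclength_deriv_def numeral_2_eq_2 vd T g)
    also have "vector_derivative (\<lambda>v. T v t) (at u) = (q u t - g' u t *\<^sub>R T u t) /\<^sub>R g u t"
      by (rule vector_derivative_at[OF T_diff[OF that]])
    finally show ?thesis
      using flow[OF that, of u] by (simp add: gs frame_k_def power2_eq_square)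
  qed
  have Tu: "((\<lambda>v. T v t) has_vector_derivative g u t *\<^sub>R k u t) (at u)" if "t \<in> J" for u t
  proof -
    have "g u t * inverse ((g u t)\<^sup>2) = inverse (g u t)"
      using gp[OF that, of u] by (simp add: field_simps power2_eq_square)
    then show ?thesis using T_diff[OF that, of u] by (simp add: k_eq[OF that])
  qed
  have q_eq: "q u t = g' u t *\<^sub>R T u t + (g u t)\<^sup>2 *\<^sub>R k u t" if "t \<in> J" for u t
    using k_eq[OF that, of u] gp[OF that, of u] by simp
  have r_eq: "r u t = g u t *\<^sub>R k1 u t" if "t \<in> J" for u t
    using gp[OF that, of u] by (simp add: k1)
  have s_eq: "s u t = g' u t *\<^sub>R k1 u t + (g u t)\<^sup>2 *\<^sub>R k2 u t" if "t \<in> J" for u t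
    using gp[OF that, of u] by (simp add: k2)
  have k1u: "((\<lambda>v. k1 v t) has_vector_derivative g u t *\<^sub>R k2 u t) (at u)" if "t \<in> J" for u t
  proof -
    have "((\<lambda>v. inverse (g v t)) has_real_derivative - (inverse (g u t) * g' u t * inverse (g u t))) (at u)"
      using gp[OF that, of u] by (intro DERIV_inverse'[OF gu[OF that]]) auto
    from has_vector_derivative_scaleR[OF this r_u[OF that]]
    have "((\<lambda>v. k1 v t) has_vector_derivative
        inverse (g u t) *\<^sub>R s u t + (- (inverse (g u t) * g' u t * inverse (g u t))) *\<^sub>R r u t) (at u)"
      unfolding k1 .
    moreover have "inverse (g u t) *\<^sub>R s u t + (- (inverse (g u t) * g' u t * inverse (g u t))) *\<^sub>R r u t
      = g u t *\<^sub>R k2 u t"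
    proof -
      have "inverse (g u t) * (g u t)\<^sup>2 = g u t" "inverse (g u t) * g' u t * inverse (g u t) * g u t = inverse (g u t) * g' u t"
        using gp[OF that, of u] by (simp_all add: power2_eq_square)
      then show ?thesis
        unfolding s_eq[OF that] r_eq[OF that] by (simp add: scaleR_add_right)
    qed
    ultimately show ?thesis by simp
  qed
  have cp: "continuous_on (UNIV \<times> J) (\<lambda>x. p (fst x) (snd x))" "continuous_on (UNIV \<times> J) (\<lambda>x. q (fst x) (snd x))"
    "continuous_on (UNIV \<times> J) (\<lambda>x. r (fst x) (snd x))" "continuous_on (UNIV \<times> J) (\<lambda>x. s (fst x) (snd x))"
    "continuous_on (UNIV \<times> J) (\<lambda>x. k (fst x) (snd x))"
    using cont unfolding pqrs k_mixed split_beta by auto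
  have nz: "\<forall>x\<in>UNIV \<times> J. g (fst x) (snd x) \<noteq> 0" using gp less_imp_neq by fastforce
  have cg: "continuous_on (UNIV \<times> J) (\<lambda>x. g (fst x) (snd x))"
    unfolding g by (intro continuous_intros cp)
  have cT: "continuous_on (UNIV \<times> J) (\<lambda>x. T (fst x) (snd x))"
    unfolding T by (intro continuous_intros cp cg nz)
  have cg': "continuous_on (UNIV \<times> J) (\<lambda>x. g' (fst x) (snd x))"
    unfolding g' by (intro continuous_intros cp cT)
  have ck1: "continuous_on (UNIV \<times> J) (\<lambda>x. k1 (fst x) (snd x))"
    unfolding k1 by (intro continuous_intros cp cg nz)
  have ck2: "continuous_on (UNIV \<times> J) (\<lambda>x. k2 (fst x) (snd x))"
    unfolding k2 by (intro continuous_intros cp cg cg' ck1) (use nz in auto)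
  have ku: "((\<lambda>v. k v t) has_vector_derivative g u t *\<^sub>R k1 u t) (at u)" if "t \<in> J" for u t
    using k_r[OF that, of u] by (simp add: r_eq[OF that])
  interpret A: arclength_frame J g g' T k k1 k2
    by (unfold_locales; (unfold split_beta)?)
      (rule J cg cg' cT cp ck1 ck2 gp TT gu Tu ku k1u; assumption?)+
  have gt': "((\<lambda>s. g u s) has_real_derivative - (k u t \<bullet> k u t) * g u t) (at t within J)" if "t \<in> J" for u t
    using gt[OF that, of u] by (simp add: r_eq[OF that] A.T_k1[OF that] mult.commute)
  have Tt: "((\<lambda>s. T u s) has_vector_derivative k1 u t + (k u t \<bullet> k u t) *\<^sub>R T u t) (at t within J)" if "t \<in> J" for u t
  proof -
    have "((\<lambda>s. inverse (g u s)) has_real_derivative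
       - (inverse (g u t) * (- (k u t \<bullet> k u t) * g u t) * inverse (g u t))) (at t within J)"
      using gp[OF that, of u] by (intro DERIV_inverse'[OF gt'[OF that]]) auto
    from has_vector_derivative_scaleR[OF this p_t[OF that, of u]]
    have "((\<lambda>s. T u s) has_vector_derivative inverse (g u t) *\<^sub>R r u t
      + (- (inverse (g u t) * (- (k u t \<bullet> k u t) * g u t) * inverse (g u t))) *\<^sub>R p u t) (at t within J)"
      unfolding T .
    moreover have "inverse (g u t) * (k u t \<bullet> k u t * g u t) * inverse (g u t) * g u t = k u t \<bullet> k u t"
      using gp[OF that, of u] by (simp add: field_simps)
    ultimately show ?thesis using gp[OF that, of u]
      by (simp add: r_eq[OF that] gT[OF that])
  qed
  have kt: "((\<lambda>s. k u s) has_vector_derivative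
      k2 u t + (2 * (k u t \<bullet> k1 u t)) *\<^sub>R T u t + (2 * (k u t \<bullet> k u t)) *\<^sub>R k u t) (at t within J)" if "t \<in> J" for u t
  proof -
    note G = gp[OF that, of u]
    define K where "K = k u t \<bullet> k u t"
    define m where "m = k u t \<bullet> k1 u t"
    have gi: "((\<lambda>s. inverse (g u s ^ 2)) has_real_derivative 2 * K * inverse (g u t ^ 2)) (at t within J)"
    proof -
      have "((\<lambda>s. g u s ^ 2) has_real_derivative 2 * (- K * g u t) * g u t) (at t within J)"
        using DERIV_mult[OF gt'[OF that, of u] gt'[OF that, of u]] by (simp add: power2_eq_square K_def mult.commute mult.left_commute)
      from DERIV_inverse'[OF this] G show ?thesis
        by (elim DERIV_cong[rotated -1] | simp add: field_simps power2_eq_square)+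
    qed
    have Tq: "((\<lambda>s'. T u s' \<bullet> q u s') has_vector_derivative (g u t)\<^sup>2 * (- 2 * m) - g' u t * K) (at t within J)"
    proof -
      have "T u t \<bullet> s u t + (k1 u t + K *\<^sub>R T u t) \<bullet> q u t = (g u t)\<^sup>2 * (- 2 * m) - g' u t * K"
        using A.T_k[OF that, of u] A.T_k1[OF that, of u] A.T_k2[OF that, of u] TT[OF that, of u]
        unfolding s_eq[OF that] q_eq[OF that] K_def m_def
        by (simp add: inner_add_left inner_add_right inner_commute algebra_simps)
      then show ?thesis
        using bounded_bilinear.has_vector_derivative[OF bounded_bilinear_inner Tt[OF that, of u] q_t[OF that, of u]]
        by (simp add: K_def)
    qed
    then have Tq': "((\<lambda>s'. T u s' \<bullet> q u s') has_real_derivative (g u t)\<^sup>2 * (- 2 * m) - g' u t * K) (at t within J)"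
      by (simp add: has_real_derivative_iff_has_vector_derivative)
    have "((\<lambda>s'. inverse (g u s' ^ 2) *\<^sub>R (q u s' - (T u s' \<bullet> q u s') *\<^sub>R T u s')) has_vector_derivative
       inverse (g u t ^ 2) *\<^sub>R (s u t - ((T u t \<bullet> q u t) *\<^sub>R (k1 u t + (k u t \<bullet> k u t) *\<^sub>R T u t) + ((g u t)\<^sup>2 * (- 2 * m) - g' u t * K) *\<^sub>R T u t))
       + (2 * K * inverse (g u t ^ 2)) *\<^sub>R (q u t - (T u t \<bullet> q u t) *\<^sub>R T u t)) (at t within J)"
      by (intro has_vector_derivative_scaleR gi has_vector_derivative_diff q_t[OF that] Tt[OF that] Tq')
    moreover have "inverse (g u t ^ 2) *\<^sub>R (s u t - ((T u t \<bullet> q u t) *\<^sub>R (k1 u t + (k u t \<bullet> k u t) *\<^sub>R T u t) + ((g u t)\<^sup>2 * (- 2 * m) - g' u t * K) *\<^sub>R T u t))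
       + (2 * K * inverse (g u t ^ 2)) *\<^sub>R (q u t - (T u t \<bullet> q u t) *\<^sub>R T u t)
       = k2 u t + (2 * (k u t \<bullet> k1 u t)) *\<^sub>R T u t + (2 * (k u t \<bullet> k u t)) *\<^sub>R k u t"
    proof -
      define d c where "d = (g u t)\<^sup>2" and "c = inverse d"
      have cd: "c * d = 1" using G by (simp add: c_def d_def)
      have cd1: "c * (d * x) = x" for x by (simp add: mult.assoc[symmetric] cd)
      have cd2: "x * c * d = x" for x by (simp add: mult.assoc cd)
      show ?thesis
        unfolding s_eq[OF that] g'[symmetric] K_def m_def d_def[symmetric] c_def[symmetric]
        unfolding q_eq[OF that] d_def[symmetric]
        by (simp add: cd cd1 cd2 scaleR_add_right scaleR_diff_right scaleR_diff_left right_diff_distrib)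
    qed
    ultimately have "((\<lambda>s'. inverse (g u s' ^ 2) *\<^sub>R (q u s' - (T u s' \<bullet> q u s') *\<^sub>R T u s')) has_vector_derivative
        k2 u t + (2 * (k u t \<bullet> k1 u t)) *\<^sub>R T u t + (2 * (k u t \<bullet> k u t)) *\<^sub>R k u t) (at t within J)"
      by simp
    then show ?thesis
      by (rule has_vector_derivative_transform[OF that, rotated]) (simp add: k_eq g')
  qed
  have Xu: "((\<lambda>v. X v t) has_vector_derivative g u t *\<^sub>R T u t) (at u)" if "t \<in> J" for u t
    using X_p[OF that, of u] by (simp add: gT[OF that])
  have "csf_frame J X g g' T k k1 k2"
    by unfold_locales (rule Xu X_k gt' Tt kt; assumption)+
  then show ?thesis unfolding gs .
qed

context csf_frame
begin

text \<open>Smooth convergence is a statement about mixed derivatives. The following formulas recover from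
  them what is needed of the frame.\<close>

lemma space_deriv_X: "t \<in> J \<Longrightarrow> space_deriv X u t = g u t *\<^sub>R T u t"
  unfolding space_deriv_def by (rule vector_derivative_at[OF X_u])

lemma mixed_deriv_1_0: "t \<in> J \<Longrightarrow> mixed_deriv J 1 0 X u t = g u t *\<^sub>R T u t"
  by (simp add: mixed_deriv_def space_deriv_X)

lemma mixed_deriv_2_0:
  assumes "t \<in> J"
  shows "mixed_deriv J 2 0 X u t = g' u t *\<^sub>R T u t + (g u t)\<^sup>2 *\<^sub>R k u t"
proof -
  have "((\<lambda>v. g v t *\<^sub>R T v t) has_vector_derivative g u t *\<^sub>R (g u t *\<^sub>R k u t) + g' u t *\<^sub>R T u t) (at u)"
    by (rule has_vector_derivative_scaleR[OF g_u[OF assms] T_u[OF assms]])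
  then have "((\<lambda>v. space_deriv X v t) has_vector_derivative g u t *\<^sub>R (g u t *\<^sub>R k u t) + g' u t *\<^sub>R T u t) (at u)"
    by (simp add: space_deriv_X[OF assms])
  then have "space_deriv (space_deriv X) u t = g u t *\<^sub>R (g u t *\<^sub>R k u t) + g' u t *\<^sub>R T u t"
    unfolding space_deriv_def[of "space_deriv X"] by (rule vector_derivative_at)
  then show ?thesis by (simp add: mixed_deriv_def numeral_2_eq_2 add.commute)
qed

lemma mixed_deriv_0_1:
  assumes "at t within J \<noteq> bot" "t \<in> J"
  shows "mixed_deriv J 0 1 X u t = k u t"
  using vector_derivative_within[OF assms(1) X_t[OF assms(2)]]
  by (simp add: mixed_deriv_def time_deriv_def)

lemma mixed_deriv_1_1:
  assumes "at t within J \<noteq> bot" "t \<in> J"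
  shows "mixed_deriv J 1 1 X u t = g u t *\<^sub>R k1 u t"
proof -
  have eq: "time_deriv J X v t = k v t" for v
    using mixed_deriv_0_1[OF assms, of v] by (simp add: mixed_deriv_def)
  have "space_deriv (time_deriv J X) u t = g u t *\<^sub>R k1 u t"
    unfolding space_deriv_def eq by (rule vector_derivative_at[OF k_u[OF assms(2)]])
  then show ?thesis by (simp add: mixed_deriv_def)
qed

lemma arclength_deriv_2: 
  assumes "t \<in> J"
  shows "arclength_deriv (\<lambda>v. X v t) 2 u = k u t"
proof -
  have vd: "vector_derivative (\<lambda>v. X v t) (at u) = g u t *\<^sub>R T u t" for u
    by (rule vector_derivative_at[OF X_u[OF assms]])
  have n: "norm (g u t *\<^sub>R T u t) = g u t" for u
    using T_T[OF assms, of u] g_pos[OF assms, of u] by (simp add: norm_eq_1)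
  have Tv: "(g u t *\<^sub>R T u t) /\<^sub>R g u t = T u t" for u
    using g_pos[OF assms, of u] by simp
  have "arclength_deriv (\<lambda>v. X v t) 2 u = vector_derivative (\<lambda>v. T v t) (at u) /\<^sub>R g u t"
    unfolding arclength_deriv_def numeral_2_eq_2 by (simp only: funpow.simps o_def id_def vd n Tv)
  also have "\<dots> = k u t"
    unfolding vector_derivative_at[OF T_u[OF assms]] using g_pos[OF assms, of u] by simp
  finally show ?thesis .
qed

lemma curvature_eq: "t \<in> J \<Longrightarrow> curvature (\<lambda>v. X v t) u = norm (k u t)"
  by (simp add: curvature_def arclength_deriv_2)

end

section \<open>Total curvature of closed curves\<close>

context csf_frame
begin

definition total_reg_curvature :: "real \<Rightarrow> real \<Rightarrow> real \<Rightarrow> real" where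
  "total_reg_curvature p \<epsilon> t = integral {0..p} (\<lambda>u. reg_curvature \<epsilon> (k u t) * g u t)"

definition total_curvature :: "real \<Rightarrow> real \<Rightarrow> real" where
  "total_curvature p t = integral {0..p} (\<lambda>u. norm (k u t) * g u t)"

definition curve_length :: "real \<Rightarrow> real \<Rightarrow> real" where
  "curve_length p t = integral {0..p} (\<lambda>u. g u t)"

lemma curve_length_nonincreasing:
  assumes "s \<le> t" "s \<in> J" "t \<in> J"
  shows "curve_length p t \<le> curve_length p s"
proof (rule nonincreasing_within[OF assms(1)])
  fix x assume x: "x \<in> {s..t}"
  have sub: "{s..t} \<subseteq> J" by (rule interval_subset[OF J assms(2,3)])
  have "((\<lambda>x. integral {0..p} (\<lambda>u. 1 * g u x)) has_real_derivative
     integral {0..p} (\<lambda>u. (0 - (k u x \<bullet> k u x) * 1) * g u x)) (at x within {s..t})"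
  proof (rule arclength_integral_t[OF _ _ sub _ _ x])
    show "continuous_on ({s..t} \<times> {0..p}) (\<lambda>(t, u). (0 - (k u t \<bullet> k u t) * 1) * g u t)"
      using continuous_on_swap[OF cont_g sub, of "{0..p}"] continuous_on_swap[OF cont_k sub, of "{0..p}"]
      unfolding split_beta by (intro continuous_intros)
  qed auto
  then show "(curve_length p has_real_derivative integral {0..p} (\<lambda>u. (0 - (k u x \<bullet> k u x) * 1) * g u x)) (at x within {s..t})"
    by (simp add: curve_length_def[abs_def])
  have xJ: "x \<in> J" using x sub by blast
  have "0 \<le> integral {0..p} (\<lambda>u. (k u x \<bullet> k u x) * g u x)"
    by (intro integral_nonneg integrable_continuous_interval continuous_intros
        continuous_on_slice[OF cont_g xJ] continuous_on_slice[OF cont_k xJ])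
      (use g_pos[OF xJ] in \<open>simp add: less_imp_le\<close>)
  then show "integral {0..p} (\<lambda>u. (0 - (k u x \<bullet> k u x) * 1) * g u x) \<le> 0" by simp
qed

lemma total_curvature_le_reg: "t \<in> J \<Longrightarrow> total_curvature p t \<le> total_reg_curvature p \<epsilon> t"
  unfolding total_curvature_def total_reg_curvature_def
  by (intro integral_le integrable_continuous_interval continuous_intros mult_right_mono reg_curvature_ge
      continuous_on_slice[OF cont_g] continuous_on_slice[OF cont_k] continuous_on_slice[OF cont_reg_curvature])
    (auto intro: less_imp_le[OF g_pos])

lemma total_reg_curvature_le:
  assumes t: "t \<in> J" and e: "\<epsilon> > 0"
  shows "total_reg_curvature p \<epsilon> t \<le> total_curvature p t + \<epsilon> * curve_length p t"
proof -
  have "total_reg_curvature p \<epsilon> t \<le> integral {0..p} (\<lambda>u. norm (k u t) * g u t + \<epsilon> * g u t)"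
    unfolding total_reg_curvature_def
  proof (rule integral_le)
    fix u
    have "reg_curvature \<epsilon> (k u t) * g u t \<le> (\<epsilon> + norm (k u t)) * g u t"
      by (intro mult_right_mono reg_curvature_le e less_imp_le[OF g_pos[OF t]])
    then show "reg_curvature \<epsilon> (k u t) * g u t \<le> norm (k u t) * g u t + \<epsilon> * g u t"
      by (simp add: algebra_simps)
  qed (intro integrable_continuous_interval continuous_intros
      continuous_on_slice[OF cont_g t] continuous_on_slice[OF cont_k t] continuous_on_slice[OF cont_reg_curvature t])+
  also have "\<dots> = total_curvature p t + \<epsilon> * curve_length p t"
    unfolding total_curvature_def curve_length_def
    by (subst integral_add) (auto intro!: integrable_continuous_interval continuous_intros
      continuous_on_slice[OF cont_g t] continuous_on_slice[OF cont_k t])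
  finally show ?thesis .
qed

lemma total_curvature_nonneg: "t \<in> J \<Longrightarrow> 0 \<le> total_curvature p t"
  unfolding total_curvature_def
  by (intro integral_nonneg integrable_continuous_interval continuous_intros
      continuous_on_slice[OF cont_g] continuous_on_slice[OF cont_k])
    (auto intro!: mult_nonneg_nonneg less_imp_le[OF g_pos])

end

locale closed_csf_frame = csf_frame +
  fixes p :: real
  assumes p: "p > 0"
    and periodic: "\<And>u t. t \<in> J \<Longrightarrow> g (u + p) t = g u t" "\<And>u t. t \<in> J \<Longrightarrow> k (u + p) t = k u t"
      "\<And>u t. t \<in> J \<Longrightarrow> k1 (u + p) t = k1 u t"
begin

lemma total_reg_curvature_t':
  assumes "t \<in> J" "\<epsilon> > 0"
  shows "(total_reg_curvature p \<epsilon> has_real_derivative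
     - integral {0..p} (\<lambda>u. dissipation \<epsilon> (k u t) (k1 u t) * g u t)) (at t within J)"
  using total_reg_curvature_t[OF periodic(2,3) p assms(2,1)]
  unfolding total_reg_curvature_def[abs_def] .

lemma total_dissipation_nonneg:
  assumes "t \<in> J" "\<epsilon> > 0"
  shows "0 \<le> integral {0..p} (\<lambda>u. dissipation \<epsilon> (k u t) (k1 u t) * g u t)"
  by (intro integral_nonneg integrable_continuous_interval continuous_intros
      continuous_on_slice[OF cont_g] continuous_on_slice[OF cont_dissipation] assms)
    (auto intro!: mult_nonneg_nonneg dissipation_nonneg assms less_imp_le[OF g_pos])

lemma total_reg_curvature_nonincreasing:
  assumes "s \<le> t" "s \<in> J" "t \<in> J" and e: "\<epsilon> > 0"
  shows "total_reg_curvature p \<epsilon> t \<le> total_reg_curvature p \<epsilon> s"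
proof -
  have sub: "{s..t} \<subseteq> J" by (rule interval_subset[OF J assms(2,3)])
  show ?thesis
  proof (rule nonincreasing_within[OF assms(1)])
    fix x assume "x \<in> {s..t}"
    then have x: "x \<in> J" using sub by blast
    show "(total_reg_curvature p \<epsilon> has_real_derivative
       - integral {0..p} (\<lambda>u. dissipation \<epsilon> (k u x) (k1 u x) * g u x)) (at x within {s..t})"
      by (rule has_field_derivative_subset[OF total_reg_curvature_t'[OF x e] sub])
    show "- integral {0..p} (\<lambda>u. dissipation \<epsilon> (k u x) (k1 u x) * g u x) \<le> 0"
      using total_dissipation_nonneg[OF x e] by simp
  qed
qed

text \<open>Let \<open>\<epsilon>\<close> tend to zero in the monotonicity of the regularised total curvature.\<close>

lemma total_curvature_nonincreasing:
  assumes "s \<le> t" "s \<in> J" "t \<in> J"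
  shows "total_curvature p t \<le> total_curvature p s"
proof (rule tendsto_lowerbound[of "\<lambda>\<epsilon>. total_curvature p s + \<epsilon> * curve_length p s" _ "at_right 0"])
  have "((\<lambda>\<epsilon>. total_curvature p s + \<epsilon> * curve_length p s) \<longlongrightarrow> total_curvature p s + 0 * curve_length p s) (at_right 0)"
    by (intro tendsto_intros)
  then show "((\<lambda>\<epsilon>. total_curvature p s + \<epsilon> * curve_length p s) \<longlongrightarrow> total_curvature p s) (at_right 0)" by simp
  show "\<forall>\<^sub>F \<epsilon> in at_right 0. total_curvature p t \<le> total_curvature p s + \<epsilon> * curve_length p s"
    using eventually_at_right_less[of 0]
  proof eventually_elim
    case (elim \<epsilon>)
    show ?case
      using total_curvature_le_reg[OF assms(3), of p \<epsilon>] total_reg_curvature_nonincreasing[OF assms elim]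
        total_reg_curvature_le[OF assms(2) elim, of p] by linarith
  qed
qed auto

text \<open>The total curvature is nonincreasing and nonnegative, so it converges at the end \<open>\<omega>\<close> of the time
  interval; regularising changes it by at most \<open>\<epsilon>\<close> times the length, which is bounded. Thus the
  dissipation between two times tending to \<open>\<omega>\<close> tends to zero.\<close>

lemma total_reg_curvature_drop:
  assumes J: "J = {0..<\<omega>}"
    and ab: "\<And>j. a j \<le> b j" "\<forall>\<^sub>F j in sequentially. a j \<in> J \<and> b j \<in> J" "a \<longlonglongrightarrow> \<omega>"
    and e: "\<forall>\<^sub>F j in sequentially. e j > 0" "e \<longlonglongrightarrow> 0"
  shows "(\<lambda>j. total_reg_curvature p (e j) (a j) - total_reg_curvature p (e j) (b j)) \<longlonglongrightarrow> 0"
proof -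
  let ?K = "total_curvature p"
  define m where "m = Inf (?K ` J)"
  obtain j where "a j \<in> J" using ab(2) by (auto simp: eventually_sequentially)
  then have ne: "J \<noteq> {}" and zero: "0 \<in> J" by (auto simp: J)
  have bdd: "bdd_below (?K ` J)" using total_curvature_nonneg by (intro bdd_belowI[of _ 0]) auto
  have K_m: "m \<le> ?K t" if "t \<in> J" for t
    unfolding m_def using bdd that by (intro cInf_lower) auto
  have Ka: "(\<lambda>j. ?K (a j)) \<longlonglongrightarrow> m"
  proof (rule order_tendstoI)
    fix c assume "c < m"
    then show "\<forall>\<^sub>F j in sequentially. c < ?K (a j)"
      using ab(2) K_m by (auto elim!: eventually_mono intro: less_le_trans)
  next
    fix c assume "m < c"
    then obtain s where s: "s \<in> J" "?K s < c"
      unfolding m_def using bdd ne by (auto simp: cInf_less_iff)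
    have "\<forall>\<^sub>F j in sequentially. s < a j"
      using order_tendstoD(1)[OF ab(3)] s(1) by (auto simp: J)
    with ab(2) show "\<forall>\<^sub>F j in sequentially. ?K (a j) < c"
    proof eventually_elim
      case (elim j)
      then have "?K (a j) \<le> ?K s" using s(1) by (intro total_curvature_nonincreasing) auto
      with s(2) show ?case by simp
    qed
  qed
  have "(\<lambda>j. ?K (a j) - m + e j * curve_length p 0) \<longlonglongrightarrow> m - m + 0 * curve_length p 0"
    by (intro tendsto_intros Ka e(2))
  then have U: "(\<lambda>j. ?K (a j) - m + e j * curve_length p 0) \<longlonglongrightarrow> 0" by simp
  show ?thesis
  proof (rule tendsto_sandwich[OF _ _ tendsto_const U])
    show "\<forall>\<^sub>F j in sequentially. 0 \<le> total_reg_curvature p (e j) (a j) - total_reg_curvature p (e j) (b j)"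
      using ab(2) e(1) by eventually_elim (use total_reg_curvature_nonincreasing[OF ab(1)] in auto)
    show "\<forall>\<^sub>F j in sequentially. total_reg_curvature p (e j) (a j) - total_reg_curvature p (e j) (b j)
        \<le> ?K (a j) - m + e j * curve_length p 0"
      using ab(2) e(1)
    proof eventually_elim
      case (elim j)
      then have aJ: "a j \<in> J" and bJ: "b j \<in> J" and ej: "e j > 0" by auto
      have "0 \<le> a j" using aJ by (auto simp: J)
      have "e j * curve_length p (a j) \<le> e j * curve_length p 0"
        using curve_length_nonincreasing[OF \<open>0 \<le> a j\<close> zero aJ] ej by (intro mult_left_mono) auto
      with total_reg_curvature_le[OF aJ ej, of p] total_curvature_le_reg[OF bJ, of p "e j"] K_m[OF bJ]
      show ?case by linarith
    qed
  qed
qed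

text \<open>A piece of the rescaled curve may cover the original closed curve several times. Its dissipation is
  bounded by that of the closed curve times the number of periods which it meets.\<close>

lemma rescaled_dissipation_le:
  assumes l: "l > 0" and t0: "t0 \<in> J" and L: "orthogonal_transformation L"
    and \<phi>: "\<And>v. (\<phi> has_real_derivative 1 / (l * g (\<phi> v) t0)) (at v)"
    and t: "t \<in> J" and e: "\<epsilon> > 0" and ab: "a \<le> b" and N: "\<phi> b - \<phi> a \<le> real N * p"
  shows "integral {a..b} (\<lambda>v. dissipation (\<epsilon> / l) ((1 / l) *\<^sub>R L (k (\<phi> v) t)) ((1 / l\<^sup>2) *\<^sub>R L (k1 (\<phi> v) t))
            * (g (\<phi> v) t / g (\<phi> v) t0))
    \<le> (real N + 1) * (1 / l\<^sup>2 * integral {0..p} (\<lambda>u. dissipation \<epsilon> (k u t) (k1 u t) * g u t))"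
proof -
  let ?D = "\<lambda>u. dissipation \<epsilon> (k u t) (k1 u t) * g u t"
  have cD: "continuous_on S ?D" for S
    by (intro continuous_intros continuous_on_slice[OF cont_g t] continuous_on_slice[OF cont_dissipation[OF e] t])
  have nn: "?D u \<ge> 0" for u
    using dissipation_nonneg[OF t e, of u] g_pos[OF t, of u] by simp
  have g0: "g u t0 > 0" for u by (rule g_pos[OF t0])
  have mono: "\<phi> x \<le> \<phi> y" if "x \<le> y" for x y
    by (rule DERIV_nonneg_imp_nondecreasing[OF that]) (use \<phi> g0 l in \<open>force intro!: less_imp_le\<close>)
  have "((\<lambda>v. (1 / (l * g (\<phi> v) t0)) *\<^sub>R ?D (\<phi> v)) has_integral (integral {\<phi> a..\<phi> b} ?D)) {a..b}"
    by (rule has_integral_substitution[where c = "\<phi> a" and d = "\<phi> b"])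
      (use ab mono cD \<phi> in \<open>auto intro: has_field_derivative_at_within\<close>)
  then have "((\<lambda>v. 1 / l\<^sup>2 * ((1 / (l * g (\<phi> v) t0)) *\<^sub>R ?D (\<phi> v))) has_integral
      1 / l\<^sup>2 * (integral {\<phi> a..\<phi> b} ?D)) {a..b}"
    by (rule has_integral_mult_right)
  moreover have "1 / l\<^sup>2 * ((1 / (l * g (\<phi> v) t0)) *\<^sub>R ?D (\<phi> v)) =
     dissipation (\<epsilon> / l) ((1 / l) *\<^sub>R L (k (\<phi> v) t)) ((1 / l\<^sup>2) *\<^sub>R L (k1 (\<phi> v) t)) * (g (\<phi> v) t / g (\<phi> v) t0)" for v
    unfolding dissipation_rescale[OF l L] by (simp add: power2_eq_square power3_eq_cube)
  ultimately have "integral {a..b} (\<lambda>v. dissipation (\<epsilon> / l) ((1 / l) *\<^sub>R L (k (\<phi> v) t)) ((1 / l\<^sup>2) *\<^sub>R L (k1 (\<phi> v) t))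
            * (g (\<phi> v) t / g (\<phi> v) t0)) = 1 / l\<^sup>2 * (integral {\<phi> a..\<phi> b} ?D)"
    by (simp add: integral_unique)
  moreover have "integral {\<phi> a..\<phi> b} ?D \<le> (real N + 1) * integral {0..p} ?D"
    by (rule integral_periodic_le[OF p _ cD nn N]) (simp add: periodic t)
  then have "1 / l\<^sup>2 * (integral {\<phi> a..\<phi> b} ?D) \<le> 1 / l\<^sup>2 * ((real N + 1) * integral {0..p} ?D)"
    by (rule mult_left_mono) simp
  ultimately show ?thesis by (simp add: mult.left_commute)
qed

end

section \<open>Limits with vanishing dissipation\<close>

text \<open>A flow \<open>X\<close> which is a limit of flows \<open>Xs j\<close> whose dissipation, regularised with \<open>e j\<close>, tends to zero. The
  functions \<open>G j\<close> act as budgets: up to the factor \<open>N\<close>, their decrease pays for the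
  dissipation on \<open>[-M, M]\<close>, and they become constant in the limit. For rescaled flows \<open>G j\<close> is the
  regularised total curvature of the whole closed curve. The product \<open>gs * k1s\<close> appears because it is a mixed
  derivative.\<close>

locale csf_approximation = csf_frame I X g g' T k k1 k2
  for I :: "real set" and X :: "real \<Rightarrow> real \<Rightarrow> 'a::euclidean_space"
    and g g' :: "real \<Rightarrow> real \<Rightarrow> real" and T k k1 k2 :: "real \<Rightarrow> real \<Rightarrow> 'a" +
  fixes J :: "nat \<Rightarrow> real set" and Xs :: "nat \<Rightarrow> real \<Rightarrow> real \<Rightarrow> 'a"
    and gs gs' :: "nat \<Rightarrow> real \<Rightarrow> real \<Rightarrow> real" and Ts ks k1s k2s :: "nat \<Rightarrow> real \<Rightarrow> real \<Rightarrow> 'a"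
    and e :: "nat \<Rightarrow> real" and G :: "nat \<Rightarrow> real \<Rightarrow> real"
  assumes frames: "\<forall>\<^sub>F j in sequentially.
      csf_frame (J j) (Xs j) (gs j) (gs' j) (Ts j) (ks j) (k1s j) (k2s j)"
    and e_pos: "\<forall>\<^sub>F j in sequentially. e j > 0" and e_lim: "e \<longlonglongrightarrow> 0"
    and times: "\<And>t1 t2. {t1..t2} \<subseteq> I \<Longrightarrow> \<forall>\<^sub>F j in sequentially. {t1..t2} \<subseteq> J j"
    and conv_g: "\<And>M t1 t2. {t1..t2} \<subseteq> I \<Longrightarrow> uniform_limit ({-M..M} \<times> {t1..t2})
      (\<lambda>j (u, t). gs j u t) (\<lambda>(u, t). g u t) sequentially"
    and conv_k: "\<And>M t1 t2. {t1..t2} \<subseteq> I \<Longrightarrow> uniform_limit ({-M..M} \<times> {t1..t2})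
      (\<lambda>j (u, t). ks j u t) (\<lambda>(u, t). k u t) sequentially"
    and conv_gk1: "\<And>M t1 t2. {t1..t2} \<subseteq> I \<Longrightarrow> uniform_limit ({-M..M} \<times> {t1..t2})
      (\<lambda>j (u, t). gs j u t *\<^sub>R k1s j u t) (\<lambda>(u, t). g u t *\<^sub>R k1 u t) sequentially"
    and bound_g': "\<And>M t1 t2. {t1..t2} \<subseteq> I \<Longrightarrow>
      \<exists>B. \<forall>\<^sub>F j in sequentially. \<forall>u\<in>{-M..M}. \<forall>t\<in>{t1..t2}. \<bar>gs' j u t\<bar> \<le> B"
    and budget: "\<And>M t1 t2. {t1..t2} \<subseteq> I \<Longrightarrow>
      \<exists>N>0. \<forall>\<^sub>F j in sequentially. \<forall>t\<in>{t1..t2}. \<exists>d.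
        (G j has_real_derivative - d) (at t within {t1..t2}) \<and>
        integral {-M..M} (\<lambda>u. dissipation (e j) (ks j u t) (k1s j u t) * gs j u t) \<le> N * d"
    and budget_lim: "\<And>t1 t2. t1 \<le> t2 \<Longrightarrow> {t1..t2} \<subseteq> I \<Longrightarrow> (\<lambda>j. G j t1 - G j t2) \<longlonglongrightarrow> 0"

text \<open>With \<open>d = u - l(t)\<close>, \<open>s = l'(t)\<close> and \<open>P = r\<^sup>2 - d\<^sup>2\<close> this is, up to a positive factor, the inequality
  \<open>g \<Phi>\<^sub>t \<le> g \<Phi>\<^sub>s\<^sub>s\<close> for \<open>\<Phi> = exp (- A t) P\<^sup>3\<close>, a bump in a tube of radius \<open>r\<close> around the moving point \<open>l(t)\<close>.
  It reduces to \<open>\<alpha> P\<^sup>2 - H P + \<beta> \<ge> 0\<close> with \<open>\<alpha> = A m\<close> and \<open>\<beta> = 24 r\<^sup>2 / C\<close>: the term \<open>\<beta>\<close>, which comes from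
  \<open>(P\<^sub>u)\<^sup>2\<close>, wins near the edge of the tube and \<open>\<alpha> P\<^sup>2\<close> wins inside. The constant \<open>A\<close> is chosen such
  that the discriminant \<open>H\<^sup>2 - 4 \<alpha> \<beta>\<close> is negative.\<close>

lemma barrier_inequality:
  fixes m C B r d s P gg gg' A H :: real
  assumes m: "0 < m" "m \<le> gg" "gg \<le> C" and B: "\<bar>gg'\<bar> \<le> B" and r: "r > 0" and d: "\<bar>d\<bar> \<le> r"
    and P: "P = r\<^sup>2 - d\<^sup>2"
    and H: "H = 6 * r * \<bar>s\<bar> * C + 30 / m + 6 * r * B / m\<^sup>2"
    and A: "A = (H\<^sup>2 * C / (96 * r\<^sup>2) + 1) / m"
  shows "gg * (- A * P\<^sup>2 + 6 * P * d * s) \<le> (24 * d\<^sup>2 - 6 * P) / gg + 6 * P * d * gg' / gg\<^sup>2"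
proof -
  have gg: "gg > 0" and C: "C > 0" using m by linarith+
  have P0: "P \<ge> 0"
    using d r by (simp add: P abs_le_square_iff[of d r, symmetric])
  define \<alpha> where "\<alpha> = H\<^sup>2 * C / (96 * r\<^sup>2) + 1"
  have \<alpha>: "\<alpha> > 0" unfolding \<alpha>_def using C r by (intro add_nonneg_pos) auto
  have A\<alpha>: "A = \<alpha> / m" "A > 0" using \<alpha> m by (auto simp: A \<alpha>_def)
  have 1: "\<alpha> * P\<^sup>2 \<le> gg * A * P\<^sup>2"
  proof -
    have "\<alpha> = m * A" using m by (simp add: A\<alpha>)
    also have "\<dots> \<le> gg * A" using m A\<alpha> by (intro mult_right_mono) auto
    finally show ?thesis by (rule mult_right_mono) simp
  qed
  have 2: "gg * (6 * P * d * s) \<le> 6 * r * \<bar>s\<bar> * C * P"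
  proof -
    have "gg * (6 * P * d * s) \<le> gg * (6 * P) * (\<bar>d\<bar> * \<bar>s\<bar>)"
    proof -
      have "gg * (6 * P) * (d * s) \<le> gg * (6 * P) * (\<bar>d\<bar> * \<bar>s\<bar>)"
        using gg P0 abs_ge_self[of "d * s"] by (intro mult_left_mono) (auto simp: abs_mult)
      then show ?thesis by (simp add: mult.assoc)
    qed
    also have "\<dots> \<le> C * (6 * P) * (r * \<bar>s\<bar>)"
      using gg P0 m d C by (intro mult_mono) auto
    finally show ?thesis by (simp add: mult.commute mult.left_commute)
  qed
  have 3: "30 * P / gg \<le> 30 / m * P"
    using frac_le[of "30 * P" "30 * P" m gg] m P0 by simp
  have 4: "- (6 * P * d * gg' / gg\<^sup>2) \<le> 6 * r * B / m\<^sup>2 * P"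
  proof -
    have "- (6 * P * d * gg') \<le> 6 * P * (\<bar>d\<bar> * \<bar>gg'\<bar>)"
    proof -
      have "6 * P * (- (d * gg')) \<le> 6 * P * (\<bar>d\<bar> * \<bar>gg'\<bar>)"
        using P0 abs_ge_minus_self[of "d * gg'"] by (intro mult_left_mono) (auto simp: abs_mult)
      then show ?thesis by (simp add: mult.assoc)
    qed
    also have "\<dots> \<le> 6 * P * (r * B)"
      using P0 d B r by (intro mult_left_mono mult_mono) auto
    finally have a: "- (6 * P * d * gg') \<le> 6 * P * (r * B)" .
    have "B \<ge> 0" using B by linarith
    then have b: "0 \<le> 6 * P * (r * B)" using P0 r by simp
    have "- (6 * P * d * gg' / gg\<^sup>2) = - (6 * P * d * gg') / gg\<^sup>2" by simp
    also have "\<dots> \<le> 6 * P * (r * B) / m\<^sup>2"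
      using m by (intro frac_le a b) auto
    also have "\<dots> = 6 * r * B / m\<^sup>2 * P" by simp
    finally show ?thesis .
  qed
  have 5: "24 * r\<^sup>2 / C \<le> 24 * r\<^sup>2 / gg"
    using m C by (intro divide_left_mono) auto
  have "0 \<le> \<alpha> * P\<^sup>2 - H * P + 24 * r\<^sup>2 / C"
  proof -
    have "4 * \<alpha> * (\<alpha> * P\<^sup>2 - H * P + 24 * r\<^sup>2 / C) = (2 * \<alpha> * P - H)\<^sup>2 + (4 * \<alpha> * (24 * r\<^sup>2 / C) - H\<^sup>2)"
      by (simp add: power2_eq_square algebra_simps)
    moreover have "4 * \<alpha> * (24 * r\<^sup>2 / C) = H\<^sup>2 + 96 * r\<^sup>2 / C"
      using r C unfolding \<alpha>_def by (simp add: field_simps)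
    ultimately have "0 \<le> 4 * \<alpha> * (\<alpha> * P\<^sup>2 - H * P + 24 * r\<^sup>2 / C)"
      using C by simp
    with \<alpha> show ?thesis by (simp add: zero_le_mult_iff)
  qed
  moreover have "H * P = 6 * r * \<bar>s\<bar> * C * P + 30 / m * P + 6 * r * B / m\<^sup>2 * P"
    by (simp add: H distrib_right)
  moreover have "(24 * d\<^sup>2 - 6 * P) / gg = 24 * r\<^sup>2 / gg - 30 * P / gg"
  proof -
    have eq: "24 * d\<^sup>2 - 6 * P = 24 * r\<^sup>2 - 30 * P" by (simp add: P)
    show ?thesis by (simp only: eq diff_divide_distrib)
  qed
  moreover have "gg * (- A * P\<^sup>2 + 6 * P * d * s) = gg * (6 * P * d * s) - gg * A * P\<^sup>2"
    by (simp add: algebra_simps)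
  ultimately show ?thesis using 1 2 3 4 5 by linarith
qed

context csf_approximation
begin

abbreviation total_dissipation :: "nat \<Rightarrow> real \<Rightarrow> real \<Rightarrow> real" where
  "total_dissipation j M t \<equiv> integral {-M..M} (\<lambda>u. dissipation (e j) (ks j u t) (k1s j u t) * gs j u t)"

lemma compact_rect: "compact ({-M..M} \<times> {t1..t2::real})" for M :: real
  by (intro compact_Times compact_Icc)

lemma uniform_close:
  assumes "uniform_limit K (\<lambda>j (u, t). hs j u t) (\<lambda>(u, t). h u t) sequentially" "\<delta> > 0"
  shows "\<forall>\<^sub>F j in sequentially. \<forall>u t. (u, t) \<in> K \<longrightarrow> dist (hs j u t) (h u t) < \<delta>"
  using uniform_limitD[OF assms] by (auto elim!: eventually_mono)

text \<open>If \<open>c \<integral> D + b\<close> bounds the growth rate of \<open>Y j\<close>, then \<open>Y j + c N (G j) - b t\<close> is nonincreasing, and the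
  budget \<open>G j\<close> contributes nothing in the limit.\<close>

lemma budget_bound:
  assumes sub: "{t1..t2} \<subseteq> I" and "t1 \<le> t2" and c: "c \<ge> 0"
    and Y: "\<forall>\<^sub>F j in sequentially. \<forall>t\<in>{t1..t2}. \<exists>D. (Y j has_real_derivative D) (at t within {t1..t2}) \<and>
      D \<le> c * total_dissipation j M t + b"
    and \<eta>: "\<eta> > 0"
  shows "\<forall>\<^sub>F j in sequentially. Y j t2 \<le> Y j t1 + b * (t2 - t1) + \<eta>"
proof -
  obtain N where N: "N > 0" and N_b: "\<forall>\<^sub>F j in sequentially. \<forall>t\<in>{t1..t2}. \<exists>d.
        (G j has_real_derivative - d) (at t within {t1..t2}) \<and>
        total_dissipation j M t \<le> N * d"
    using budget[OF sub] by blast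
  have "(\<lambda>j. c * N * (G j t1 - G j t2)) \<longlonglongrightarrow> c * N * 0"
    by (intro tendsto_intros budget_lim assms)
  then have "\<forall>\<^sub>F j in sequentially. c * N * (G j t1 - G j t2) < \<eta>"
    using \<eta> by (auto dest: order_tendstoD(2))
  with N_b Y show ?thesis
  proof eventually_elim
    case (elim j)
    define D where "D t = (SOME D. (Y j has_real_derivative D) (at t within {t1..t2}) \<and>
      D \<le> c * total_dissipation j M t + b)" for t
    define d where "d t = (SOME d. (G j has_real_derivative - d) (at t within {t1..t2}) \<and>
        total_dissipation j M t \<le> N * d)" for t
    have "Y j t2 + c * N * G j t2 - b * t2 \<le> Y j t1 + c * N * G j t1 - b * t1"
    proof (rule nonincreasing_within[OF \<open>t1 \<le> t2\<close>])
      fix t assume t: "t \<in> {t1..t2}"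
      let ?I = "total_dissipation j M t"
      have D: "(Y j has_real_derivative D t) (at t within {t1..t2}) \<and> D t \<le> c * ?I + b"
        unfolding D_def using elim(2) t by (intro someI_ex[of "\<lambda>D. _ D \<and> _ D"]) blast
      have d: "(G j has_real_derivative - d t) (at t within {t1..t2}) \<and> ?I \<le> N * d t"
        unfolding d_def using elim(1) t by (intro someI_ex[of "\<lambda>D. _ D \<and> _ D"]) blast
      show "((\<lambda>t. Y j t + c * N * G j t - b * t) has_real_derivative D t + c * N * (- d t) - b) (at t within {t1..t2})"
        using D d by (auto intro!: derivative_eq_intros)
      have "c * ?I \<le> c * (N * d t)" using c d by (intro mult_left_mono) auto
      with D show "D t + c * N * (- d t) - b \<le> 0" by (simp add: mult.assoc)
    qed
    with elim(3) show ?case by (simp add: algebra_simps)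
  qed
qed

lemma speed_bounds:
  assumes sub: "{t1..t2} \<subseteq> I" and ne: "t1 \<le> t2" "M \<ge> 0"
  obtains m C where "0 < m" "0 < C" "\<forall>\<^sub>F j in sequentially. \<forall>u\<in>{-M..M}. \<forall>t\<in>{t1..t2}. m \<le> gs j u t \<and> gs j u t \<le> C"
proof -
  let ?K = "{-M..M} \<times> {t1..t2}"
  have cg: "continuous_on ?K (\<lambda>(u, t). g u t)"
    by (rule continuous_on_subset[OF cont_g]) (use sub in auto)
  have K: "?K \<noteq> {}" using ne by auto
  obtain x where x: "x \<in> ?K" "\<And>y. y \<in> ?K \<Longrightarrow> (case x of (u, t) \<Rightarrow> g u t) \<le> (case y of (u, t) \<Rightarrow> g u t)"
    using continuous_attains_inf[OF compact_rect K cg] by blast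
  obtain z where z: "z \<in> ?K" "\<And>y. y \<in> ?K \<Longrightarrow> (case y of (u, t) \<Rightarrow> g u t) \<le> (case z of (u, t) \<Rightarrow> g u t)"
    using continuous_attains_sup[OF compact_rect K cg] by blast
  define m where "m = (case x of (u, t) \<Rightarrow> g u t)"
  define C where "C = (case z of (u, t) \<Rightarrow> g u t)"
  have m: "m > 0" using x(1) sub g_pos by (auto simp: m_def)
  have gb: "m \<le> g u t" "g u t \<le> C" if "(u, t) \<in> ?K" for u t
    using x(2)[OF that] z(2)[OF that] by (auto simp: m_def C_def)
  have "\<forall>\<^sub>F j in sequentially. \<forall>u t. (u, t) \<in> ?K \<longrightarrow> dist (gs j u t) (g u t) < m / 2"
    by (rule uniform_close[OF conv_g[OF sub]]) (use m in simp)
  then have "\<forall>\<^sub>F j in sequentially. \<forall>u\<in>{-M..M}. \<forall>t\<in>{t1..t2}. m / 2 \<le> gs j u t \<and> gs j u t \<le> C + m / 2"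
  proof eventually_elim
    case (elim j)
    show ?case
    proof (intro ballI)
      fix u t assume "u \<in> {-M..M}" "t \<in> {t1..t2}"
      then have ut: "(u, t) \<in> ?K" by auto
      have "\<bar>gs j u t - g u t\<bar> < m / 2" using elim ut by (auto simp: dist_real_def)
      with gb[OF ut] show "m / 2 \<le> gs j u t \<and> gs j u t \<le> C + m / 2"
        by (intro conjI; linarith)
    qed
  qed
  moreover have "C + m / 2 > 0" using m z(2)[OF x(1)] by (simp add: m_def[symmetric] C_def[symmetric])
  ultimately show thesis using m by (intro that[of "m / 2" "C + m / 2"]) auto
qed

text \<open>Suppose \<open>|k| > 0\<close> at \<open>(x1, t1)\<close> but \<open>k = 0\<close> at \<open>(x2, t2)\<close>. A small bump below \<open>|k|\<close> around \<open>x1\<close> at time \<open>t1\<close> is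
  moved along the segment to \<open>x2\<close> as a subsolution \<open>\<Phi>\<close>. By comparison with the approximating flows, the
  integral \<open>Y j\<close> of the cubed positive part of \<open>\<Phi> - f\<close> starts at zero and stays small. But
  \<open>\<Phi> - f\<close> is bounded below by a positive constant near \<open>(x2, t2)\<close>, because \<open>f\<close> converges to \<open>|k|\<close>, uniformly.\<close>

theorem strong_maximum_principle:
  assumes t: "t1 \<in> I" "t2 \<in> I" "t1 < t2" and pos: "k x1 t1 \<noteq> 0"
  shows "k x2 t2 \<noteq> 0"
proof
  assume zero: "k x2 t2 = 0"
  have sub: "{t1..t2} \<subseteq> I" by (rule interval_subset[OF J t(1,2)])
  have t12: "t1 \<le> t2" using t by simp
  define \<kappa> where "\<kappa> = norm (k x1 t1)"
  have \<kappa>: "\<kappa> > 0" using pos by (simp add: \<kappa>_def)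
  have "\<kappa> / 2 < norm (k x1 t1)" using \<kappa> by (simp add: \<kappa>_def)
  then obtain r where r: "r > 0" "\<And>u. \<bar>u - x1\<bar> \<le> r \<Longrightarrow> \<kappa> / 2 < norm (k u t1)"
    by (rule continuous_greater_near[OF continuous_on_norm[OF continuous_on_slice[OF cont_k t(1)]]]) blast
  define M where "M = \<bar>x1\<bar> + \<bar>x2\<bar> + r + 1"
  have M: "M \<ge> 0" using r by (simp add: M_def)
  obtain m C where mC: "0 < m" "0 < C" "\<forall>\<^sub>F j in sequentially. \<forall>u\<in>{-M..M}. \<forall>t\<in>{t1..t2}. m \<le> gs j u t \<and> gs j u t \<le> C"
    using speed_bounds[OF sub t12 M] .
  obtain B where B: "\<forall>\<^sub>F j in sequentially. \<forall>u\<in>{-M..M}. \<forall>t\<in>{t1..t2}. \<bar>gs' j u t\<bar> \<le> B"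
    using bound_g'[OF sub] by blast
  define s where "s = (x2 - x1) / (t2 - t1)"
  define l where "l = (\<lambda>t. x1 + s * (t - t1))"
  have l1: "l t1 = x1" and l2: "l t2 = x2" using t by (auto simp: l_def s_def)
  have l_between: "\<bar>l t\<bar> \<le> \<bar>x1\<bar> + \<bar>x2\<bar>" if "t \<in> {t1..t2}" for t
  proof -
    define \<theta> where "\<theta> = (t - t1) / (t2 - t1)"
    have \<theta>: "0 \<le> \<theta>" "\<theta> \<le> 1" using that t by (auto simp: \<theta>_def)
    have "s * (t - t1) = (x2 - x1) * \<theta>" by (simp add: s_def \<theta>_def)
    then have "l t = (1 - \<theta>) * x1 + \<theta> * x2" by (simp add: l_def algebra_simps)
    then have "\<bar>l t\<bar> \<le> \<bar>(1 - \<theta>) * x1\<bar> + \<bar>\<theta> * x2\<bar>" by (simp add: abs_triangle_ineq)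
    also have "\<dots> \<le> \<bar>x1\<bar> + \<bar>x2\<bar>"
      using \<theta> by (intro add_mono) (auto simp: abs_mult mult_left_le_one_le)
    finally show ?thesis .
  qed
  define H where "H = 6 * r * \<bar>s\<bar> * C + 30 / m + 6 * r * B / m\<^sup>2"
  define A where "A = (H\<^sup>2 * C / (96 * r\<^sup>2) + 1) / m"
  define Q where "Q = (\<lambda>u t. r\<^sup>2 - (u - l t)\<^sup>2)"
  define P where "P = (\<lambda>u t. max 0 (Q u t))"
  \<comment> \<open>As \<open>P \<le> r\<^sup>2\<close>, this normalisation gives \<open>\<Phi> \<le> \<kappa> / 4\<close>.\<close>
  define c where "c = \<kappa> / (4 * r ^ 6)"
  define E where "E = (\<lambda>t. c * exp (- (A * (t - t1))))"
  have c: "c > 0" using \<kappa> r by (simp add: c_def)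
  have E: "E t > 0" for t using c by (simp add: E_def)
  define \<Phi> where "\<Phi> = (\<lambda>u t. E t * P u t ^ 3)"
  define \<Phi>1 where "\<Phi>1 = (\<lambda>u t. E t * (3 * P u t ^ 2 * (- (2 * (u - l t)))))"
  define \<Phi>2 where "\<Phi>2 = (\<lambda>u t. E t * (24 * P u t * (u - l t)\<^sup>2 - 6 * P u t ^ 2))"
  define \<Phi>t where "\<Phi>t = (\<lambda>u t. E t * (- A * P u t ^ 3 + 6 * P u t ^ 2 * (u - l t) * s))"
  have Q_u: "((\<lambda>v. Q v t) has_real_derivative - (2 * (u - l t))) (at u)" for u t
    unfolding Q_def by (auto intro!: derivative_eq_intros)
  have P_u: "((\<lambda>v. P v t ^ n) has_real_derivative real n * P u t ^ (n - 1) * (- (2 * (u - l t)))) (at u)"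
    if "n \<ge> 2" for u t n
    unfolding P_def using DERIV_chain2[where g = "\<lambda>v. Q v t" and x = u, OF has_real_derivative_pos_part_power[OF that] Q_u] .
  have Q_t: "((\<lambda>t. Q u t) has_real_derivative 2 * (u - l t) * s) (at t within S)" for u t S
    unfolding Q_def l_def by (auto intro!: derivative_eq_intros simp: algebra_simps)
  have P_t: "((\<lambda>t. P u t ^ 3) has_real_derivative 3 * P u t ^ 2 * (2 * (u - l t) * s)) (at t within S)" for u t S
    unfolding P_def using DERIV_chain2[where g = "\<lambda>t. Q u t" and x = t, OF has_real_derivative_pos_part_power[of 3] Q_t] by simp
  have E_t: "(E has_real_derivative - A * E t) (at t within S)" for t S
    unfolding E_def by (auto intro!: derivative_eq_intros)
  have \<Phi>_u: "((\<lambda>v. \<Phi> v t) has_real_derivative \<Phi>1 u t) (at u)" for u t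
    unfolding \<Phi>_def \<Phi>1_def using P_u[of 3 t u] by (intro DERIV_cmult) simp
  have \<Phi>1_u: "((\<lambda>v. \<Phi>1 v t) has_real_derivative \<Phi>2 u t) (at u)" for u t
  proof -
    have "((\<lambda>v. 3 * P v t ^ 2 * (- (2 * (v - l t)))) has_real_derivative
       3 * (2 * P u t * (- (2 * (u - l t)))) * (- (2 * (u - l t))) + - 2 * (3 * P u t ^ 2)) (at u)"
      by (intro DERIV_mult DERIV_cmult) (use P_u[of 2 t u] in \<open>auto intro!: derivative_eq_intros\<close>)
    then have "((\<lambda>v. \<Phi>1 v t) has_real_derivative
       E t * (3 * (2 * P u t * (- (2 * (u - l t)))) * (- (2 * (u - l t))) + - 2 * (3 * P u t ^ 2))) (at u)"
      unfolding \<Phi>1_def by (rule DERIV_cmult)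
    then show ?thesis
      by (rule DERIV_cong) (simp add: \<Phi>2_def power2_eq_square algebra_simps)
  qed
  have \<Phi>_t: "((\<lambda>t. \<Phi> u t) has_real_derivative \<Phi>t u t) (at t within S)" for u t S
    unfolding \<Phi>_def
    by (rule DERIV_cong[OF DERIV_mult[OF E_t P_t]]) (simp add: \<Phi>t_def algebra_simps)
  have cont_\<Phi>: "continuous_on S (\<lambda>(u, t). \<Phi> u t)" "continuous_on S (\<lambda>(u, t). \<Phi>t u t)" for S
    unfolding \<Phi>_def \<Phi>t_def P_def Q_def E_def l_def split_beta by (intro continuous_intros)+
  have P_le: "0 \<le> P u t" "P u t \<le> r\<^sup>2" for u t
    by (auto simp: P_def Q_def)
  have E_le: "E t \<le> c" if "t \<in> {t1..t2}" for t
  proof -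
    have "A \<ge> 0" using mC(1,2) by (simp add: A_def)
    then have "exp (- (A * (t - t1))) \<le> 1" using that by simp
    then show ?thesis unfolding E_def using c by (simp add: mult_left_le)
  qed
  have \<Phi>_le: "\<Phi> u t \<le> \<kappa> / 4" if "t \<in> {t1..t2}" for u t
  proof -
    have "\<Phi> u t \<le> c * (r\<^sup>2) ^ 3"
      unfolding \<Phi>_def using E_le[OF that] P_le[of u t] c by (intro mult_mono power_mono) auto
    also have "\<dots> = \<kappa> / 4" using r by (simp add: c_def power_mult[symmetric])
    finally show ?thesis .
  qed
  have \<Phi>_zero: "\<Phi> u t = 0" if "r \<le> \<bar>u - l t\<bar>" for u t
  proof -
    have "r\<^sup>2 \<le> (u - l t)\<^sup>2" using that r by (simp add: abs_le_square_iff[symmetric])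
    then show ?thesis by (simp add: \<Phi>_def P_def Q_def)
  qed
  have ends: "\<Phi> (- M) t \<le> 0" "\<Phi> M t \<le> 0" if "t \<in> {t1..t2}" for t
    using l_between[OF that] by (auto simp: \<Phi>_zero M_def)
  define Y where "Y = (\<lambda>j t. integral {-M..M} (\<lambda>u. max 0 (\<Phi> u t - reg_curvature (e j) (ks j u t)) ^ 3 * gs j u t))"
  have Y_t: "\<forall>\<^sub>F j in sequentially. \<forall>t\<in>{t1..t2}. \<exists>D. (Y j has_real_derivative D) (at t within {t1..t2}) \<and>
      D \<le> (3 * (\<kappa> / 4)\<^sup>2) * total_dissipation j M t + 0"
    using frames times[OF sub] e_pos mC(3) B
  proof eventually_elim
    case (elim j)
    interpret F: csf_frame "J j" "Xs j" "gs j" "gs' j" "Ts j" "ks j" "k1s j" "k2s j" by (rule elim(1))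
    show ?case
    proof
      fix t assume t: "t \<in> {t1..t2}"
      show "\<exists>D. (Y j has_real_derivative D) (at t within {t1..t2}) \<and>
        D \<le> (3 * (\<kappa> / 4)\<^sup>2) * total_dissipation j M t + 0"
        unfolding Y_def add_0_right
      proof (rule F.comparison_t[where ?\<Phi>1.0 = \<Phi>1 and ?\<Phi>2.0 = \<Phi>2 and \<Phi>t = \<Phi>t, OF elim(2) _ t elim(3) _ _ \<Phi>_u \<Phi>1_u \<Phi>_t cont_\<Phi> ends[OF t] \<Phi>_le[OF t]])
        fix u assume u: "u \<in> {-M..M}"
        have gg: "0 < m" "m \<le> gs j u t" "gs j u t \<le> C" "\<bar>gs' j u t\<bar> \<le> B" using elim(4,5) u t mC(1) by auto
        then have g0: "gs j u t > 0" by linarith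
        show "\<Phi>t u t * gs j u t \<le> \<Phi>2 u t / gs j u t - \<Phi>1 u t * gs' j u t / (gs j u t)\<^sup>2"
        proof (cases "\<bar>u - l t\<bar> \<le> r")
          case False
          then have "r\<^sup>2 \<le> (u - l t)\<^sup>2" using r by (simp add: abs_le_square_iff[symmetric])
          then have "P u t = 0" by (simp add: P_def Q_def)
          then show ?thesis by (simp add: \<Phi>t_def \<Phi>1_def \<Phi>2_def)
        next
          case True
          then have "(u - l t)\<^sup>2 \<le> r\<^sup>2" using r by (simp add: abs_le_square_iff[symmetric])
          then have Pd: "P u t = r\<^sup>2 - (u - l t)\<^sup>2" by (simp add: P_def Q_def)
          have le: "E t * P u t * (gs j u t * (- A * (P u t)\<^sup>2 + 6 * P u t * (u - l t) * s))
             \<le> E t * P u t * ((24 * (u - l t)\<^sup>2 - 6 * P u t) / gs j u t + 6 * P u t * (u - l t) * gs' j u t / (gs j u t)\<^sup>2)"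
            using E[of t] P_le[of u t]
            by (intro mult_left_mono barrier_inequality[OF gg r(1) True Pd H_def A_def]) auto
          have e1: "E t * P u t * (gs j u t * (- A * (P u t)\<^sup>2 + 6 * P u t * (u - l t) * s)) = \<Phi>t u t * gs j u t"
            by (simp add: \<Phi>t_def power2_eq_square power3_eq_cube algebra_simps)
          have e2: "E t * P u t * ((24 * (u - l t)\<^sup>2 - 6 * P u t) / gs j u t + 6 * P u t * (u - l t) * gs' j u t / (gs j u t)\<^sup>2)
             = \<Phi>2 u t / gs j u t - \<Phi>1 u t * gs' j u t / (gs j u t)\<^sup>2"
          proof -
            have "e' * p * ((24 * d\<^sup>2 - 6 * p) / z + 6 * p * d * w / z\<^sup>2) =
                e' * (24 * p * d\<^sup>2 - 6 * p\<^sup>2) / z - e' * (3 * p\<^sup>2 * (- (2 * d))) * w / z\<^sup>2" for e' p d w z :: real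
              by (simp add: power2_eq_square algebra_simps add_divide_distrib diff_divide_distrib)
            then show ?thesis unfolding \<Phi>1_def \<Phi>2_def .
          qed
          show ?thesis using le unfolding e1 e2 .
        qed
      qed (use M \<kappa> in \<open>auto simp: is_interval_cc\<close>)
    qed
  qed
  define v where "v = \<Phi> x2 t2"
  have v: "v > 0" unfolding v_def \<Phi>_def P_def Q_def l2 using E[of t2] r by simp
  have "continuous_on UNIV (\<lambda>u. \<Phi> u t2 - norm (k u t2))"
    by (intro continuous_intros continuous_on_slice[OF cont_\<Phi>(1)[of "UNIV \<times> UNIV"]] continuous_on_slice[OF cont_k t(2)]) simp
  moreover have "v / 2 < \<Phi> x2 t2 - norm (k x2 t2)" using v zero by (simp add: v_def)
  ultimately obtain \<delta>' where \<delta>': "\<delta>' > 0" "\<And>u. \<bar>u - x2\<bar> \<le> \<delta>' \<Longrightarrow> v / 2 < \<Phi> u t2 - norm (k u t2)"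
    by (rule continuous_greater_near) blast
  define \<delta> where "\<delta> = min 1 \<delta>'"
  have \<delta>: "\<delta> > 0" "\<delta> \<le> 1" "\<And>u. \<bar>u - x2\<bar> \<le> \<delta> \<Longrightarrow> v / 2 < \<Phi> u t2 - norm (k u t2)"
    using \<delta>' by (auto simp: \<delta>_def)
  define \<eta> where "\<eta> = \<delta> * ((v / 4) ^ 3 * m)"
  have \<eta>: "\<eta> > 0" using \<delta> v mC(1) by (simp add: \<eta>_def)
  have "\<forall>\<^sub>F j in sequentially. Y j t2 \<le> Y j t1 + 0 * (t2 - t1) + \<eta>"
    by (rule budget_bound[OF sub t12 _ Y_t \<eta>]) simp
  moreover have "\<forall>\<^sub>F j in sequentially. \<forall>u t. (u, t) \<in> {-M..M} \<times> {t1..t2} \<longrightarrow> dist (ks j u t) (k u t) < min (\<kappa> / 4) (v / 8)"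
    by (rule uniform_close[OF conv_k[OF sub]]) (use \<kappa> v in simp)
  moreover have "\<forall>\<^sub>F j in sequentially. e j < v / 8"
    using v by (intro order_tendstoD(2)[OF e_lim]) simp
  ultimately have "\<forall>\<^sub>F j in sequentially. False"
    using frames times[OF sub] e_pos mC(3)
  proof eventually_elim
    case (elim j)
    interpret F: csf_frame "J j" "Xs j" "gs j" "gs' j" "Ts j" "ks j" "k1s j" "k2s j" by (rule elim(4))
    have t2J: "t2 \<in> J j" using elim(5) t12 by auto
    have close: "\<bar>norm (ks j u t) - norm (k u t)\<bar> < min (\<kappa> / 4) (v / 8)" if "u \<in> {-M..M}" "t \<in> {t1..t2}" for u t
      using elim(2) that norm_triangle_ineq3[of "ks j u t" "k u t"] by (fastforce simp: dist_norm)
    have "Y j t1 = integral {-M..M} (\<lambda>u. 0)"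
      unfolding Y_def
    proof (rule integral_cong)
      fix u assume u: "u \<in> {-M..M}"
      have f: "reg_curvature (e j) (ks j u t1) > 0" "norm (ks j u t1) \<le> reg_curvature (e j) (ks j u t1)"
        using elim(6) by (auto intro: reg_curvature_pos reg_curvature_ge)
      have "\<Phi> u t1 \<le> reg_curvature (e j) (ks j u t1)"
      proof (cases "\<bar>u - x1\<bar> \<le> r")
        case True
        have "\<bar>norm (ks j u t1) - norm (k u t1)\<bar> < \<kappa> / 4" "\<Phi> u t1 \<le> \<kappa> / 4"
          using close[OF u, of t1] \<Phi>_le[of t1 u] t12 by auto
        with r(2)[OF True] f show ?thesis by linarith
      next
        case False
        then have "\<Phi> u t1 = 0" by (intro \<Phi>_zero) (simp add: l1)
        with f show ?thesis by simp
      qed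
      then show "max 0 (\<Phi> u t1 - reg_curvature (e j) (ks j u t1)) ^ 3 * gs j u t1 = 0" by simp
    qed
    then have Y1: "Y j t1 = 0" by simp
    have cY: "continuous_on S (\<lambda>u. max 0 (\<Phi> u t2 - reg_curvature (e j) (ks j u t2)) ^ 3 * gs j u t2)" for S
      by (intro continuous_intros continuous_on_slice[OF cont_\<Phi>(1)[of "UNIV \<times> UNIV"]] continuous_on_slice[OF F.cont_g t2J]
          continuous_on_slice[OF F.cont_reg_curvature t2J]) auto
    have inM: "u \<in> {-M..M}" if "u \<in> {x2 - \<delta>..x2 + \<delta>}" for u
      using that \<delta>(2) r(1) by (auto simp: M_def)
    have "2 * \<eta> = integral {x2 - \<delta>..x2 + \<delta>} (\<lambda>u. (v / 4) ^ 3 * m)"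
      using \<delta>(1) by (simp add: \<eta>_def)
    also have "\<dots> \<le> integral {x2 - \<delta>..x2 + \<delta>} (\<lambda>u. max 0 (\<Phi> u t2 - reg_curvature (e j) (ks j u t2)) ^ 3 * gs j u t2)"
    proof (rule integral_le)
      fix u assume u: "u \<in> {x2 - \<delta>..x2 + \<delta>}"
      then have "\<bar>u - x2\<bar> \<le> \<delta>" by auto
      note \<delta>(3)[OF this] reg_curvature_le[OF elim(6), of "ks j u t2"] elim(3)
      moreover have "\<bar>norm (ks j u t2) - norm (k u t2)\<bar> < v / 8"
        using close[OF inM[OF u], of t2] t12 by auto
      ultimately have "v / 4 \<le> \<Phi> u t2 - reg_curvature (e j) (ks j u t2)" by linarith
      then show "(v / 4) ^ 3 * m \<le> max 0 (\<Phi> u t2 - reg_curvature (e j) (ks j u t2)) ^ 3 * gs j u t2"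
        using v mC(1) elim(7) inM[OF u] t12 by (intro mult_mono power_mono) auto
    qed (intro integrable_continuous_interval continuous_intros cY)+
    also have "\<dots> \<le> Y j t2"
      unfolding Y_def
    proof (rule integral_subset_le)
      show "{x2 - \<delta>..x2 + \<delta>} \<subseteq> {-M..M}" using inM by blast
      show "\<forall>u\<in>{-M..M}. 0 \<le> max 0 (\<Phi> u t2 - reg_curvature (e j) (ks j u t2)) ^ 3 * gs j u t2"
        by (auto intro!: mult_nonneg_nonneg less_imp_le[OF F.g_pos[OF t2J]])
    qed (intro integrable_continuous_interval cY)+
    finally have "2 * \<eta> \<le> Y j t2" .
    with elim(1) Y1 \<eta> show False by simp
  qed
  then show False by simp
qed

text \<open>If the expression were positive at a point, then, by convergence of the frames and
  \<open>dissipation_ge\<close>, the dissipation of the approximating flows would be bounded below on a fixed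
  rectangle ending at time \<open>t0\<close>. The budgets would have to drop by a definite amount.\<close>

theorem limit_dissipation_zero:
  assumes t: "t' \<in> I" "t0 \<in> I" "t' < t0"
  shows "(k u0 t0 \<bullet> k u0 t0) * (k1 u0 t0 \<bullet> k1 u0 t0 - (k u0 t0 \<bullet> k u0 t0)\<^sup>2) - (k u0 t0 \<bullet> k1 u0 t0)\<^sup>2 = 0"
proof (rule ccontr)
  \<comment> \<open>\<open>V\<close> is the expression multiplied by \<open>g\<^sup>2\<close>, as a polynomial in the convergent quantities \<open>k\<close>, \<open>g k1\<close>, \<open>g\<close>.\<close>
  define V where "V = (\<lambda>(K::'a) (q::'a) gg. (K \<bullet> K) * (q \<bullet> q - gg\<^sup>2 * (K \<bullet> K)\<^sup>2) - (K \<bullet> q)\<^sup>2)"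
  have V_g: "V K (gg *\<^sub>R q) gg = gg\<^sup>2 * ((K \<bullet> K) * (q \<bullet> q - (K \<bullet> K)\<^sup>2) - (K \<bullet> q)\<^sup>2)" for K q :: 'a and gg
    by (simp add: V_def power2_eq_square algebra_simps)
  define Vl where "Vl = (\<lambda>x. V (k (fst x) (snd x)) (g (fst x) (snd x) *\<^sub>R k1 (fst x) (snd x)) (g (fst x) (snd x)))"
  assume "\<not> ?thesis"
  then have "Vl (u0, t0) > 0"
    using normal_part_Cauchy_Schwarz(1)[OF t(2), of u0] g_pos[OF t(2), of u0]
    by (auto simp: Vl_def V_g)
  define v where "v = Vl (u0, t0)"
  have v: "v > 0" using \<open>Vl (u0, t0) > 0\<close> by (simp add: v_def)
  have cont_Vl: "continuous_on (UNIV \<times> I) Vl"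
    using cont_g cont_k cont_k1 unfolding Vl_def V_def split_beta by (intro continuous_intros)
  have "\<exists>d>0. \<forall>x\<in>UNIV \<times> I. dist x (u0, t0) < d \<longrightarrow> dist (Vl x) (Vl (u0, t0)) < v / 2"
    using cont_Vl v t(2) unfolding continuous_on_iff by (metis SigmaI UNIV_I half_gt_zero)
  then obtain d where d: "d > 0" "\<And>x. x \<in> UNIV \<times> I \<Longrightarrow> dist x (u0, t0) < d \<Longrightarrow> dist (Vl x) (Vl (u0, t0)) < v / 2"
    by blast
  define \<delta> where "\<delta> = d / 4"
  define s0 where "s0 = max t' (t0 - \<delta>)"
  have s0: "s0 < t0" "t' \<le> s0" using t d by (auto simp: s0_def \<delta>_def)
  have \<delta>: "\<delta> > 0" using d by (simp add: \<delta>_def)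
  have sub: "{s0..t0} \<subseteq> I" using interval_subset[OF J t(1,2)] s0 by auto
  define M where "M = \<bar>u0\<bar> + \<delta>"
  have M: "M \<ge> 0" using \<delta> by (simp add: M_def)
  let ?K = "{-M..M} \<times> {s0..t0}"
  have Vl_ge: "v / 2 < Vl (u, t)" if "u \<in> {u0 - \<delta>..u0 + \<delta>}" "t \<in> {s0..t0}" for u t
  proof -
    have "dist (u, t) (u0, t0) \<le> dist u u0 + dist t t0"
      by (simp add: dist_Pair_Pair real_sqrt_sum_squares_triangle_ineq sqrt_sum_squares_le_sum)
    also have "\<dots> < d" using that d(1) by (auto simp: dist_real_def \<delta>_def s0_def abs_if)
    finally have "dist (Vl (u, t)) v < v / 2" using d(2)[of "(u, t)"] that sub by (auto simp: v_def)
    then show ?thesis unfolding dist_real_def by linarith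
  qed
  have cK: "continuous_on ?K (\<lambda>x. h (fst x) (snd x))" if "continuous_on (UNIV \<times> I) (\<lambda>(u, t). h u t)"
    for h :: "real \<Rightarrow> real \<Rightarrow> 'b::topological_space"
    using continuous_on_subset[OF that, of ?K] sub by (auto simp: split_beta)
  have bdd: "bounded (h ` ?K)" if "continuous_on ?K h" for h :: "real \<times> real \<Rightarrow> 'b::metric_space"
    by (intro compact_imp_bounded compact_continuous_image that compact_rect)
  have ul_k: "uniform_limit ?K (\<lambda>j x. ks j (fst x) (snd x)) (\<lambda>x. k (fst x) (snd x)) sequentially"
    and ul_g: "uniform_limit ?K (\<lambda>j x. gs j (fst x) (snd x)) (\<lambda>x. g (fst x) (snd x)) sequentially"
    and ul_q: "uniform_limit ?K (\<lambda>j x. gs j (fst x) (snd x) *\<^sub>R k1s j (fst x) (snd x))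
        (\<lambda>x. g (fst x) (snd x) *\<^sub>R k1 (fst x) (snd x)) sequentially"
    using conv_k[OF sub, of M] conv_g[OF sub, of M] conv_gk1[OF sub, of M] by (simp_all add: case_prod_unfold)
  have c_k: "continuous_on ?K (\<lambda>x. k (fst x) (snd x))" and c_g: "continuous_on ?K (\<lambda>x. g (fst x) (snd x))"
    and c_k1: "continuous_on ?K (\<lambda>x. k1 (fst x) (snd x))"
    by (intro cK cont_k cont_g cont_k1)+
  define Vj where "Vj = (\<lambda>j x. V (ks j (fst x) (snd x)) (gs j (fst x) (snd x) *\<^sub>R k1s j (fst x) (snd x)) (gs j (fst x) (snd x)))"
  have "uniform_limit ?K Vj Vl sequentially"
    unfolding Vj_def Vl_def V_def power2_eq_square
    by (intro uniform_limit_minus bounded_bilinear.bounded_uniform_limit[OF bounded_bilinear_mult]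
        bounded_bilinear.bounded_uniform_limit[OF bounded_bilinear_inner] ul_k ul_g ul_q bdd continuous_intros c_k c_g c_k1)
  then have ev_V: "\<forall>\<^sub>F j in sequentially. \<forall>x\<in>?K. dist (Vj j x) (Vl x) < v / 4"
    using v by (intro uniform_limitD) auto
  obtain m C where mC: "0 < m" "0 < C" "\<forall>\<^sub>F j in sequentially. \<forall>u\<in>{-M..M}. \<forall>t\<in>{s0..t0}. m \<le> gs j u t \<and> gs j u t \<le> C"
    using speed_bounds[OF sub _ M] s0 by auto
  obtain Ck where "\<forall>y\<in>(\<lambda>x. k (fst x) (snd x)) ` ?K. norm y \<le> Ck"
    using bdd[OF c_k] unfolding bounded_iff by blast
  then have Ck: "norm (k (fst x) (snd x)) \<le> Ck" if "x \<in> ?K" for x using that by blast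
  have "\<forall>\<^sub>F j in sequentially. \<forall>u t. (u, t) \<in> ?K \<longrightarrow> dist (ks j u t) (k u t) < 1"
    by (rule uniform_close[OF conv_k[OF sub]]) simp
  moreover have "\<forall>\<^sub>F j in sequentially. e j < 1" by (rule order_tendstoD(2)[OF e_lim]) simp
  ultimately have ev_f: "\<forall>\<^sub>F j in sequentially. \<forall>u\<in>{-M..M}. \<forall>t\<in>{s0..t0}. reg_curvature (e j) (ks j u t) \<le> Ck + 2"
    using e_pos
  proof eventually_elim
    case (elim j)
    show ?case
    proof (intro ballI)
      fix u t assume "u \<in> {-M..M}" "t \<in> {s0..t0}"
      then have "(u, t) \<in> ?K" by auto
      with elim(1) Ck[of "(u, t)"] norm_triangle_sub[of "ks j u t" "k u t"] have "norm (ks j u t) \<le> Ck + 1"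
        by (fastforce simp: dist_norm)
      with elim(2) reg_curvature_le[OF elim(3), of "ks j u t"] show "reg_curvature (e j) (ks j u t) \<le> Ck + 2" by linarith
    qed
  qed
  have "(0, s0) \<in> ?K" using M s0 by auto
  then have Ck0: "Ck \<ge> 0" using order_trans[OF norm_ge_zero Ck] by blast
  define C' where "C' = max C 1"
  define low where "low = v / 4 / ((Ck + 2) ^ 3 * C')"
  have low: "low > 0" using v Ck0 by (simp add: low_def C'_def)
  have ev_low: "\<forall>\<^sub>F j in sequentially. \<forall>t\<in>{s0..t0}.
      2 * \<delta> * low \<le> total_dissipation j M t"
    using frames times[OF sub] e_pos mC(3) ev_f ev_V
  proof eventually_elim
    case (elim j)
    interpret F: csf_frame "J j" "Xs j" "gs j" "gs' j" "Ts j" "ks j" "k1s j" "k2s j" by (rule elim(1))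
    show ?case
    proof
      fix t assume t: "t \<in> {s0..t0}"
      then have tJ: "t \<in> J j" using elim(2) by auto
      let ?D = "\<lambda>u. dissipation (e j) (ks j u t) (k1s j u t) * gs j u t"
      have cD: "continuous_on S ?D" for S
        by (intro continuous_intros continuous_on_slice[OF F.cont_g tJ] continuous_on_slice[OF F.cont_dissipation[OF elim(3)] tJ])
      have inM: "u \<in> {-M..M}" if "u \<in> {u0 - \<delta>..u0 + \<delta>}" for u
        using that by (auto simp: M_def)
      have "2 * \<delta> * low = integral {u0 - \<delta>..u0 + \<delta>} (\<lambda>u. low)" using \<delta> by simp
      also have "\<dots> \<le> integral {u0 - \<delta>..u0 + \<delta>} ?D"
      proof (rule integral_le)
        fix u assume u: "u \<in> {u0 - \<delta>..u0 + \<delta>}"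
        let ?f = "reg_curvature (e j) (ks j u t)"
        have f: "0 < ?f" "?f \<le> Ck + 2" using elim(3,5) inM[OF u] t by (auto intro: reg_curvature_pos)
        have gg: "0 < gs j u t" "gs j u t \<le> C'" using F.g_pos[OF tJ] elim(4) inM[OF u] t by (auto simp: C'_def le_max_iff_disj)
        have "v / 4 \<le> Vj j (u, t)"
        proof -
          have "(u, t) \<in> ?K" using inM[OF u] t by simp
          with elim(6) have "dist (Vj j (u, t)) (Vl (u, t)) < v / 4" by blast
          with Vl_ge[OF u t] show ?thesis unfolding dist_real_def by linarith
        qed
        then have "low \<le> Vj j (u, t) / (?f ^ 3 * gs j u t)"
          unfolding low_def using v f gg by (intro frac_le mult_mono power_mono) auto
        also have "Vj j (u, t) / (?f ^ 3 * gs j u t) = (((ks j u t \<bullet> ks j u t) * (k1s j u t \<bullet> k1s j u t - (ks j u t \<bullet> ks j u t)\<^sup>2)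
           - (ks j u t \<bullet> k1s j u t)\<^sup>2) / ?f ^ 3) * gs j u t"
          using gg(1) f(1) by (simp add: Vj_def V_g power2_eq_square)
        also have "\<dots> \<le> ?D u"
          using gg(1) by (intro mult_right_mono F.dissipation_ge tJ elim(3)) auto
        finally show "low \<le> ?D u" .
      qed (intro integrable_continuous_interval continuous_intros cD)+
      also have "\<dots> \<le> integral {-M..M} ?D"
      proof (rule integral_subset_le)
        show "{u0 - \<delta>..u0 + \<delta>} \<subseteq> {-M..M}" using inM by blast
        show "\<forall>u\<in>{-M..M}. 0 \<le> ?D u"
          using F.dissipation_nonneg[OF tJ elim(3)] F.g_pos[OF tJ] by (auto intro!: mult_nonneg_nonneg less_imp_le[OF F.g_pos[OF tJ]])
      qed (intro integrable_continuous_interval cD)+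
      finally show "2 * \<delta> * low \<le> integral {-M..M} ?D" .
    qed
  qed
  \<comment> \<open>The constant function \<open>0\<close>, whose derivative is at most the dissipation minus its lower bound, would have to decrease.\<close>
  have Y: "\<forall>\<^sub>F j in sequentially. \<forall>t\<in>{s0..t0}. \<exists>D. ((\<lambda>t::real. 0) has_real_derivative D) (at t within {s0..t0}) \<and>
      D \<le> 1 * total_dissipation j M t + (- (2 * \<delta> * low))"
    using ev_low by eventually_elim (auto intro!: exI[of _ 0])
  have "\<forall>\<^sub>F j in sequentially. (0::real) \<le> 0 + (- (2 * \<delta> * low)) * (t0 - s0) + \<delta> * low * (t0 - s0)"
    by (rule budget_bound[OF sub _ _ Y]) (use s0 \<delta> low in auto)
  then show False using s0 \<delta> low by (simp add: mult_le_0_iff)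
qed

end

section \<open>Planarity\<close>

context csf_frame
begin

text \<open>Equality in Cauchy--Schwarz makes the normal part of \<open>k1\<close> a multiple of \<open>k\<close>, so \<open>k1 = \<alpha> k - |k|\<^sup>2 T\<close>.
  Differentiating once more puts \<open>k2\<close> into the span of \<open>T\<close> and \<open>k\<close> too. Thus, for a fixed vector \<open>z\<close>, the
  pair \<open>(T \<bullet> z, k \<bullet> z)\<close> solves a linear system in \<open>u\<close> and, by the evolution equations, in \<open>t\<close>. If \<open>z\<close> is
  orthogonal to the frame at one point, it is so everywhere, and \<open>X \<bullet> z\<close> is constant.\<close>

lemma planar_if_no_torsion:
  assumes flat: "\<And>u t. t \<in> J \<Longrightarrow>
      (k u t \<bullet> k u t) * (k1 u t \<bullet> k1 u t - (k u t \<bullet> k u t)\<^sup>2) - (k u t \<bullet> k1 u t)\<^sup>2 = 0"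
    and nz: "\<And>u t. t \<in> J \<Longrightarrow> k u t \<noteq> 0" and t0: "t0 \<in> J"
  shows "\<exists>P. affine P \<and> aff_dim P = 2 \<and> (\<forall>u. \<forall>t\<in>J. X u t \<in> P)"
proof -
  define K where "K = (\<lambda>u t. k u t \<bullet> k u t)"
  define \<alpha> where "\<alpha> = (\<lambda>u t. (k u t \<bullet> k1 u t) / K u t)"
  define \<alpha>1 where "\<alpha>1 = (\<lambda>u t. (k1 u t \<bullet> k1 u t + k u t \<bullet> k2 u t) / K u t - 2 * (k u t \<bullet> k1 u t)\<^sup>2 / (K u t)\<^sup>2)"
  have K: "K u t > 0" if "t \<in> J" for u t using nz[OF that] by (simp add: K_def)
  have k1_eq: "k1 u t = \<alpha> u t *\<^sub>R k u t - K u t *\<^sub>R T u t" if "t \<in> J" for u t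
  proof -
    define q where "q = k1 u t + K u t *\<^sub>R T u t"
    have kq: "k u t \<bullet> q = k u t \<bullet> k1 u t"
      using T_k[OF that, of u] by (simp add: q_def inner_right_distrib inner_commute)
    have qq: "q \<bullet> q = k1 u t \<bullet> k1 u t - (K u t)\<^sup>2"
      using T_k1[OF that, of u] T_T[OF that, of u]
      by (simp add: q_def inner_simps inner_commute power2_eq_square K_def)
    have "(q - \<alpha> u t *\<^sub>R k u t) \<bullet> (q - \<alpha> u t *\<^sub>R k u t) = q \<bullet> q - 2 * \<alpha> u t * (k u t \<bullet> q) + (\<alpha> u t)\<^sup>2 * K u t"
      by (simp add: inner_simps inner_commute K_def power2_eq_square algebra_simps)
    also have "\<dots> = (K u t * (q \<bullet> q) - (k u t \<bullet> k1 u t)\<^sup>2) / K u t"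
      using K[OF that, of u] by (simp add: kq \<alpha>_def field_simps power2_eq_square)
    also have "\<dots> = 0" using flat[OF that, of u] by (simp add: qq K_def)
    finally have "q = \<alpha> u t *\<^sub>R k u t" by simp
    then show ?thesis by (simp add: q_def algebra_simps)
  qed
  have K_u: "((\<lambda>v. K v t) has_real_derivative g u t * (2 * (k u t \<bullet> k1 u t))) (at u)" if "t \<in> J" for u t
    unfolding K_def by (rule inner_k_u(1)[OF that])
  have \<alpha>_u: "((\<lambda>v. \<alpha> v t) has_real_derivative g u t * \<alpha>1 u t) (at u)" if "t \<in> J" for u t
  proof -
    have "((\<lambda>v. (k v t \<bullet> k1 v t) / K v t) has_real_derivative
      (g u t * (k1 u t \<bullet> k1 u t + k u t \<bullet> k2 u t) * K u t - (k u t \<bullet> k1 u t) * (g u t * (2 * (k u t \<bullet> k1 u t)))) / (K u t * K u t)) (at u)"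
      using K[OF that, of u] by (intro DERIV_divide inner_k_u(2) K_u that) auto
    moreover have "(g u t * (k1 u t \<bullet> k1 u t + k u t \<bullet> k2 u t) * K u t - (k u t \<bullet> k1 u t) * (g u t * (2 * (k u t \<bullet> k1 u t)))) / (K u t * K u t)
      = g u t * \<alpha>1 u t"
      using K[OF that, of u] by (simp add: \<alpha>1_def field_simps power2_eq_square)
    ultimately show ?thesis by (simp add: \<alpha>_def)
  qed
  have k2_eq: "k2 u t = \<alpha>1 u t *\<^sub>R k u t + \<alpha> u t *\<^sub>R k1 u t - (2 * (k u t \<bullet> k1 u t)) *\<^sub>R T u t - K u t *\<^sub>R k u t"
    if "t \<in> J" for u t
  proof -
    have "((\<lambda>v. \<alpha> v t *\<^sub>R k v t - K v t *\<^sub>R T v t) has_vector_derivative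
      (\<alpha> u t *\<^sub>R (g u t *\<^sub>R k1 u t) + (g u t * \<alpha>1 u t) *\<^sub>R k u t) -
      (K u t *\<^sub>R (g u t *\<^sub>R k u t) + (g u t * (2 * (k u t \<bullet> k1 u t))) *\<^sub>R T u t)) (at u)"
      by (intro has_vector_derivative_diff has_vector_derivative_scaleR \<alpha>_u k_u K_u T_u that)
    then have "((\<lambda>v. k1 v t) has_vector_derivative
      (\<alpha> u t *\<^sub>R (g u t *\<^sub>R k1 u t) + (g u t * \<alpha>1 u t) *\<^sub>R k u t) -
      (K u t *\<^sub>R (g u t *\<^sub>R k u t) + (g u t * (2 * (k u t \<bullet> k1 u t))) *\<^sub>R T u t)) (at u)"
      by (simp add: k1_eq[OF that])
    from vector_derivative_unique_at[OF k1_u[OF that] this]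
    have "g u t *\<^sub>R k2 u t = g u t *\<^sub>R (\<alpha>1 u t *\<^sub>R k u t + \<alpha> u t *\<^sub>R k1 u t - (2 * (k u t \<bullet> k1 u t)) *\<^sub>R T u t - K u t *\<^sub>R k u t)"
      by (simp add: algebra_simps)
    then show ?thesis using g_pos[OF that, of u] by simp
  qed
  have c_K: "continuous_on (UNIV \<times> J) (\<lambda>x. K (fst x) (snd x))"
    using cont_k unfolding K_def split_beta by (intro continuous_intros)
  have K_nz: "\<forall>x\<in>UNIV \<times> J. K (fst x) (snd x) \<noteq> 0"
  proof
    fix x :: "real \<times> real" assume "x \<in> UNIV \<times> J"
    then have "snd x \<in> J" by auto
    from K[OF this, of "fst x"] show "K (fst x) (snd x) \<noteq> 0" by simp
  qed
  have c_\<alpha>: "continuous_on (UNIV \<times> J) (\<lambda>x. \<alpha> (fst x) (snd x))"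
    using cont_k cont_k1 c_K K_nz unfolding \<alpha>_def split_beta by (intro continuous_intros)
  have c_\<alpha>1: "continuous_on (UNIV \<times> J) (\<lambda>x. \<alpha>1 (fst x) (snd x))"
    using cont_k cont_k1 cont_k2 c_K K_nz unfolding \<alpha>1_def split_beta by (intro continuous_intros) auto
  have slice_t: "continuous_on S (\<lambda>t. h u t)" if "continuous_on (UNIV \<times> J) (\<lambda>x. h (fst x) (snd x))" "S \<subseteq> J"
    for h :: "real \<Rightarrow> real \<Rightarrow> real" and u S
  proof -
    have "continuous_on S (\<lambda>t. h (fst (u, t)) (snd (u, t)))"
      by (rule continuous_on_compose2[OF that(1)]) (use that(2) in \<open>auto intro!: continuous_intros\<close>)
    then show ?thesis by simp
  qed
  have slice_u: "continuous_on S (\<lambda>u. h u t)" if "continuous_on (UNIV \<times> J) (\<lambda>x. h (fst x) (snd x))" "t \<in> J"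
    for h :: "real \<Rightarrow> real \<Rightarrow> real" and t S
    using continuous_on_slice[of J h t S] that by (simp add: split_beta)
  have c_g: "continuous_on (UNIV \<times> J) (\<lambda>x. g (fst x) (snd x))" using cont_g by (simp add: split_beta)
  let ?T = "T 0 t0" and ?k = "k 0 t0"
  have inner_vd: "((\<lambda>x. f x \<bullet> z) has_real_derivative d \<bullet> z) F" if "(f has_vector_derivative d) F" for f :: "real \<Rightarrow> 'a" and d F z
    using bounded_linear.has_vector_derivative[OF bounded_linear_inner_left that]
    by (simp add: has_real_derivative_iff_has_vector_derivative)
  have main: "(X u t - X 0 t0) \<bullet> z = 0" if z: "?T \<bullet> z = 0" "?k \<bullet> z = 0" and t: "t \<in> J" for u t z
  proof -
    define l where "l = min t t0"
    define r where "r = max t t0"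
    have sub: "{l..r} \<subseteq> J" and tlr: "t \<in> {l..r}" "t0 \<in> {l..r}"
      using interval_subset[OF J, of l r] t t0 by (auto simp: l_def r_def min_def max_def)
    have time: "T 0 s \<bullet> z = 0" "k 0 s \<bullet> z = 0" if s: "s \<in> {l..r}" for s
    proof -
      have a: "((\<lambda>s. T 0 s \<bullet> z) has_real_derivative \<alpha> 0 s * (k 0 s \<bullet> z)) (at s within {l..r})" if "s \<in> {l..r}" for s
      proof -
        have sJ: "s \<in> J" using that sub by auto
        have "k1 0 s + (k 0 s \<bullet> k 0 s) *\<^sub>R T 0 s = \<alpha> 0 s *\<^sub>R k 0 s" by (simp add: k1_eq[OF sJ] K_def)
        then show ?thesis
          using inner_vd[OF has_vector_derivative_within_subset[OF T_t[OF sJ, of 0] sub]] by simp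
      qed
      have b: "((\<lambda>s. k 0 s \<bullet> z) has_real_derivative - (\<alpha> 0 s * K 0 s) * (T 0 s \<bullet> z)
          + (K 0 s + \<alpha>1 0 s + (\<alpha> 0 s)\<^sup>2) * (k 0 s \<bullet> z)) (at s within {l..r})" if "s \<in> {l..r}" for s
      proof -
        have sJ: "s \<in> J" using that sub by auto
        have eq: "k2 0 s + (2 * (k 0 s \<bullet> k1 0 s)) *\<^sub>R T 0 s + (2 * (k 0 s \<bullet> k 0 s)) *\<^sub>R k 0 s
          = \<alpha>1 0 s *\<^sub>R k 0 s + \<alpha> 0 s *\<^sub>R (\<alpha> 0 s *\<^sub>R k 0 s - K 0 s *\<^sub>R T 0 s) + K 0 s *\<^sub>R k 0 s"
          unfolding k2_eq[OF sJ] k1_eq[OF sJ, symmetric] by (simp add: K_def algebra_simps) (simp add: scaleR_left_distrib[symmetric])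
        show ?thesis
          by (rule DERIV_cong[OF inner_vd[OF has_vector_derivative_within_subset[OF k_t[OF sJ, of 0] sub], of z]])
            (unfold eq, simp add: inner_simps power2_eq_square algebra_simps)
      qed
      show "T 0 s \<bullet> z = 0" "k 0 s \<bullet> z = 0"
        by (rule linear_system_zero[OF a b _ _ _ tlr(2) z s],
            (intro continuous_intros slice_t[OF c_\<alpha> sub] slice_t[OF c_\<alpha>1 sub] slice_t[OF c_K sub] | assumption)+)+
    qed
    have "X 0 t \<bullet> z = X 0 t0 \<bullet> z"
    proof (rule constant_within[OF _ tlr])
      fix s assume s: "s \<in> {l..r}"
      then have sJ: "s \<in> J" using sub by auto
      show "((\<lambda>s. X 0 s \<bullet> z) has_real_derivative 0) (at s within {l..r})"
        using inner_vd[OF has_vector_derivative_within_subset[OF X_t[OF sJ, of 0] sub], of z] time(2)[OF s] by simp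
    qed
    moreover have "X u t \<bullet> z = X 0 t \<bullet> z"
    proof -
      define l where "l = min u 0"
      define r where "r = max u 0"
      have ulr: "u \<in> {l..r}" "0 \<in> {l..r}" by (auto simp: l_def r_def)
      have space: "T v t \<bullet> z = 0" if v: "v \<in> {l..r}" for v
      proof -
        have a: "((\<lambda>v. T v t \<bullet> z) has_real_derivative g v t * (k v t \<bullet> z)) (at v within {l..r})" for v
          using inner_vd[OF has_vector_derivative_at_within[OF T_u[OF t, of v]]] by simp
        have b: "((\<lambda>v. k v t \<bullet> z) has_real_derivative - (g v t * K v t) * (T v t \<bullet> z) + (g v t * \<alpha> v t) * (k v t \<bullet> z)) (at v within {l..r})" for v
        proof -
          have "(g v t *\<^sub>R k1 v t) \<bullet> z = - (g v t * K v t) * (T v t \<bullet> z) + (g v t * \<alpha> v t) * (k v t \<bullet> z)"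
            unfolding k1_eq[OF t] by (simp add: inner_simps algebra_simps)
          then show ?thesis
            using inner_vd[OF has_vector_derivative_at_within[OF k_u[OF t, of v]]] by metis
        qed
        show ?thesis
          by (rule linear_system_zero(1)[OF a b _ _ _ ulr(2) time[OF tlr(1)] v])
            (intro continuous_intros slice_u[OF c_\<alpha> t] slice_u[OF c_g t] slice_u[OF c_K t])+
      qed
      show ?thesis
      proof (rule constant_within[OF _ ulr])
        fix v assume v: "v \<in> {l..r}"
        show "((\<lambda>v. X v t \<bullet> z) has_real_derivative 0) (at v within {l..r})"
          using inner_vd[OF has_vector_derivative_at_within[OF X_u[OF t, of v]], of z] space[OF v] by simp
      qed
    qed
    ultimately show ?thesis by (simp add: inner_diff_left)
  qed
  define S where "S = span {?T, ?k}"
  have Tk0: "?T \<bullet> ?k = 0" by (rule T_k[OF t0])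
  have nzT: "?T \<noteq> 0" using T_T[OF t0, of 0] by auto
  have nzk: "?k \<noteq> 0" by (rule nz[OF t0])
  have ne: "?T \<noteq> ?k" using Tk0 nzT by auto
  have "independent {?T, ?k}"
    by (rule pairwise_orthogonal_independent)
      (use Tk0 nzT nzk in \<open>auto simp: pairwise_def orthogonal_def inner_commute\<close>)
  then have "dim S = 2" unfolding S_def using ne by (simp add: dim_eq_card_independent)
  moreover have subS: "subspace S" by (simp add: S_def)
  ultimately have "aff_dim ((+) (X 0 t0) ` S) = 2"
    by (simp add: aff_dim_translation_eq aff_dim_subspace)
  moreover have "affine ((+) (X 0 t0) ` S)"
    using subspace_imp_affine[OF subS] affine_translation[of S "X 0 t0"] by blast
  moreover have "X u t \<in> (+) (X 0 t0) ` S" if t: "t \<in> J" for u t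
  proof -
    obtain y z where yz: "y \<in> span {?T, ?k}" "\<And>w. w \<in> span {?T, ?k} \<Longrightarrow> orthogonal z w" "X u t - X 0 t0 = y + z"
      using orthogonal_subspace_decomp_exists[of "{?T, ?k}" "X u t - X 0 t0"] by blast
    have "?T \<bullet> z = 0" "?k \<bullet> z = 0"
      using yz(2)[of ?T] yz(2)[of ?k] by (auto simp: orthogonal_def inner_commute span_base)
    from main[OF this t, of u] have "(y + z) \<bullet> z = 0" by (simp add: yz(3))
    moreover have "y \<bullet> z = 0" using yz(2)[OF yz(1)] by (simp add: orthogonal_def inner_commute)
    ultimately have "z = 0" by (simp add: inner_add_left)
    with yz have "X u t = X 0 t0 + y" "y \<in> S" by (auto simp: S_def algebra_simps)
    then show ?thesis by blast
  qed
  ultimately show ?thesis by blast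
qed

lemma speed_nonincreasing:
  assumes "s \<le> t" "s \<in> J" "t \<in> J"
  shows "g u t \<le> g u s"
proof -
  have sub: "{s..t} \<subseteq> J" by (rule interval_subset[OF J assms(2,3)])
  show ?thesis
  proof (rule nonincreasing_within[OF assms(1)])
    fix x assume "x \<in> {s..t}"
    then have x: "x \<in> J" using sub by auto
    show "(g u has_real_derivative - (k u x \<bullet> k u x) * g u x) (at x within {s..t})"
      by (rule has_field_derivative_subset[OF g_t[OF x] sub])
    show "- (k u x \<bullet> k u x) * g u x \<le> 0"
      using g_pos[OF x, of u] by simp
  qed
qed

text \<open>On an arc of length at most \<open>1 / (2 C)\<close> the tangent keeps an inner product of at least \<open>1 / 2\<close> with its initial
  value, so the curve moves forward in that direction.\<close>

lemma no_short_loop: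
  assumes t: "t \<in> J" and ab: "a < b" and g1: "\<And>v. g v t = 1"
    and k: "\<And>v. v \<in> {a..b} \<Longrightarrow> norm (k v t) \<le> C" and C: "C * (b - a) \<le> 1 / 2"
  shows "X a t \<noteq> X b t"
proof
  assume eq: "X a t = X b t"
  define e where "e = T a t"
  have e: "norm e = 1" using T_T[OF t, of a] by (simp add: e_def norm_eq_1)
  have inner_vd: "((\<lambda>x. f x \<bullet> e) has_real_derivative d \<bullet> e) F" if "(f has_vector_derivative d) F" for f :: "real \<Rightarrow> 'a" and d F
    using bounded_linear.has_vector_derivative[OF bounded_linear_inner_left that]
    by (simp add: has_real_derivative_iff_has_vector_derivative)
  have Te: "1 / 2 \<le> T v t \<bullet> e" if v: "v \<in> {a..b}" for v
  proof -
    have "- (T v t \<bullet> e) - C * v \<le> - (T a t \<bullet> e) - C * a"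
    proof (rule nonincreasing_within[of a v "\<lambda>x. - (T x t \<bullet> e) - C * x"])
      fix x assume x: "x \<in> {a..v}"
      show "((\<lambda>x. - (T x t \<bullet> e) - C * x) has_real_derivative - (k x t \<bullet> e) - C) (at x within {a..v})"
        using inner_vd[OF has_vector_derivative_at_within[OF T_u[OF t, of x]]]
        by (auto intro!: derivative_eq_intros simp: g1)
      have "\<bar>k x t \<bullet> e\<bar> \<le> C" using Cauchy_Schwarz_ineq2[of "k x t" e] k[of x] x v e by auto
      then show "- (k x t \<bullet> e) - C \<le> 0" by linarith
    qed (use v in auto)
    moreover have "T a t \<bullet> e = 1" using T_T[OF t] by (simp add: e_def)
    moreover have "C * (v - a) \<le> 1 / 2"
    proof -
      have "0 \<le> C" using order_trans[OF norm_ge_zero k[of a]] ab by auto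
      then have "C * (v - a) \<le> C * (b - a)" using v by (intro mult_left_mono) auto
      with C show ?thesis by linarith
    qed
    ultimately show ?thesis by (simp add: right_diff_distrib)
  qed
  have "1 / 2 * b - X b t \<bullet> e \<le> 1 / 2 * a - X a t \<bullet> e"
  proof (rule nonincreasing_within[of a b "\<lambda>x. 1 / 2 * x - X x t \<bullet> e"])
    fix x assume x: "x \<in> {a..b}"
    show "((\<lambda>x. 1 / 2 * x - X x t \<bullet> e) has_real_derivative 1 / 2 - T x t \<bullet> e) (at x within {a..b})"
      using inner_vd[OF has_vector_derivative_at_within[OF X_u[OF t, of x]]]
      by (auto intro!: derivative_eq_intros simp: g1)
    show "1 / 2 - T x t \<bullet> e \<le> 0" using Te[OF x] by simp
  qed (use ab in auto)
  with eq ab show False by simp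
qed

end

context csf_approximation
begin

text \<open>A zero of \<open>k\<close> at time \<open>t\<close> makes the flow straight at all times before \<open>t\<close>. If \<open>t > 0\<close> this includes time
  \<open>0\<close>. If \<open>t \<le> 0\<close>, straightness propagates from time \<open>t - 1\<close> up to \<open>0\<close>, since \<open>g \<ge> 1\<close> at
  nonpositive times.\<close>

theorem curvature_never_zero:
  assumes I: "{..0} \<subseteq> I" and g0: "\<And>u. g u 0 = 1" and k0: "k 0 0 \<noteq> 0" and t: "t \<in> I"
  shows "k u t \<noteq> 0"
proof
  assume zero: "k u t = 0"
  have past: "k v s = 0" if "s \<in> I" "s < t" for v s
    using strong_maximum_principle[OF that(1) t that(2), of v u] zero by blast
  have "0 \<in> I" using I by auto
  show False
  proof (cases "t > 0")
    case True
    with past[OF \<open>0 \<in> I\<close>] k0 show False by simp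
  next
    case False
    have sub: "{t - 1..0} \<subseteq> I" using I by auto
    have "k 0 0 = 0"
    proof (rule straight_stays_straight[OF _ sub])
      have "t - 1 \<in> I" using sub False by auto
      then show "k v (t - 1) = 0" for v by (rule past) simp
      show "1 \<le> g v s" if "s \<in> {t - 1..0}" for v s
        using speed_nonincreasing[of s 0 v] that sub \<open>0 \<in> I\<close> g0[of v] by auto
    qed (use False in auto)
    with k0 show False by simp
  qed
qed

end

section \<open>Blow-up sequences\<close>

lemma space_deriv_periodic:
  assumes "\<And>u. f (u + p) = f u"
  shows "space_deriv f (u + p) t = space_deriv f u t"
proof -
  have "((\<lambda>v. f v t) has_vector_derivative d) (at (u + p)) \<longleftrightarrow> ((\<lambda>v. f v t) has_vector_derivative d) (at u)" for d
  proof
    assume "((\<lambda>v. f v t) has_vector_derivative d) (at (u + p))"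
    moreover have "((\<lambda>v. v + p) has_vector_derivative 1) (at u)"
      by (auto intro!: derivative_eq_intros)
    ultimately have "((\<lambda>v. f v t) \<circ> (\<lambda>v. v + p) has_vector_derivative 1 *\<^sub>R d) (at u)"
      by (intro vector_diff_chain_at)
    then show "((\<lambda>v. f v t) has_vector_derivative d) (at u)" by (simp add: o_def assms)
  next
    assume "((\<lambda>v. f v t) has_vector_derivative d) (at u)"
    moreover have "((\<lambda>v. v - p) has_vector_derivative 1) (at (u + p))"
      by (auto intro!: derivative_eq_intros)
    ultimately have "((\<lambda>v. f v t) \<circ> (\<lambda>v. v - p) has_vector_derivative 1 *\<^sub>R d) (at (u + p))"
      using vector_diff_chain_at[of "\<lambda>v. v - p" 1 "u + p" "\<lambda>v. f v t" d] by simp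
    moreover have "f (v - p) = f v" for v using assms[of "v - p"] by simp
    ultimately show "((\<lambda>v. f v t) has_vector_derivative d) (at (u + p))" by (simp add: o_def)
  qed
  then show ?thesis by (simp add: space_deriv_def vector_derivative_def)
qed

lemma closed_csf_frame_of_circle:
  fixes \<gamma> :: "complex \<Rightarrow> real \<Rightarrow> real ^ 'n"
  assumes "csf_circle \<omega> \<gamma>"
  defines "c \<equiv> lift_circle \<gamma>" and "J \<equiv> {0..<\<omega>}"
  shows "closed_csf_frame J c (frame_speed c) (frame_speed' c) (frame_T c)
    (frame_k J c) (frame_k1 J c) (frame_k2 J c) (2 * pi)"
proof -
  have sol: "csf_solution J c" using assms by (simp add: csf_circle_def)
  have J: "is_interval J" by (simp add: J_def is_interval_co)
  interpret csf_frame J c "frame_speed c" "frame_speed' c" "frame_T c" "frame_k J c" "frame_k1 J c" "frame_k2 J c"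
    by (rule csf_frame_of_solution[OF J sol])
  have per: "c (u + 2 * pi) = c u" for u
    by (simp add: c_def lift_circle_def cis_mult[symmetric] fun_eq_iff)
  have per_k: "frame_k J c (u + 2 * pi) = frame_k J c u" for u
    by (simp add: frame_k_def time_deriv_def per)
  show ?thesis
    by unfold_locales
      (simp_all add: frame_speed_def frame_k1_def space_deriv_periodic[where f = c and p = "2 * pi", OF per]
        space_deriv_periodic[where f = "frame_k J c" and p = "2 * pi", OF per_k] per_k)
qed

lemma rescaled_times_eq:
  assumes "l > 0"
  shows "rescaled_times \<omega> l t0 = {\<tau>. t0 + \<tau> / l\<^sup>2 \<in> {0..<\<omega>}}"
  using assms by (auto simp: rescaled_times_def field_simps)

text \<open>A strictly increasing reparametrisation to unit speed has derivative \<open>1 / (l g)\<close>, as required for the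
  frame of the rescaled flow.\<close>

lemma rescaled_solution_frame:
  fixes \<gamma> :: "complex \<Rightarrow> real \<Rightarrow> real ^ 'n"
  assumes \<gamma>: "csf_circle \<omega> \<gamma>" and t0: "t0 \<in> {0..<\<omega>}" and l: "circle_curvature \<gamma> q t0 > 0"
    and h: "rescaled_solution \<gamma> q t0 h"
  defines "c \<equiv> lift_circle \<gamma>" and "l \<equiv> circle_curvature \<gamma> q t0"
  obtains L :: "real ^ 'n \<Rightarrow> real ^ 'n" and \<phi> b where "orthogonal_transformation L" "\<phi> 0 = Arg q"
    "\<And>v. (\<phi> has_real_derivative 1 / (l * frame_speed c (\<phi> v) t0)) (at v)"
    "h = (\<lambda>v \<tau>. l *\<^sub>R (L (c (\<phi> v) (t0 + \<tau> / l\<^sup>2)) + b))"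
proof -
  define J where "J = {0..<\<omega>}"
  interpret O: closed_csf_frame J c "frame_speed c" "frame_speed' c" "frame_T c" "frame_k J c" "frame_k1 J c"
    "frame_k2 J c" "2 * pi"
    unfolding J_def c_def by (rule closed_csf_frame_of_circle[OF \<gamma>])
  have t0J: "t0 \<in> J" using t0 by (simp add: J_def)
  have l: "l > 0" using l by (simp add: l_def)
  obtain A b \<phi> where rot: "rotation_matrix A"
    and arc: "arclength_parametrisation (\<lambda>u. rescaled_family \<gamma> l t0 A b u 0) (Arg q) \<phi>"
    and h_eq: "h = (\<lambda>v \<tau>. rescaled_family \<gamma> l t0 A b (\<phi> v) \<tau>)"
    using h unfolding rescaled_solution_def Let_def l_def by blast
  define L where "L = (\<lambda>x. A *v x)"
  have L: "orthogonal_transformation L"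
    using rot by (simp add: L_def rotation_matrix_def orthogonal_transformation_matrix matrix_vector_mul_linear
        matrix_of_matrix_vector_mul)
  have bl: "bounded_linear L"
    using L by (simp add: orthogonal_transformation_linear linear_conv_bounded_linear[symmetric])
  have fam: "rescaled_family \<gamma> l t0 A b = (\<lambda>u \<tau>. l *\<^sub>R (L (c u (t0 + \<tau> / l\<^sup>2)) + b))"
    by (simp add: rescaled_family_def L_def c_def)
  have \<phi>0: "\<phi> 0 = Arg q" and mono: "strict_mono \<phi>" and diff: "\<And>v. \<phi> differentiable (at v)"
    and unit: "\<And>v. norm (vector_derivative ((\<lambda>u. l *\<^sub>R (L (c u t0) + b)) \<circ> \<phi>) (at v)) = 1"
    using arc by (auto simp: arclength_parametrisation_def fam)
  have "(\<phi> has_real_derivative 1 / (l * frame_speed c (\<phi> v) t0)) (at v)" for v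
  proof -
    obtain D where D: "(\<phi> has_real_derivative D) (at v)"
      using diff[of v] real_differentiable_def by blast
    have "D \<ge> 0"
      using mono by (intro mono_on_imp_deriv_nonneg[of UNIV \<phi> D v] D) (auto simp: mono_on_def strict_mono_less_eq)
    have g: "frame_speed c (\<phi> v) t0 > 0" by (rule O.g_pos[OF t0J])
    have "((\<lambda>u. l *\<^sub>R (L (c u t0) + b)) has_vector_derivative
        l *\<^sub>R (L (frame_speed c (\<phi> v) t0 *\<^sub>R frame_T c (\<phi> v) t0) + 0)) (at (\<phi> v))"
      by (intro bounded_linear.has_vector_derivative[OF bounded_linear_scaleR_right[of l]]
          has_vector_derivative_add bounded_linear.has_vector_derivative[OF bl] O.X_u[OF t0J] has_vector_derivative_const)
    from vector_diff_chain_at[OF D[unfolded has_real_derivative_iff_has_vector_derivative] this]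
    have "norm (D *\<^sub>R l *\<^sub>R (L (frame_speed c (\<phi> v) t0 *\<^sub>R frame_T c (\<phi> v) t0))) = 1"
      using unit[of v] vector_derivative_at by fastforce
    moreover have "norm (L (frame_speed c (\<phi> v) t0 *\<^sub>R frame_T c (\<phi> v) t0)) = frame_speed c (\<phi> v) t0"
      using O.T_T[OF t0J, of "\<phi> v"] g by (simp add: orthogonal_transformation_norm[OF L] norm_eq_1)
    ultimately have "D * (l * frame_speed c (\<phi> v) t0) = 1"
      using \<open>D \<ge> 0\<close> l by simp
    then have "D = 1 / (l * frame_speed c (\<phi> v) t0)"
      using l g by (simp add: field_simps)
    with D show ?thesis by simp
  qed
  then show thesis
    using L \<phi>0 by (intro that[of L \<phi> b]) (simp_all add: h_eq fam)
qed

text \<open>The regularisation \<open>1 / (j + 1)\<close> of the original flow becomes \<open>e j = 1 / ((j + 1) l j)\<close> after rescaling. The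
  budget \<open>G j\<close> is the regularised total curvature of the closed curve as a function of rescaled time. The factor
  \<open>N\<close> bounds how often the interval \<open>[-M, M]\<close> winds around the closed curve: the curvature of the rescaled curves is bounded
  there at time \<open>0\<close>, so by \<open>no_short_loop\<close> each turn has a definite length.\<close>

theorem blow_up_limit_approximation:
  fixes \<gamma> :: "complex \<Rightarrow> real \<Rightarrow> real ^ 'n" and \<Gamma> :: "real \<Rightarrow> real \<Rightarrow> real ^ 'n"
  assumes \<gamma>: "csf_circle \<omega> \<gamma>" and lim: "blow_up_limit \<omega> \<gamma> I \<Gamma>"
  obtains J Xs gs gs' Ts ks k1s k2s e G where
    "csf_approximation I \<Gamma> (frame_speed \<Gamma>) (frame_speed' \<Gamma>) (frame_T \<Gamma>) (frame_k I \<Gamma>) (frame_k1 I \<Gamma>)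
      (frame_k2 I \<Gamma>) J Xs gs gs' Ts ks k1s k2s e G"
    "\<And>u. frame_speed \<Gamma> u 0 = 1" "norm (frame_k I \<Gamma> 0 0) = 1"
proof -
  have I: "is_interval I" and I0: "{..0} \<subseteq> I" and sol: "csf_solution I \<Gamma>"
    using lim by (auto simp: blow_up_limit_def)
  obtain p t h r where bs: "blow_up_sequence \<omega> \<gamma> p t"
    and resc: "\<And>j. circle_curvature \<gamma> (p j) (t j) > 0 \<Longrightarrow> rescaled_solution \<gamma> (p j) (t j) (h j)"
    and r: "strict_mono (r :: nat \<Rightarrow> nat)"
    and conv: "converges_smoothly
          (\<lambda>j. rescaled_times \<omega> (circle_curvature \<gamma> (p (r j)) (t (r j))) (t (r j))) (\<lambda>j. h (r j)) I \<Gamma>"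
    using lim unfolding blow_up_limit_def by blast
  define J0 where "J0 = {0..<\<omega>}"
  define c where "c = lift_circle \<gamma>"
  define l where "l = (\<lambda>j. circle_curvature \<gamma> (p (r j)) (t (r j)))"
  define t0 where "t0 = (\<lambda>j. t (r j))"
  define J where "J = (\<lambda>j. rescaled_times \<omega> (l j) (t0 j))"
  define Xs where "Xs = (\<lambda>j. h (r j))"
  have \<omega>: "\<omega> > 0" using \<gamma> by (simp add: csf_circle_def)
  interpret O: closed_csf_frame J0 c "frame_speed c" "frame_speed' c" "frame_T c" "frame_k J0 c" "frame_k1 J0 c"
    "frame_k2 J0 c" "2 * pi"
    unfolding J0_def c_def by (rule closed_csf_frame_of_circle[OF \<gamma>])
  interpret F: csf_frame I \<Gamma> "frame_speed \<Gamma>" "frame_speed' \<Gamma>" "frame_T \<Gamma>" "frame_k I \<Gamma>" "frame_k1 I \<Gamma>" "frame_k2 I \<Gamma>"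
    by (rule csf_frame_of_solution[OF I sol])
  have t0J: "t0 j \<in> J0" for j using bs by (simp add: blow_up_sequence_def t0_def J0_def)
  have t0_lim: "t0 \<longlonglongrightarrow> \<omega>"
    using bs LIMSEQ_subseq_LIMSEQ[of t \<omega> r] r by (simp add: blow_up_sequence_def t0_def o_def)
  have l_sq: "filterlim (\<lambda>j. (l j)\<^sup>2) at_top sequentially"
    using bs filterlim_compose[OF _ filterlim_subseq[OF r]] unfolding blow_up_sequence_def l_def by blast
  have l_nn: "l j \<ge> 0" for j by (simp add: l_def circle_curvature_def curvature_def)
  have good: "\<forall>\<^sub>F j in sequentially. l j > 1"
  proof -
    have "\<forall>\<^sub>F j in sequentially. (l j)\<^sup>2 > 1" using l_sq by (simp add: filterlim_at_top_dense)
    then show ?thesis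
    proof eventually_elim
      case (elim j)
      then have "1\<^sup>2 < (l j)\<^sup>2" by simp
      then show ?case using l_nn[of j] by (rule power2_less_imp_less)
    qed
  qed
  define normalises where "normalises = (\<lambda>j L \<phi> b. orthogonal_transformation (L :: real ^ 'n \<Rightarrow> real ^ 'n) \<and> \<phi> 0 = Arg (p (r j)) \<and>
      (\<forall>v. (\<phi> has_real_derivative 1 / (l j * frame_speed c (\<phi> v) (t0 j))) (at v)) \<and>
      Xs j = (\<lambda>v \<tau>. l j *\<^sub>R (L (c (\<phi> v) (t0 j + \<tau> / (l j)\<^sup>2)) + b)))"
  have "\<exists>L \<phi> b. l j > 0 \<longrightarrow> normalises j L \<phi> b" for j
  proof (cases "l j > 0")
    case True
    obtain L \<phi> b where "orthogonal_transformation L" "\<phi> 0 = Arg (p (r j))"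
      "\<And>v. (\<phi> has_real_derivative 1 / (l j * frame_speed c (\<phi> v) (t0 j))) (at v)"
      "Xs j = (\<lambda>v \<tau>. l j *\<^sub>R (L (c (\<phi> v) (t0 j + \<tau> / (l j)\<^sup>2)) + b))"
      using rescaled_solution_frame[OF \<gamma> t0J[of j, unfolded J0_def] _ , of "p (r j)" "Xs j"] True resc[of "r j"]
      unfolding l_def t0_def Xs_def c_def by blast
    then have "normalises j L \<phi> b" unfolding normalises_def by blast
    then show ?thesis by blast
  qed simp
  then obtain L \<phi> b where "\<And>j. l j > 0 \<Longrightarrow> normalises j (L j) (\<phi> j) (b j)" by metis
  then have L: "orthogonal_transformation (L j)" and \<phi>0: "\<phi> j 0 = Arg (p (r j))"
    and \<phi>: "\<And>v. (\<phi> j has_real_derivative 1 / (l j * frame_speed c (\<phi> j v) (t0 j))) (at v)"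
    and Xs_eq: "Xs j = (\<lambda>v \<tau>. l j *\<^sub>R (L j (c (\<phi> j v) (t0 j + \<tau> / (l j)\<^sup>2)) + b j))" if "l j > 0" for j
    using that unfolding normalises_def by blast+
  define gs where "gs = (\<lambda>j v \<tau>. frame_speed c (\<phi> j v) (t0 j + \<tau> / (l j)\<^sup>2) / frame_speed c (\<phi> j v) (t0 j))"
  define gs' where "gs' = (\<lambda>j v \<tau>. (frame_speed' c (\<phi> j v) (t0 j + \<tau> / (l j)\<^sup>2) * frame_speed c (\<phi> j v) (t0 j)
      - frame_speed c (\<phi> j v) (t0 j + \<tau> / (l j)\<^sup>2) * frame_speed' c (\<phi> j v) (t0 j))
        / (frame_speed c (\<phi> j v) (t0 j))\<^sup>2 * (1 / (l j * frame_speed c (\<phi> j v) (t0 j))))"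
  define Ts where "Ts = (\<lambda>j v \<tau>. L j (frame_T c (\<phi> j v) (t0 j + \<tau> / (l j)\<^sup>2)))"
  define ks where "ks = (\<lambda>j v \<tau>. (1 / l j) *\<^sub>R L j (frame_k J0 c (\<phi> j v) (t0 j + \<tau> / (l j)\<^sup>2)))"
  define k1s where "k1s = (\<lambda>j v \<tau>. (1 / (l j)\<^sup>2) *\<^sub>R L j (frame_k1 J0 c (\<phi> j v) (t0 j + \<tau> / (l j)\<^sup>2)))"
  define k2s where "k2s = (\<lambda>j v \<tau>. (1 / (l j) ^ 3) *\<^sub>R L j (frame_k2 J0 c (\<phi> j v) (t0 j + \<tau> / (l j)\<^sup>2)))"
  have J_eq: "J j = {\<tau>. t0 j + \<tau> / (l j)\<^sup>2 \<in> J0}" if "l j > 0" for j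
    using rescaled_times_eq[OF that] by (simp add: J_def J0_def)
  have frame: "csf_frame (J j) (Xs j) (gs j) (gs' j) (Ts j) (ks j) (k1s j) (k2s j)" if "l j > 0" for j
    unfolding J_eq[OF that] Xs_eq[OF that] gs_def gs'_def Ts_def ks_def k1s_def k2s_def
    by (rule csf_frame_rescale[OF O.csf_frame_axioms that t0J L[OF that] \<phi>[OF that]])
  have nonbot: "at \<tau> within J j \<noteq> bot" if "l j > 0" "\<tau> \<in> J j" for j \<tau>
  proof -
    interpret Fj: csf_frame "J j" "Xs j" "gs j" "gs' j" "Ts j" "ks j" "k1s j" "k2s j" by (rule frame[OF that(1)])
    \<comment> \<open>\<open>J j = {a..<d}\<close>, and \<open>\<omega> > 0\<close> makes it nondegenerate.\<close>
    define a d where "a = - ((l j)\<^sup>2 * t0 j)" and "d = (l j)\<^sup>2 * (\<omega> - t0 j)"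
    have "d - a = (l j)\<^sup>2 * \<omega>" by (simp add: a_def d_def algebra_simps)
    moreover have "(l j)\<^sup>2 * \<omega> > 0" using that(1) \<omega> by simp
    ultimately have "a < d" by linarith
    then have "a \<in> J j" "(a + d) / 2 \<in> J j" "a \<noteq> (a + d) / 2"
      by (auto simp: J_def rescaled_times_def a_def[symmetric] d_def[symmetric])
    then show ?thesis using Fj.J that(2) by (intro at_within_interval_neq_bot)
  qed
  have nonbot_I: "at \<tau> within I \<noteq> bot" if "\<tau> \<in> I" for \<tau>
    by (rule at_within_interval_neq_bot[OF I, of "-1" 0]) (use I0 that in auto)
  have rect: "\<forall>\<^sub>F j in sequentially. {-M..M} \<times> {t1..t2} \<subseteq> UNIV \<times> J j"
    "\<And>k i. uniform_limit ({-M..M} \<times> {t1..t2}) (\<lambda>j (u, t). mixed_deriv (J j) k i (Xs j) u t)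
       (\<lambda>(u, t). mixed_deriv I k i \<Gamma> u t) sequentially" if "{t1..t2} \<subseteq> I" for M t1 t2
  proof -
    have "compact ({-M..M} \<times> {t1..t2})" by (intro compact_Times compact_Icc)
    moreover have "{-M..M} \<times> {t1..t2} \<subseteq> UNIV \<times> I" using that by auto
    ultimately show "\<forall>\<^sub>F j in sequentially. {-M..M} \<times> {t1..t2} \<subseteq> UNIV \<times> J j"
      "\<And>k i. uniform_limit ({-M..M} \<times> {t1..t2}) (\<lambda>j (u, t). mixed_deriv (J j) k i (Xs j) u t)
       (\<lambda>(u, t). mixed_deriv I k i \<Gamma> u t) sequentially"
      using conv unfolding converges_smoothly_def J_def Xs_def l_def t0_def by blast+
  qed
  have times: "\<forall>\<^sub>F j in sequentially. {t1..t2} \<subseteq> J j" if "{t1..t2} \<subseteq> I" for t1 t2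
    using rect(1)[OF that, of 0] by eventually_elim auto
  have ev: "\<forall>\<^sub>F j in sequentially. l j > 0 \<and> {t1..t2} \<subseteq> J j" if "{t1..t2} \<subseteq> I" for t1 t2
    using good times[OF that] by eventually_elim auto
  note Fj = csf_frame.mixed_deriv_1_0[OF frame] csf_frame.mixed_deriv_0_1[OF frame] csf_frame.mixed_deriv_1_1[OF frame]
  have conv_g: "uniform_limit ({-M..M} \<times> {t1..t2}) (\<lambda>j (u, t). gs j u t) (\<lambda>(u, t). frame_speed \<Gamma> u t) sequentially"
    if sub: "{t1..t2} \<subseteq> I" for M t1 t2
  proof (rule uniform_limit_transfer[OF _ ev[OF sub]])
    show "uniform_limit ({-M..M} \<times> {t1..t2}) (\<lambda>j (u, t). norm (mixed_deriv (J j) 1 0 (Xs j) u t))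
       (\<lambda>(u, t). norm (mixed_deriv I 1 0 \<Gamma> u t)) sequentially"
      using uniform_limit_norm[OF rect(2)[OF sub]] by (simp add: case_prod_unfold)
    show "norm (mixed_deriv (J j) 1 0 (Xs j) u t) = gs j u t" if "l j > 0" "t \<in> J j" for j u t
      using arclength_frame.g_pos[OF csf_frame.axioms(1)[OF frame[OF that(1)]] that(2), of u]
        arclength_frame.T_T[OF csf_frame.axioms(1)[OF frame[OF that(1)]] that(2), of u]
      unfolding Fj(1)[OF that] by (simp add: norm_eq_1)
  qed (simp add: mixed_deriv_def frame_speed_def)
  have conv_k: "uniform_limit ({-M..M} \<times> {t1..t2}) (\<lambda>j (u, t). ks j u t) (\<lambda>(u, t). frame_k I \<Gamma> u t) sequentially"
    if sub: "{t1..t2} \<subseteq> I" for M t1 t2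
  proof (rule uniform_limit_transfer[OF rect(2)[OF sub, where k = 0 and i = 1] ev[OF sub]])
    show "mixed_deriv (J j) 0 1 (Xs j) u t = ks j u t" if "l j > 0" "t \<in> J j" for j u t
      using that by (intro Fj nonbot)
  qed (simp add: mixed_deriv_def frame_k_def)
  have conv_gk1: "uniform_limit ({-M..M} \<times> {t1..t2}) (\<lambda>j (u, t). gs j u t *\<^sub>R k1s j u t)
      (\<lambda>(u, t). frame_speed \<Gamma> u t *\<^sub>R frame_k1 I \<Gamma> u t) sequentially"
    if sub: "{t1..t2} \<subseteq> I" for M t1 t2
    using sub by (intro uniform_limit_transfer[OF rect(2)[OF sub, where k = 1 and i = 1] ev[OF sub]] Fj F.mixed_deriv_1_1 nonbot nonbot_I) auto
  have bound_g': "\<exists>B. \<forall>\<^sub>F j in sequentially. \<forall>u\<in>{-M..M}. \<forall>t\<in>{t1..t2}. \<bar>gs' j u t\<bar> \<le> B"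
    if sub: "{t1..t2} \<subseteq> I" for M t1 t2
  proof -
    let ?K = "{-M..M} \<times> {t1..t2}"
    have "continuous_on ?K (\<lambda>x. mixed_deriv I 2 0 \<Gamma> (fst x) (snd x))"
    proof -
      have "continuous_on (UNIV \<times> I) (\<lambda>(u, t). mixed_deriv I 2 0 \<Gamma> u t)"
        using sol by (simp add: csf_solution_def smooth_family_def)
      then have "continuous_on ?K (\<lambda>(u, t). mixed_deriv I 2 0 \<Gamma> u t)"
        by (rule continuous_on_subset) (use sub in auto)
      then show ?thesis by (simp add: split_beta)
    qed
    then have "bounded ((\<lambda>x. mixed_deriv I 2 0 \<Gamma> (fst x) (snd x)) ` ?K)"
      by (intro compact_imp_bounded compact_continuous_image compact_Times compact_Icc)
    then obtain B where "\<forall>y\<in>(\<lambda>x. mixed_deriv I 2 0 \<Gamma> (fst x) (snd x)) ` ?K. norm y \<le> B"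
      unfolding bounded_iff by blast
    then have B: "norm (mixed_deriv I 2 0 \<Gamma> u t) \<le> B" if "u \<in> {-M..M}" "t \<in> {t1..t2}" for u t
      using that by auto
    have "\<forall>\<^sub>F j in sequentially. \<forall>x\<in>?K. dist (case x of (u, t) \<Rightarrow> mixed_deriv (J j) 2 0 (Xs j) u t)
        (case x of (u, t) \<Rightarrow> mixed_deriv I 2 0 \<Gamma> u t) < 1"
      by (rule uniform_limitD[OF rect(2)[OF sub]]) simp
    then have "\<forall>\<^sub>F j in sequentially. \<forall>u\<in>{-M..M}. \<forall>t\<in>{t1..t2}. \<bar>gs' j u t\<bar> \<le> B + 1"
      using ev[OF sub]
    proof eventually_elim
      case (elim j)
      interpret Fj: csf_frame "J j" "Xs j" "gs j" "gs' j" "Ts j" "ks j" "k1s j" "k2s j" using frame elim by blast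
      show ?case
      proof (intro ballI)
        fix u t assume ut: "u \<in> {-M..M}" "t \<in> {t1..t2}"
        then have t: "t \<in> J j" using elim by blast
        have "gs' j u t = Ts j u t \<bullet> mixed_deriv (J j) 2 0 (Xs j) u t"
          unfolding Fj.mixed_deriv_2_0[OF t] using Fj.T_T[OF t, of u] Fj.T_k[OF t, of u] by (simp add: inner_simps)
        then have "\<bar>gs' j u t\<bar> \<le> norm (Ts j u t) * norm (mixed_deriv (J j) 2 0 (Xs j) u t)"
          using Cauchy_Schwarz_ineq2 by simp
        also have "norm (Ts j u t) = 1" using Fj.T_T[OF t, of u] by (simp add: norm_eq_1)
        also have "dist (mixed_deriv (J j) 2 0 (Xs j) u t) (mixed_deriv I 2 0 \<Gamma> u t) < 1"
          using bspec[OF elim(1), of "(u, t)"] ut by simp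
        then have "1 * norm (mixed_deriv (J j) 2 0 (Xs j) u t) \<le> B + 1"
          using B[OF ut] norm_triangle_sub[of "mixed_deriv (J j) 2 0 (Xs j) u t" "mixed_deriv I 2 0 \<Gamma> u t"]
          by (simp add: dist_norm)
        finally show "\<bar>gs' j u t\<bar> \<le> B + 1" .
      qed
    qed
    then show ?thesis by blast
  qed
  have zero_I: "{0..0} \<subseteq> I" using I0 by auto
  have gs0: "gs j v 0 = 1" for j v
    using O.g_pos[OF t0J[of j], of "\<phi> j v"] by (simp add: gs_def)
  have unit: "frame_speed \<Gamma> u 0 = 1" for u
  proof -
    have "(\<lambda>j. (\<lambda>j (u, t). gs j u t) j (u, 0)) \<longlonglongrightarrow> (\<lambda>(u, t). frame_speed \<Gamma> u t) (u, 0)"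
      by (rule tendsto_uniform_limitI[OF conv_g[OF zero_I, of "\<bar>u\<bar>"]]) auto
    then have "(\<lambda>j. 1 :: real) \<longlonglongrightarrow> frame_speed \<Gamma> u 0" by (simp add: gs0)
    then show ?thesis using LIMSEQ_unique[OF tendsto_const] by metis
  qed
  have "(\<lambda>j. norm (ks j 0 0)) \<longlonglongrightarrow> norm (frame_k I \<Gamma> 0 0)"
  proof -
    have "(\<lambda>j. (\<lambda>j (u, t). ks j u t) j (0, 0)) \<longlonglongrightarrow> (\<lambda>(u, t). frame_k I \<Gamma> u t) (0, 0)"
      by (rule tendsto_uniform_limitI[OF conv_k[OF zero_I, of 0]]) auto
    then show ?thesis by (auto intro: tendsto_norm)
  qed
  moreover have "\<forall>\<^sub>F j in sequentially. norm (ks j 0 0) = 1"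
    using good
  proof eventually_elim
    case (elim j)
    then have lj: "l j > 0" by simp
    have "norm (frame_k J0 c (Arg (p (r j))) (t0 j)) = l j"
      using O.curvature_eq[OF t0J[of j], of "Arg (p (r j))"] by (simp add: l_def circle_curvature_def c_def t0_def)
    then show ?case using lj
      by (simp add: ks_def orthogonal_transformation_norm[OF L[OF lj]] \<phi>0[OF lj])
  qed
  then have "(\<lambda>j. norm (ks j 0 0)) \<longlonglongrightarrow> 1" by (rule tendsto_eventually)
  ultimately have k00: "norm (frame_k I \<Gamma> 0 0) = 1" by (rule LIMSEQ_unique)
  \<comment> \<open>The length of the closed curve is bounded, so \<open>\<epsilon> j\<close> times the length tends to zero.\<close>
  define \<epsilon> where "\<epsilon> = (\<lambda>j. inverse (real (Suc j)))"
  define e where "e = (\<lambda>j. \<epsilon> j / l j)"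
  have \<epsilon>: "\<epsilon> j > 0" for j by (simp add: \<epsilon>_def)
  have \<epsilon>_lim: "\<epsilon> \<longlonglongrightarrow> 0" unfolding \<epsilon>_def by (rule LIMSEQ_inverse_real_of_nat)
  have e_pos: "\<forall>\<^sub>F j in sequentially. e j > 0"
    using good by eventually_elim (simp add: e_def \<epsilon>)
  have e_lim: "e \<longlonglongrightarrow> 0"
  proof (rule tendsto_sandwich[OF _ _ tendsto_const \<epsilon>_lim])
    show "\<forall>\<^sub>F j in sequentially. 0 \<le> e j" using e_pos by eventually_elim simp
    show "\<forall>\<^sub>F j in sequentially. e j \<le> \<epsilon> j"
      using good
    proof eventually_elim
      case (elim j)
      have "\<epsilon> j * 1 \<le> \<epsilon> j * l j" using \<epsilon>[of j] elim by (intro mult_left_mono) auto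
      then show ?case using elim by (simp add: e_def pos_divide_le_eq)
    qed
  qed
  define G where "G = (\<lambda>j \<tau>. O.total_reg_curvature (2 * pi) (\<epsilon> j) (t0 j + \<tau> / (l j)\<^sup>2))"
  have budget_lim: "(\<lambda>j. G j t1 - G j t2) \<longlonglongrightarrow> 0" if t12: "t1 \<le> t2" and sub: "{t1..t2} \<subseteq> I" for t1 t2
    unfolding G_def
  proof (rule O.total_reg_curvature_drop[OF J0_def])
    show "t0 j + t1 / (l j)\<^sup>2 \<le> t0 j + t2 / (l j)\<^sup>2" for j
      using t12 by (simp add: divide_right_mono)
    show "\<forall>\<^sub>F j in sequentially. t0 j + t1 / (l j)\<^sup>2 \<in> J0 \<and> t0 j + t2 / (l j)\<^sup>2 \<in> J0"
      using ev[OF sub] by eventually_elim (use t12 J_eq in auto)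
    have "(\<lambda>j. t1 / (l j)\<^sup>2) \<longlonglongrightarrow> 0"
      by (intro tendsto_divide_0[OF tendsto_const] filterlim_at_top_imp_at_infinity l_sq)
    from tendsto_add[OF t0_lim this] show "(\<lambda>j. t0 j + t1 / (l j)\<^sup>2) \<longlonglongrightarrow> \<omega>" by simp
  qed (use \<epsilon> \<epsilon>_lim in auto)
  have winding: "\<exists>N :: nat. \<forall>\<^sub>F j in sequentially. \<phi> j M - \<phi> j (- M) \<le> real N * (2 * pi)" if M: "M \<ge> 0" for M
  proof -
    let ?K = "{-(M + 1)..M + 1} \<times> {0..0::real}"
    have "continuous_on ?K (\<lambda>(u, t). frame_k I \<Gamma> u t)"
      by (rule continuous_on_subset[OF F.cont_k]) (use I0 in auto)
    then have "bounded ((\<lambda>(u, t). frame_k I \<Gamma> u t) ` ?K)"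
      by (intro compact_imp_bounded compact_continuous_image compact_Times compact_Icc)
    then obtain B where "\<forall>y\<in>(\<lambda>(u, t). frame_k I \<Gamma> u t) ` ?K. norm y \<le> B"
      unfolding bounded_iff by blast
    then have B: "norm (frame_k I \<Gamma> u 0) \<le> B" if "u \<in> {-(M + 1)..M + 1}" for u using that by auto
    define C where "C = max B 0 + 1"
    define \<delta> where "\<delta> = 1 / (2 * C)"
    have C: "C \<ge> 1" by (simp add: C_def)
    have \<delta>: "\<delta> > 0" "\<delta> \<le> 1" "C * \<delta> = 1 / 2" using C by (auto simp: \<delta>_def field_simps)
    have "\<forall>\<^sub>F j in sequentially. \<forall>x\<in>?K. dist (case x of (u, t) \<Rightarrow> ks j u t) (case x of (u, t) \<Rightarrow> frame_k I \<Gamma> u t) < 1"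
      by (rule uniform_limitD[OF conv_k[OF zero_I]]) simp
    then have "\<forall>\<^sub>F j in sequentially. \<phi> j M - \<phi> j (- M) \<le> real (nat \<lceil>2 * M / \<delta>\<rceil>) * (2 * pi)"
      using ev[OF zero_I]
    proof eventually_elim
      case (elim j)
      then have lj: "l j > 0" and J0j: "0 \<in> J j" by auto
      interpret Fj: csf_frame "J j" "Xs j" "gs j" "gs' j" "Ts j" "ks j" "k1s j" "k2s j" by (rule frame[OF lj])
      have kC: "norm (ks j u 0) \<le> C" if "u \<in> {-(M + 1)..M + 1}" for u
      proof -
        have "dist (ks j u 0) (frame_k I \<Gamma> u 0) < 1" using bspec[OF elim(1), of "(u, 0)"] that by simp
        with B[OF that] norm_triangle_sub[of "ks j u 0" "frame_k I \<Gamma> u 0"] show ?thesis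
          by (simp add: C_def dist_norm)
      qed
      have "mono (\<phi> j)"
      proof (rule monoI)
        fix x y :: real assume "x \<le> y"
        then show "\<phi> j x \<le> \<phi> j y"
          by (rule DERIV_nonneg_imp_nondecreasing)
            (use \<phi>[OF lj] O.g_pos[OF t0J] lj in \<open>force intro!: less_imp_le\<close>)
      qed
      then show ?case
      proof (rule bounded_increment[OF _ \<delta>(1) M])
        fix v assume v: "v \<in> {-M..M}"
        show "\<phi> j (v + \<delta>) - \<phi> j v \<le> 2 * pi"
        proof (rule ccontr)
          assume "\<not> ?thesis"
          then have "\<phi> j v + 2 * pi \<le> \<phi> j (v + \<delta>)" by simp
          moreover have "\<phi> j v \<le> \<phi> j v + 2 * pi" by simp
          moreover have "continuous_on {v..v + \<delta>} (\<phi> j)"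
            using \<phi>[OF lj] by (meson DERIV_isCont continuous_at_imp_continuous_on)
          ultimately obtain w where w: "v \<le> w" "w \<le> v + \<delta>" "\<phi> j w = \<phi> j v + 2 * pi"
            using IVT'[of "\<phi> j" v "\<phi> j v + 2 * pi" "v + \<delta>"] \<delta>(1) by auto
          then have vw: "v < w" by (cases "v = w") auto
          have "Xs j v 0 \<noteq> Xs j w 0"
          proof (rule Fj.no_short_loop[OF J0j vw gs0])
            show "norm (ks j x 0) \<le> C" if "x \<in> {v..w}" for x
              using that v w \<delta>(2) by (intro kC) auto
            have "C * (w - v) \<le> C * \<delta>" using w C by (intro mult_left_mono) auto
            then show "C * (w - v) \<le> 1 / 2" using \<delta>(3) by simp
          qed
          moreover have "c (\<phi> j v + 2 * pi) s = c (\<phi> j v) s" for s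
            by (simp add: c_def lift_circle_def cis_mult[symmetric])
          ultimately show False by (simp add: Xs_eq[OF lj] w(3))
        qed
      qed simp
    qed
    then show ?thesis by blast
  qed
  have budget: "\<exists>N>0. \<forall>\<^sub>F j in sequentially. \<forall>t\<in>{t1..t2}. \<exists>d.
        (G j has_real_derivative - d) (at t within {t1..t2}) \<and>
        integral {-M..M} (\<lambda>u. dissipation (e j) (ks j u t) (k1s j u t) * gs j u t) \<le> N * d"
    if sub: "{t1..t2} \<subseteq> I" for M t1 t2
  proof -
    define Dt where "Dt = (\<lambda>j \<tau>. 1 / (l j)\<^sup>2 * integral {0..2 * pi} (\<lambda>u. dissipation (\<epsilon> j) (frame_k J0 c u (t0 j + \<tau> / (l j)\<^sup>2))
        (frame_k1 J0 c u (t0 j + \<tau> / (l j)\<^sup>2)) * frame_speed c u (t0 j + \<tau> / (l j)\<^sup>2)))"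
    have G_t: "(G j has_real_derivative - Dt j \<tau>) (at \<tau> within {t1..t2})"
      if lj: "l j > 0" and subj: "{t1..t2} \<subseteq> J j" and \<tau>: "\<tau> \<in> {t1..t2}" for j \<tau>
    proof -
      define \<sigma> where "\<sigma> = (\<lambda>\<tau>. t0 j + \<tau> / (l j)\<^sup>2)"
      have im: "\<sigma> ` {t1..t2} \<subseteq> J0" using subj J_eq[OF lj] by (auto simp: \<sigma>_def)
      have \<sigma>J: "\<sigma> \<tau> \<in> J0" using im \<tau> by auto
      have \<sigma>_t: "(\<sigma> has_real_derivative 1 / (l j)\<^sup>2) (at \<tau> within {t1..t2})"
        unfolding \<sigma>_def by (rule DERIV_cong[OF DERIV_add[OF DERIV_const DERIV_cdivide[OF DERIV_ident]]]) simp
      from DERIV_image_chain[OF has_field_derivative_subset[OF O.total_reg_curvature_t'[OF \<sigma>J \<epsilon>[of j]] im] \<sigma>_t]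
      show ?thesis by (simp add: G_def Dt_def o_def \<sigma>_def)
    qed
    have D_nn: "Dt j \<tau> \<ge> 0" if "l j > 0" "\<tau> \<in> J j" for j \<tau>
      unfolding Dt_def using that J_eq[OF that(1)] O.total_dissipation_nonneg[OF _ \<epsilon>[of j], of "t0 j + \<tau> / (l j)\<^sup>2"]
      by (intro mult_nonneg_nonneg) auto
    show ?thesis
    proof (cases "M \<ge> 0")
      case False
      have "\<forall>\<^sub>F j in sequentially. \<forall>t\<in>{t1..t2}. \<exists>d. (G j has_real_derivative - d) (at t within {t1..t2}) \<and>
        integral {-M..M} (\<lambda>u. dissipation (e j) (ks j u t) (k1s j u t) * gs j u t) \<le> 1 * d"
        using ev[OF sub]
      proof eventually_elim
        case (elim j)
        show ?case
        proof
          fix \<tau> assume \<tau>: "\<tau> \<in> {t1..t2}"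
          with elim have "Dt j \<tau> \<ge> 0" by (intro D_nn) auto
          then show "\<exists>d. (G j has_real_derivative - d) (at \<tau> within {t1..t2}) \<and>
              integral {-M..M} (\<lambda>u. dissipation (e j) (ks j u \<tau>) (k1s j u \<tau>) * gs j u \<tau>) \<le> 1 * d"
            using G_t[of j \<tau>] elim \<tau> False by (intro exI[of _ "Dt j \<tau>"]) auto
        qed
      qed
      then show ?thesis by (intro exI[of _ 1]) auto
    next
      case True
      obtain N :: nat where N: "\<forall>\<^sub>F j in sequentially. \<phi> j M - \<phi> j (- M) \<le> real N * (2 * pi)"
        using winding[OF True] by blast
      have "\<forall>\<^sub>F j in sequentially. \<forall>t\<in>{t1..t2}. \<exists>d. (G j has_real_derivative - d) (at t within {t1..t2}) \<and>
        integral {-M..M} (\<lambda>u. dissipation (e j) (ks j u t) (k1s j u t) * gs j u t) \<le> (real N + 1) * d"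
        using ev[OF sub] N
      proof eventually_elim
        case (elim j)
        show ?case
        proof
          fix \<tau> assume \<tau>: "\<tau> \<in> {t1..t2}"
          have lj: "l j > 0" and \<tau>J: "t0 j + \<tau> / (l j)\<^sup>2 \<in> J0" using elim \<tau> J_eq by auto
          have "integral {-M..M} (\<lambda>u. dissipation (e j) (ks j u \<tau>) (k1s j u \<tau>) * gs j u \<tau>) \<le> (real N + 1) * Dt j \<tau>"
            unfolding e_def ks_def k1s_def gs_def Dt_def
            by (rule O.rescaled_dissipation_le[OF lj t0J L[OF lj] \<phi>[OF lj] \<tau>J \<epsilon> _ elim(2)]) (use True in simp)
          then show "\<exists>d. (G j has_real_derivative - d) (at \<tau> within {t1..t2}) \<and>
              integral {-M..M} (\<lambda>u. dissipation (e j) (ks j u \<tau>) (k1s j u \<tau>) * gs j u \<tau>) \<le> (real N + 1) * d"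
            using G_t[of j \<tau>] elim \<tau> by blast
        qed
      qed
      then show ?thesis by (intro exI[of _ "real N + 1"]) auto
    qed
  qed
  have frames: "\<forall>\<^sub>F j in sequentially. csf_frame (J j) (Xs j) (gs j) (gs' j) (Ts j) (ks j) (k1s j) (k2s j)"
    using good by eventually_elim (simp add: frame)
  have "csf_approximation I \<Gamma> (frame_speed \<Gamma>) (frame_speed' \<Gamma>) (frame_T \<Gamma>) (frame_k I \<Gamma>) (frame_k1 I \<Gamma>)
      (frame_k2 I \<Gamma>) J Xs gs gs' Ts ks k1s k2s e G"
    by unfold_locales
      (rule frames e_pos e_lim times conv_g conv_k conv_gk1 bound_g' budget budget_lim; assumption)+
  then show thesis using unit k00 by (rule that)
qed

theorem theorem4p4:
  fixes \<gamma> :: "complex \<Rightarrow> real \<Rightarrow> real ^ 'n"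
    and \<Gamma> :: "real \<Rightarrow> real \<Rightarrow> real ^ 'n"
    and \<omega> :: real and I :: "real set"
  assumes "CARD('n) \<ge> 2"
    and "csf_circle \<omega> \<gamma>"
    and "singularity_at \<omega> \<gamma>"
    and "blow_up_limit \<omega> \<gamma> I \<Gamma>"
    and "\<not> is_straight_line I \<Gamma>"
  shows "planar I \<Gamma> \<and> convex_family I \<Gamma>"
proof -
  have I: "{..0} \<subseteq> I" "is_interval I" using assms(4) by (auto simp: blow_up_limit_def)
  obtain J Xs gs gs' Ts ks k1s k2s e G where approx:
    "csf_approximation I \<Gamma> (frame_speed \<Gamma>) (frame_speed' \<Gamma>) (frame_T \<Gamma>) (frame_k I \<Gamma>) (frame_k1 I \<Gamma>)
      (frame_k2 I \<Gamma>) J Xs gs gs' Ts ks k1s k2s e G"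
    and unit: "\<And>u. frame_speed \<Gamma> u 0 = 1" and k0: "norm (frame_k I \<Gamma> 0 0) = 1"
    using blow_up_limit_approximation[OF assms(2,4)] by metis
  interpret csf_approximation I \<Gamma> "frame_speed \<Gamma>" "frame_speed' \<Gamma>" "frame_T \<Gamma>" "frame_k I \<Gamma>" "frame_k1 I \<Gamma>"
    "frame_k2 I \<Gamma>" J Xs gs gs' Ts ks k1s k2s e G by (rule approx)
  have "frame_k I \<Gamma> 0 0 \<noteq> 0" using k0 by auto
  then have nz: "frame_k I \<Gamma> u t \<noteq> 0" if "t \<in> I" for u t
    by (rule curvature_never_zero[OF I(1) unit _ that])
  have earlier: "\<exists>t'\<in>I. t' < t" if "t \<in> I" for t
    using I(1) by (intro bexI[of _ "min t 0 - 1"]) auto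
  have "\<exists>P. affine P \<and> aff_dim P = 2 \<and> (\<forall>u. \<forall>t\<in>I. \<Gamma> u t \<in> P)"
  proof (rule planar_if_no_torsion[OF _ nz])
    show "0 \<in> I" using I by auto
  qed (use earlier limit_dissipation_zero in blast)+
  moreover have "convex_family I \<Gamma>"
    unfolding convex_family_def using nz by (simp add: curvature_eq)
  ultimately show ?thesis by (simp add: planar_def)
qed

end
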